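(* Let $H$ be a separable infinite-dimensional Hilbert space and let $\mathscr{Q}(H)=\mathscr{B}(H)/\mathscr{K}(H)$ be the Calkin algebra. Assume the continuum hypothesis. Then there exists an irreducible representation of $\mathscr{Q}(H)$ which admits infinite transitivity.
   Context: $\mathscr{B}(H)$ denotes the bounded operators and $\mathscr{K}(H)$ the compact operators on $H$. A representation $\pi:C\to\mathscr{B}(L)$ of a $C^*$-algebra $C$ on a Hilbert space $L$ admits infinite transitivity if for every separable (closed) subspace $K$ of $L$, the map $C\to\mathscr{B}(K)$, $c\mapsto P_K\pi(c)P_K$, is onto, where $P_K$ is the orthogonal projection onto $K$ (and $P_K\pi(c)P_K$ is regarded as an operator on $K$). *)

theory Defs
  imports
    "HOL-Analysis.Analysis"
    "HOL-Library.Equipollence"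
    "HOL-Algebra.Algebraic_Closure_Type"
    "HOL-Algebra.Module"
    "HOL-Algebra.QuotRing"
begin

section \<open>Complex Hilbert spaces on a carrier\<close>

text \<open>
  Hilbert spaces are carrier-based, so that closed subspaces are again Hilbert spaces and so that the
  existence of a Hilbert space can be asserted. The vector space structure is a module over the field
  of complex numbers; the fields \<open>mult\<close> and \<open>one\<close> inherited from the record of modules are unused.

  Existence of a Hilbert space can only be stated over a fixed type. The type
  \<open>real \<Rightarrow> complex\<close> is large enough for irreducible representations of the Calkin algebra on a separable
  space: these are cyclic, so their spaces have at most the cardinality of the continuum and can be
  transported to a subset of that type.
\<close>

abbreviation complex_field :: "complex ring" where
  "complex_field \<equiv> ring_of_type_algebra"

record 'a inner_space = "(complex, 'a) module" +
  cinner :: "'a \<Rightarrow> 'a \<Rightarrow> complex"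

definition hnorm :: "'a inner_space \<Rightarrow> 'a \<Rightarrow> real" where
  "hnorm H x = sqrt (Re (cinner H x x))"

text \<open>The value outside the carrier is chosen so that the axioms of \<^locale>\<open>Metric_space\<close> hold.\<close>

definition hdist :: "'a inner_space \<Rightarrow> 'a \<Rightarrow> 'a \<Rightarrow> real" where
  "hdist H x y = (if x \<in> carrier H \<and> y \<in> carrier H then hnorm H (x \<ominus>\<^bsub>H\<^esub> y) else 0)"

abbreviation htopology :: "'a inner_space \<Rightarrow> 'a topology" where
  "htopology H \<equiv> Metric_space.mtopology (carrier H) (hdist H)"

locale complex_inner_space = module complex_field H for H :: "'a inner_space" (structure) +
  assumes cinner_add_left:
      "\<lbrakk>x \<in> carrier H; y \<in> carrier H; z \<in> carrier H\<rbrakk>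
        \<Longrightarrow> cinner H (x \<oplus> y) z = cinner H x z + cinner H y z"
    and cinner_smult_left:
      "\<lbrakk>x \<in> carrier H; y \<in> carrier H\<rbrakk> \<Longrightarrow> cinner H (c \<odot> x) y = c * cinner H x y"
    and cinner_commute:
      "\<lbrakk>x \<in> carrier H; y \<in> carrier H\<rbrakk> \<Longrightarrow> cinner H y x = cnj (cinner H x y)"
    and cinner_self_nonneg:
      "x \<in> carrier H \<Longrightarrow> 0 \<le> Re (cinner H x x)"
    and cinner_self_eq_zero:
      "\<lbrakk>x \<in> carrier H; cinner H x x = 0\<rbrakk> \<Longrightarrow> x = \<zero>"

locale hilbert_space = complex_inner_space +
  assumes complete: "Metric_space.mcomplete (carrier H) (hdist H)"

definition separable :: "'a inner_space \<Rightarrow> bool" where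
  "separable H \<longleftrightarrow> separable_space (htopology H)"

definition finite_dimensional :: "'a inner_space \<Rightarrow> bool" where
  "finite_dimensional H \<longleftrightarrow>
    (\<exists>B. finite B \<and> B \<subseteq> carrier H \<and>
      (\<forall>x\<in>carrier H. \<exists>a :: 'a \<Rightarrow> complex. x = (\<Oplus>\<^bsub>H\<^esub>b\<in>B. a b \<odot>\<^bsub>H\<^esub> b)))"

definition closed_subspace :: "'a inner_space \<Rightarrow> 'a set \<Rightarrow> bool" where
  "closed_subspace H K \<longleftrightarrow> submodule K complex_field H \<and> closedin (htopology H) K"

definition subspace_of :: "'a inner_space \<Rightarrow> 'a set \<Rightarrow> 'a inner_space" where
  "subspace_of H K = H\<lparr>carrier := K\<rparr>"

definition orth_proj :: "'a inner_space \<Rightarrow> 'a set \<Rightarrow> 'a \<Rightarrow> 'a" where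
  "orth_proj H K x = (THE y. y \<in> K \<and> (\<forall>z\<in>K. cinner H (x \<ominus>\<^bsub>H\<^esub> y) z = 0))"


section \<open>Star algebras and bounded operators\<close>

text \<open>
  The norm of a \<open>C\<^sup>*\<close>-algebra is determined by its star algebra structure and plays no role in the
  notion of a representation, so it is not part of the record.
\<close>

record 'a star_algebra = "(complex, 'a) module" +
  star :: "'a \<Rightarrow> 'a"

text \<open>Operators are \<^const>\<open>undefined\<close> outside the carrier, so that equality is equality on the carrier.\<close>

definition bounded_ops :: "'a inner_space \<Rightarrow> ('a \<Rightarrow> 'a) set" where
  "bounded_ops H = {T \<in> carrier H \<rightarrow>\<^sub>E carrier H.
    (\<forall>x\<in>carrier H. \<forall>y\<in>carrier H. T (x \<oplus>\<^bsub>H\<^esub> y) = T x \<oplus>\<^bsub>H\<^esub> T y) \<and>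
    (\<forall>c. \<forall>x\<in>carrier H. T (c \<odot>\<^bsub>H\<^esub> x) = c \<odot>\<^bsub>H\<^esub> T x) \<and>
    (\<exists>b. \<forall>x\<in>carrier H. hnorm H (T x) \<le> b * hnorm H x)}"

definition adjoint_op :: "'a inner_space \<Rightarrow> ('a \<Rightarrow> 'a) \<Rightarrow> 'a \<Rightarrow> 'a" where
  "adjoint_op H T = (THE S. S \<in> bounded_ops H \<and>
    (\<forall>x\<in>carrier H. \<forall>y\<in>carrier H. cinner H (T x) y = cinner H x (S y)))"

definition op_algebra :: "'a inner_space \<Rightarrow> ('a \<Rightarrow> 'a) star_algebra" where
  "op_algebra H =
    \<lparr>carrier = bounded_ops H,
     mult = compose (carrier H),
     one = (\<lambda>x\<in>carrier H. x),
     zero = (\<lambda>x\<in>carrier H. \<zero>\<^bsub>H\<^esub>),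
     add = (\<lambda>S T. \<lambda>x\<in>carrier H. S x \<oplus>\<^bsub>H\<^esub> T x),
     smult = (\<lambda>c T. \<lambda>x\<in>carrier H. c \<odot>\<^bsub>H\<^esub> T x),
     star = adjoint_op H\<rparr>"

definition compact_ops :: "'a inner_space \<Rightarrow> ('a \<Rightarrow> 'a) set" where
  "compact_ops H = {T \<in> bounded_ops H.
    compactin (htopology H) (htopology H closure_of (T ` {x \<in> carrier H. hnorm H x \<le> 1}))}"


section \<open>Quotients and the Calkin algebra\<close>

text \<open>
  The ring structure is that of \<^const>\<open>FactRing\<close>. As in \<^const>\<open>rcoset_mult\<close>, the unions below are
  over cosets that all coincide when \<open>I\<close> is a self-adjoint ideal.
\<close>

definition quotient_star_algebra :: "'a star_algebra \<Rightarrow> 'a set \<Rightarrow> 'a set star_algebra" where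
  "quotient_star_algebra A I =
    \<lparr>carrier = carrier (A Quot I),
     mult = mult (A Quot I),
     one = one (A Quot I),
     zero = zero (A Quot I),
     add = add (A Quot I),
     smult = (\<lambda>c S. \<Union>a\<in>S. I +>\<^bsub>A\<^esub> (c \<odot>\<^bsub>A\<^esub> a)),
     star = (\<lambda>S. \<Union>a\<in>S. I +>\<^bsub>A\<^esub> star A a)\<rparr>"

definition calkin_algebra :: "'a inner_space \<Rightarrow> ('a \<Rightarrow> 'a) set star_algebra" where
  "calkin_algebra H = quotient_star_algebra (op_algebra H) (compact_ops H)"


section \<open>Representations\<close>

definition star_hom :: "'a star_algebra \<Rightarrow> 'b star_algebra \<Rightarrow> ('a \<Rightarrow> 'b) \<Rightarrow> bool" where
  "star_hom A B f \<longleftrightarrow> f \<in> carrier A \<rightarrow> carrier B \<and>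
    (\<forall>x\<in>carrier A. \<forall>y\<in>carrier A. f (x \<oplus>\<^bsub>A\<^esub> y) = f x \<oplus>\<^bsub>B\<^esub> f y) \<and>
    (\<forall>x\<in>carrier A. \<forall>y\<in>carrier A. f (x \<otimes>\<^bsub>A\<^esub> y) = f x \<otimes>\<^bsub>B\<^esub> f y) \<and>
    (\<forall>c. \<forall>x\<in>carrier A. f (c \<odot>\<^bsub>A\<^esub> x) = c \<odot>\<^bsub>B\<^esub> f x) \<and>
    (\<forall>x\<in>carrier A. f (star A x) = star B (f x))"

definition star_representation ::
  "'c star_algebra \<Rightarrow> 'a inner_space \<Rightarrow> ('c \<Rightarrow> 'a \<Rightarrow> 'a) \<Rightarrow> bool" where
  "star_representation C L \<pi> \<longleftrightarrow> hilbert_space L \<and> star_hom C (op_algebra L) \<pi>"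

text \<open>The first conjunct excludes the zero space and the zero representation on a one-dimensional space.\<close>

definition irreducible_rep ::
  "'c star_algebra \<Rightarrow> 'a inner_space \<Rightarrow> ('c \<Rightarrow> 'a \<Rightarrow> 'a) \<Rightarrow> bool" where
  "irreducible_rep C L \<pi> \<longleftrightarrow>
    (\<exists>c\<in>carrier C. \<pi> c \<noteq> \<zero>\<^bsub>op_algebra L\<^esub>) \<and>
    (\<forall>V. closed_subspace L V \<and> (\<forall>c\<in>carrier C. \<pi> c ` V \<subseteq> V) \<longrightarrow> V = {\<zero>\<^bsub>L\<^esub>} \<or> V = carrier L)"

definition compression :: "'a inner_space \<Rightarrow> 'a set \<Rightarrow> ('a \<Rightarrow> 'a) \<Rightarrow> 'a \<Rightarrow> 'a" where
  "compression L K T = (\<lambda>x\<in>K. orth_proj L K (T (orth_proj L K x)))"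

definition infinitely_transitive ::
  "'c star_algebra \<Rightarrow> 'a inner_space \<Rightarrow> ('c \<Rightarrow> 'a \<Rightarrow> 'a) \<Rightarrow> bool" where
  "infinitely_transitive C L \<pi> \<longleftrightarrow>
    (\<forall>K. closed_subspace L K \<and> separable (subspace_of L K) \<longrightarrow>
      (\<lambda>c. compression L K (\<pi> c)) ` carrier C = bounded_ops (subspace_of L K))"


section \<open>The continuum hypothesis\<close>

definition continuum_hypothesis :: bool where
  "continuum_hypothesis \<longleftrightarrow> (\<forall>S :: real set. countable S \<or> S \<approx> (UNIV :: real set))"


section \<open>The metric of an inner product space\<close>

context complex_inner_space
begin

lemma complex_field_simps [simp]:
  "carrier complex_field = UNIV" "\<zero>\<^bsub>complex_field\<^esub> = 0" "\<one>\<^bsub>complex_field\<^esub> = 1"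
  "x \<oplus>\<^bsub>complex_field\<^esub> y = x + y" "x \<otimes>\<^bsub>complex_field\<^esub> y = x * y"
  by (simp_all add: ring_of_type_algebra_def)

lemma smult_in_carrier [simp, intro]: "x \<in> carrier H \<Longrightarrow> c \<odot> x \<in> carrier H"
  using smult_closed by simp

lemma cinner_add_right:
  "\<lbrakk>x \<in> carrier H; y \<in> carrier H; z \<in> carrier H\<rbrakk>
    \<Longrightarrow> cinner H x (y \<oplus> z) = cinner H x y + cinner H x z"
  by (metis M.a_closed cinner_add_left cinner_commute complex_cnj_add)

lemma cinner_smult_right:
  "\<lbrakk>x \<in> carrier H; y \<in> carrier H\<rbrakk> \<Longrightarrow> cinner H x (c \<odot> y) = cnj c * cinner H x y"
  by (metis cinner_commute cinner_smult_left complex_cnj_mult smult_in_carrier)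

lemma cinner_zero_left [simp]: "y \<in> carrier H \<Longrightarrow> cinner H \<zero> y = 0"
  using cinner_add_left[of \<zero> \<zero> y] by simp

lemma cinner_self: "x \<in> carrier H \<Longrightarrow> cinner H x x = of_real ((hnorm H x)\<^sup>2)"
  using cinner_commute[of x x] cinner_self_nonneg[of x]
  by (simp add: hnorm_def complex_eq_iff)

lemma hnorm_nonneg: "x \<in> carrier H \<Longrightarrow> 0 \<le> hnorm H x"
  using cinner_self_nonneg by (simp add: hnorm_def)

lemma hnorm_add_smult_sq:
  assumes "x \<in> carrier H" "y \<in> carrier H"
  shows "(hnorm H (x \<oplus> c \<odot> y))\<^sup>2 =
    (hnorm H x)\<^sup>2 + 2 * Re (cnj c * cinner H x y) + (cmod c)\<^sup>2 * (hnorm H y)\<^sup>2"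
proof -
  have "cinner H (x \<oplus> c \<odot> y) (x \<oplus> c \<odot> y) =
      cinner H x x + (cnj c * cinner H x y + cnj (cnj c * cinner H x y)) + (c * cnj c) * cinner H y y"
    using assms cinner_commute[of x y]
    by (simp add: cinner_add_left cinner_add_right cinner_smult_left cinner_smult_right
        algebra_simps)
  also have "\<dots> = of_real ((hnorm H x)\<^sup>2 + 2 * Re (cnj c * cinner H x y) + (cmod c)\<^sup>2 * (hnorm H y)\<^sup>2)"
    unfolding complex_add_cnj complex_norm_square[symmetric] cinner_self[OF assms(1)]
      cinner_self[OF assms(2)] by simp
  finally have "of_real ((hnorm H (x \<oplus> c \<odot> y))\<^sup>2) = (of_real ((hnorm H x)\<^sup>2 +
      2 * Re (cnj c * cinner H x y) + (cmod c)\<^sup>2 * (hnorm H y)\<^sup>2) :: complex)"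
    using cinner_self[of "x \<oplus> c \<odot> y"] assms by simp
  then show ?thesis
    unfolding of_real_eq_iff .
qed

lemma hnorm_triangle:
  assumes x: "x \<in> carrier H" and y: "y \<in> carrier H"
  shows "hnorm H (x \<oplus> y) \<le> hnorm H x + hnorm H y"
proof -
  have quad: "0 \<le> (hnorm H x)\<^sup>2 + 2 * Re (cnj c * cinner H x y) + (cmod c)\<^sup>2 * (hnorm H y)\<^sup>2" for c
    using hnorm_add_smult_sq[OF x y, of c] by (metis zero_le_power2)
  have cs: "Re (cinner H x y) \<le> hnorm H x * hnorm H y"
  proof (cases "y = \<zero>")
    case True
    then show ?thesis
      using x cinner_commute[of y x] hnorm_nonneg[OF x] hnorm_nonneg[OF y] y by simp
  next
    case False
    then have "hnorm H y > 0"
      using cinner_self_eq_zero[OF y] cinner_self[OF y] hnorm_nonneg[OF y] by fastforce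
    moreover define r where "r = hnorm H x / hnorm H y"
    ultimately have r: "r * hnorm H y = hnorm H x" "r \<ge> 0"
      using hnorm_nonneg[OF x] by auto
    show ?thesis
    proof (cases "r = 0")
      case True
      then have "hnorm H x = 0" using r by simp
      then have "x = \<zero>"
        using cinner_self_eq_zero[OF x] cinner_self[OF x] by simp
      then show ?thesis using y \<open>hnorm H x = 0\<close> by simp
    next
      case False
      have "(hnorm H x)\<^sup>2 + 2 * (- r * Re (cinner H x y)) + r\<^sup>2 * (hnorm H y)\<^sup>2 \<ge> 0"
        using quad[of "of_real (- r)"] r by simp
      moreover have "r\<^sup>2 * (hnorm H y)\<^sup>2 = (hnorm H x)\<^sup>2"
        using r by (metis power_mult_distrib)
      moreover have "(hnorm H x)\<^sup>2 = r * (hnorm H x * hnorm H y)"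
        using r by (simp add: power2_eq_square mult.left_commute mult.commute)
      ultimately have "r * Re (cinner H x y) \<le> r * (hnorm H x * hnorm H y)"
        by linarith
      then show ?thesis using False r by simp
    qed
  qed
  have "(hnorm H (x \<oplus> y))\<^sup>2 = (hnorm H x)\<^sup>2 + 2 * Re (cinner H x y) + (hnorm H y)\<^sup>2"
    using hnorm_add_smult_sq[OF x y, of 1] y smult_one by simp
  also have "\<dots> \<le> (hnorm H x + hnorm H y)\<^sup>2"
    using cs by (simp add: power2_sum)
  finally show ?thesis
    by (rule power2_le_imp_le) (simp add: hnorm_nonneg x y)
qed

lemma hnorm_uminus:
  assumes x: "x \<in> carrier H"
  shows "hnorm H (\<ominus> x) = hnorm H x"
proof -
  have neg: "cinner H (\<ominus> u) v = - cinner H u v" if "u \<in> carrier H" "v \<in> carrier H" for u v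
    using cinner_add_left[of u "\<ominus> u" v] that M.r_neg[of u]
    by (simp add: add_eq_0_iff)
  have "cinner H (\<ominus> x) (\<ominus> x) = - cnj (cinner H (\<ominus> x) x)"
    using neg[of x "\<ominus> x"] cinner_commute[of "\<ominus> x" x] x by simp
  also have "\<dots> = cinner H x x"
    using neg[of x x] cinner_commute[of x x] x by simp
  finally show ?thesis by (simp add: hnorm_def)
qed

sublocale metric: Metric_space "carrier H" "hdist H"
proof
  fix x y
  show "0 \<le> hdist H x y"
    by (auto simp: hdist_def hnorm_nonneg)
  show "hdist H x y = hdist H y x"
  proof (cases "x \<in> carrier H \<and> y \<in> carrier H")
    case True
    then have "\<ominus> (x \<ominus> y) = y \<ominus> x"
      by (simp add: a_minus_def M.minus_add M.a_comm)
    then show ?thesis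
      using True hnorm_uminus[of "x \<ominus> y"] by (simp add: hdist_def)
  qed (auto simp: hdist_def)
next
  fix x y
  assume xy: "x \<in> carrier H" "y \<in> carrier H"
  have "x \<ominus> y \<in> carrier H"
    using xy by simp
  then have "hnorm H (x \<ominus> y) = 0 \<longleftrightarrow> x \<ominus> y = \<zero>"
    using cinner_self[of "x \<ominus> y"] cinner_self_eq_zero[of "x \<ominus> y"] cinner_zero_left[of \<zero>]
    by (metis M.zero_closed hnorm_def of_real_0 power_zero_numeral real_sqrt_zero zero_complex.sel(1))
  moreover have "x \<ominus> y = \<zero> \<longleftrightarrow> x = y"
    unfolding a_minus_def using xy by (metis M.a_inv_closed M.minus_equality M.minus_minus M.r_neg)
  ultimately show "hdist H x y = 0 \<longleftrightarrow> x = y"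
    using xy by (simp add: hdist_def)
next
  fix x y z
  assume xyz: "x \<in> carrier H" "y \<in> carrier H" "z \<in> carrier H"
  have "(x \<ominus> y) \<oplus> (y \<ominus> z) = x \<ominus> z"
    unfolding a_minus_def using xyz
    by (metis M.a_assoc M.a_inv_closed M.add.m_closed M.r_neg1)
  then show "hdist H x z \<le> hdist H x y + hdist H y z"
    using xyz hnorm_triangle[of "x \<ominus> y" "y \<ominus> z"] by (simp add: hdist_def)
qed

end

end

theory Submission
  imports Defs
begin

text \<open>
  Let \<open>G\<close> be a filter on the natural numbers containing all cofinite sets. The Calkin algebra of \<open>H\<close> acts
  on the bounded sequences in \<open>H\<close> that tend weakly to 0 along \<open>G\<close>, modulo those that tend to 0 in norm along
  \<open>G\<close>: operators are applied entrywise, and a compact operator acts as zero since it turns weak into norm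
  convergence. The inner product of two classes is the limit of \<open>\<langle>x n, y n\<rangle>\<close> along \<open>G\<close>, provided that these
  limits exist. The space so obtained is complete for every such \<open>G\<close> (\<open>diagonal_limit\<close>), but it is a
  special choice of \<open>G\<close> that makes the representation irreducible and infinitely transitive.

  The choice of \<open>G\<close> is where the continuum hypothesis is needed. There are only continuum many sequences of
  sequences in \<open>H\<close>, and under the continuum hypothesis a tower of infinite sets of natural numbers,
  decreasing modulo finite sets, can be made to meet continuum many prescribed dense families of infinite
  sets (\<open>generic_filter\<close>), because at each stage only countably many sets have been chosen and they have
  an infinite pseudo-intersection. The filter generated by the tower is arranged to have limits of all
  inner products, and to decide for each sequence \<open>x 0, x 1, \<dots>\<close> of sequences whether some set in \<open>G\<close> makes
  it nearly orthogonal: on the elements \<open>f 0 < f 1 < \<dots>\<close> of this set, the blocks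
  \<open>x 0 (f i), \<dots>, x i (f i)\<close> are almost orthogonal systems, and almost orthogonal to each other.

  Now let \<open>e 0, e 1, \<dots>\<close> be an orthonormal basis of a separable closed subspace \<open>K\<close> of the limit space, and
  let \<open>t\<close> be the matrix of a bounded operator \<open>T\<close> on \<open>K\<close>. Represent \<open>e k\<close> by a weakly null sequence \<open>x k\<close>. Weak
  convergence to 0 and orthogonality in the limit give nearly orthogonal subsets of every set in \<open>G\<close>, so
  that \<open>G\<close> itself contains a set making the \<open>x k\<close> nearly orthogonal (\<open>near_orthogonal_subsequence\<close>). On each
  block one can prescribe an operator by a finite corner of \<open>t\<close>; by near orthogonality these operators add up
  to a bounded operator \<open>S\<close> on \<open>H\<close> with \<open>\<langle>S (x k n), x j n\<rangle>\<close> tending to \<open>t j k\<close> along \<open>G\<close>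
  (\<open>near_orthogonal_block_operator\<close>, \<open>matrix_interpolation\<close>). Hence the image of \<open>S\<close> compresses to \<open>T\<close>.
  Irreducibility is the case of a two-element orthonormal system, one vector in a given invariant subspace
  and one orthogonal to it, and of a matrix that moves the first vector to the second.
\<close>

section \<open>A filter meeting continuum many dense families\<close>

text \<open>
  The choice of indices used throughout: countably many conditions, each holding eventually along a
  filter, can be met one after the other, even if a condition mentions the indices chosen before.
\<close>

lemma diagonal_selection:
  fixes G :: "nat filter"
  assumes "G \<noteq> bot"
    and unary: "\<And>i::nat. eventually (P i) G"
    and binary: "\<And>m i a. m < i \<Longrightarrow> eventually (Q m i a) G"
  shows "\<exists>f. \<forall>i. P i (f i) \<and> (\<forall>m<i. Q m i (f m) (f i))"
proof -
  have "\<exists>f. \<forall>i. P i (f i) \<and> (\<forall>m. (m, i) \<in> less_than \<longrightarrow> Q m i (f m) (f i))"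
  proof (rule dependent_wf_choice[where R = less_than])
    fix i :: nat and f :: "nat \<Rightarrow> nat"
    have "eventually (\<lambda>n. P i n \<and> (\<forall>m\<in>{..<i}. Q m i (f m) n)) G"
      using unary binary by (intro eventually_conj eventually_ball_finite) auto
    then show "\<exists>n. P i n \<and> (\<forall>m. (m, i) \<in> less_than \<longrightarrow> Q m i (f m) n)"
      using eventually_happens'[OF \<open>G \<noteq> bot\<close>] by fastforce
  qed auto
  then show ?thesis by simp
qed

text \<open>
  Inclusion modulo finite sets and infinite intersections are handled as the order of filters: an
  infinite set \<open>A\<close> stands for the trace on \<open>A\<close> of the cofinite filter.
\<close>

lemma infinite_iff_inf_principal_neq_bot:
  "infinite A \<longleftrightarrow> inf sequentially (principal A) \<noteq> bot"
  unfolding trivial_limit_def eventually_inf_principal cofinite_eq_sequentially[symmetric]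
    eventually_cofinite by (simp add: Int_def)

lemma inf_principal_mono_almost:
  assumes "finite (A - B)"
  shows "inf sequentially (principal A) \<le> inf sequentially (principal B)"
proof (rule le_infI)
  have "finite {n. \<not> (n \<in> A \<longrightarrow> n \<in> B)}"
    by (rule finite_subset[OF _ assms]) auto
  then show "inf sequentially (principal A) \<le> principal B"
    unfolding le_principal eventually_inf_principal cofinite_eq_sequentially[symmetric]
      eventually_cofinite .
qed simp

text \<open>
  The hypothesis says that finitely many members always have an infinite intersection. A sequence
  picking its \<open>i\<close>-th term from the first \<open>i + 1\<close> members is then almost contained in each of them.
\<close>

lemma pseudo_intersection:
  assumes "countable \<B>"
    and "(INF B\<in>\<B>. inf sequentially (principal B)) \<noteq> bot"
  shows "\<exists>Y. infinite Y \<and> (\<forall>B\<in>\<B>. finite (Y - B))"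
proof (cases "\<B> = {}")
  case True
  then show ?thesis using infinite_UNIV_nat by blast
next
  case False
  define b where "b = from_nat_into \<B>"
  have b: "b j \<in> \<B>" for j
    using from_nat_into[OF False] unfolding b_def .
  define G where "G = (INF B\<in>\<B>. inf sequentially (principal B))"
  have le: "G \<le> inf sequentially (principal (b j))" for j
    unfolding G_def using b by (rule INF_lower)
  have inb: "eventually (\<lambda>n. n \<in> b j) G" for j
    using order_trans[OF le inf_le2] unfolding le_principal .
  have large: "eventually (\<lambda>n. a < n) G" for a
    using filter_leD[OF order_trans[OF le inf_le1] eventually_gt_at_top] .
  have "\<exists>f. \<forall>i. (\<forall>j\<in>{..i}. f i \<in> b j) \<and> (\<forall>m<i. f m < f i)"
  proof (rule diagonal_selection[where P = "\<lambda>i n. \<forall>j\<in>{..i}. n \<in> b j" and Q = "\<lambda>m i a n. a < n"])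
    show "G \<noteq> bot" using assms(2) unfolding G_def .
    show "eventually (\<lambda>n. \<forall>j\<in>{..i}. n \<in> b j) G" for i
      using inb by (intro eventually_ball_finite) auto
  qed (rule large)
  then obtain f where f: "\<And>i j. j \<le> i \<Longrightarrow> f i \<in> b j" "\<And>i m. m < i \<Longrightarrow> f m < f i"
    by auto
  have "strict_mono f" using f(2) by (simp add: strict_mono_def)
  then have "infinite (range f)" by (simp add: range_inj_infinite strict_mono_imp_inj_on)
  moreover have "finite (range f - B)" if "B \<in> \<B>" for B
  proof -
    obtain j where "B = b j" using from_nat_into_surj[OF assms(1) \<open>B \<in> \<B>\<close>] unfolding b_def by auto
    have "range f - B \<subseteq> f ` {..<j}"
    proof
      fix n assume n: "n \<in> range f - B"
      then obtain i where "n = f i" by blast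
      with n f(1)[of j i] \<open>B = b j\<close> show "n \<in> f ` {..<j}" by (cases "j \<le> i") auto
    qed
    then show ?thesis by (rule finite_subset) simp
  qed
  ultimately show ?thesis by blast
qed

text \<open>
  The cardinal well-order of the reals: an initial segment has smaller cardinality than the reals and
  so is countable.
\<close>

lemma continuum_hypothesis_wellorder:
  includes cardinal_syntax
  assumes continuum_hypothesis
  obtains R :: "(real \<times> real) set"
  where "wf R" "trans R" "\<And>x y. x \<noteq> y \<Longrightarrow> (x, y) \<in> R \<or> (y, x) \<in> R"
    "\<And>x. countable {z. (z, x) \<in> R}"
proof -
  let ?r = "|UNIV :: real set|"
  have wo: "Well_order ?r" and F: "Field ?r = UNIV" and co: "Card_order ?r"
    by (rule card_of_Well_order Field_card_of card_of_Card_order)+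
  define R where "R = ?r - Id"
  have lin: "Refl ?r" "trans ?r" "antisym ?r" "total ?r"
    using wo F unfolding order_on_defs by auto
  show ?thesis
  proof
    show "wf R" using wo unfolding R_def well_order_on_def by blast
    show "trans R" using lin unfolding R_def by (simp add: trans_diff_Id)
    show "(x, y) \<in> R \<or> (y, x) \<in> R" if "x \<noteq> y" for x y
      using lin that unfolding R_def total_on_def by auto
    show "countable {z. (z, x) \<in> R}" for x
    proof -
      have S: "{z. (z, x) \<in> R} = underS ?r x"
        unfolding R_def underS_def by auto
      have less: "|underS ?r x| <o ?r"
        using card_of_underS[OF co] F by blast
      have "\<not> underS ?r x \<approx> (UNIV :: real set)"
      proof
        assume "underS ?r x \<approx> (UNIV :: real set)"
        then have "|underS ?r x| =o ?r" unfolding eqpoll_def card_of_ordIso .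
        with less show False using not_ordLess_ordIso by blast
      qed
      then show ?thesis using assms S unfolding continuum_hypothesis_def by auto
    qed
  qed
qed

text \<open>
  A transfinite recursion of length \<open>\<omega>\<^sub>1\<close> builds a sequence of infinite sets, decreasing modulo finite
  sets, whose \<open>r\<close>-th term lies in \<open>D r\<close>. The continuum hypothesis enters because only countably many
  terms precede a given one, so that they have a pseudo-intersection, inside which density finds the
  next term.
\<close>

lemma generic_filter:
  fixes D :: "real \<Rightarrow> nat set set"
  assumes continuum_hypothesis
    and dense: "\<And>r A. infinite A \<Longrightarrow> \<exists>Y\<subseteq>A. infinite Y \<and> Y \<in> D r"
  obtains G :: "nat filter"
  where "G \<noteq> bot" "G \<le> sequentially" "\<And>r. \<exists>Z\<in>D r. eventually (\<lambda>n. n \<in> Z) G"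
proof -
  obtain R :: "(real \<times> real) set" where R: "wf R" "trans R"
    "\<And>x y. x \<noteq> y \<Longrightarrow> (x, y) \<in> R \<or> (y, x) \<in> R" "\<And>x. countable {z. (z, x) \<in> R}"
    using continuum_hypothesis_wellorder[OF assms(1)] by blast
  define F where "F = (\<lambda>A::nat set. inf sequentially (principal A))"
  have chain: "(INF z\<in>S. F (f z)) \<noteq> bot"
    if S: "\<And>z. z \<in> S \<Longrightarrow> infinite (f z)"
      "\<And>z z'. z \<in> S \<Longrightarrow> z' \<in> S \<Longrightarrow> (z, z') \<in> R \<Longrightarrow> finite (f z' - f z)"
    for S and f :: "real \<Rightarrow> nat set"
  proof (rule INF_filter_not_bot)
    (* The sets indexed by J form a chain, so the last one is almost contained in all of them. *)
    fix J assume J: "J \<subseteq> S" "finite J"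
    show "(INF z\<in>J. F (f z)) \<noteq> bot"
    proof (cases "J = {}")
      case True then show ?thesis by (simp add: trivial_limit_def)
    next
      case False
      have "wf ((R \<inter> J \<times> J)\<inverse>)"
        using J(2) R(1,2) by (intro finite_acyclic_wf_converse)
          (auto intro: acyclic_subset[of R] wf_acyclic)
      then obtain m where m: "m \<in> J" "\<And>y. (m, y) \<in> R \<inter> J \<times> J \<Longrightarrow> y \<notin> J"
        using False wfE_min[of "(R \<inter> J \<times> J)\<inverse>"] by (metis converse_iff ex_in_conv)
      have "F (f m) \<le> F (f z)" if "z \<in> J" for z
      proof (cases "z = m")
        case False
        then have "(z, m) \<in> R" using R(3) m that by blast
        then show ?thesis using S(2) J(1) m(1) that unfolding F_def
          by (intro inf_principal_mono_almost) auto
      qed simp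
      then have "F (f m) \<le> (INF z\<in>J. F (f z))" by (rule INF_greatest)
      moreover have "F (f m) \<noteq> bot"
        using S(1) J(1) m(1) infinite_iff_inf_principal_neq_bot unfolding F_def by blast
      ultimately show ?thesis using bot.extremum_unique[of "F (f m)"] by auto
    qed
  qed
  have "\<exists>f. \<forall>x. infinite (f x) \<and> f x \<in> D x \<and> (\<forall>z. (z, x) \<in> R \<longrightarrow> finite (f x - f z))"
  proof (rule dependent_wf_choice[OF R(1)])
    fix x and f :: "real \<Rightarrow> nat set"
    assume IH: "\<And>y. (y, x) \<in> R \<Longrightarrow>
      infinite (f y) \<and> f y \<in> D y \<and> (\<forall>z. (z, y) \<in> R \<longrightarrow> finite (f y - f z))"
    have "(INF z\<in>{z. (z, x) \<in> R}. F (f z)) \<noteq> bot"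
      using IH by (intro chain) auto
    then have "\<exists>A. infinite A \<and> (\<forall>B\<in>f ` {z. (z, x) \<in> R}. finite (A - B))"
      using R(4)[of x] unfolding F_def by (intro pseudo_intersection) (auto simp: image_image)
    then obtain A where A: "infinite A" "\<And>z. (z, x) \<in> R \<Longrightarrow> finite (A - f z)"
      by auto
    obtain Y where "Y \<subseteq> A" "infinite Y" "Y \<in> D x" using dense[OF A(1)] by blast
    moreover have "finite (Y - f z)" if "(z, x) \<in> R" for z
      using A(2)[OF that] \<open>Y \<subseteq> A\<close> by (meson Diff_mono finite_subset order_refl)
    ultimately show "\<exists>Y. infinite Y \<and> Y \<in> D x \<and> (\<forall>z. (z, x) \<in> R \<longrightarrow> finite (Y - f z))"
      by blast
  qed simp
  then obtain f where f: "\<And>x. infinite (f x)" "\<And>x. f x \<in> D x"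
    "\<And>x z. (z, x) \<in> R \<Longrightarrow> finite (f x - f z)" by blast
  define G where "G = (INF z. F (f z))"
  have le: "G \<le> F (f z)" for z unfolding G_def by (rule INF_lower) simp
  show ?thesis
  proof
    show "G \<noteq> bot" unfolding G_def using f by (intro chain) auto
    show "G \<le> sequentially" using le[of 0] unfolding F_def by simp
    show "\<exists>Z\<in>D r. eventually (\<lambda>n. n \<in> Z) G" for r
      using le[of r] f(2)[of r] unfolding F_def by (auto simp: le_principal)
  qed
qed

section \<open>Hilbert spaces on a carrier\<close>

context complex_inner_space
begin

lemma cinner_zero_right [simp]: "y \<in> carrier H \<Longrightarrow> cinner H y \<zero> = 0"
  using cinner_commute[of \<zero> y] by simp

lemma cinner_uminus_left: "\<lbrakk>x \<in> carrier H; y \<in> carrier H\<rbrakk> \<Longrightarrow> cinner H (\<ominus> x) y = - cinner H x y"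
  using cinner_add_left[of x "\<ominus> x" y] by (simp add: M.r_neg eq_neg_iff_add_eq_0 add.commute)

lemma cinner_diff_left:
  "\<lbrakk>x \<in> carrier H; y \<in> carrier H; z \<in> carrier H\<rbrakk>
    \<Longrightarrow> cinner H (x \<ominus> y) z = cinner H x z - cinner H y z"
  by (simp add: a_minus_def cinner_add_left cinner_uminus_left)

lemma cinner_diff_right:
  "\<lbrakk>x \<in> carrier H; y \<in> carrier H; z \<in> carrier H\<rbrakk>
    \<Longrightarrow> cinner H z (x \<ominus> y) = cinner H z x - cinner H z y"
  using cinner_commute[of "x \<ominus> y" z] cinner_commute[of x z] cinner_commute[of y z]
  by (simp add: cinner_diff_left)

lemmas cinner_simps = cinner_add_left cinner_add_right cinner_diff_left cinner_diff_right
  cinner_smult_left cinner_smult_right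

text \<open>
  Vector identities are proved by comparing inner products, which reduces computations relative to a
  carrier to computations with complex numbers.
\<close>

lemma cinner_eqI:
  assumes "x \<in> carrier H" "y \<in> carrier H" "\<And>z. z \<in> carrier H \<Longrightarrow> cinner H x z = cinner H y z"
  shows "x = y"
proof -
  have "cinner H (x \<ominus> y) (x \<ominus> y) = 0"
    using assms by (simp add: cinner_diff_left)
  then have "x \<ominus> y = \<zero>" using assms cinner_self_eq_zero by simp
  then show ?thesis
    using assms M.minus_equality[of x "\<ominus> y"] by (simp add: a_minus_def)
qed

lemma hnorm_square: "x \<in> carrier H \<Longrightarrow> (hnorm H x)\<^sup>2 = Re (cinner H x x)"
  by (simp add: hnorm_def cinner_self_nonneg)

lemma hnorm_zero [simp]: "hnorm H \<zero> = 0"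
  by (simp add: hnorm_def)

lemma hnorm_eq_zero: "x \<in> carrier H \<Longrightarrow> hnorm H x = 0 \<longleftrightarrow> x = \<zero>"
  using cinner_self[of x] cinner_self_eq_zero[of x] by auto

lemma hnorm_smult: "x \<in> carrier H \<Longrightarrow> hnorm H (c \<odot> x) = cmod c * hnorm H x"
proof -
  assume x: "x \<in> carrier H"
  have "cinner H (c \<odot> x) (c \<odot> x) = c * cnj c * cinner H x x"
    using x by (simp add: cinner_simps mult.assoc)
  also have "\<dots> = of_real ((cmod c * hnorm H x)\<^sup>2)"
    using x by (simp add: cinner_self power_mult_distrib complex_norm_square[symmetric])
  finally have "(hnorm H (c \<odot> x))\<^sup>2 = (cmod c * hnorm H x)\<^sup>2"
    using x cinner_self[of "c \<odot> x"] unfolding of_real_eq_iff[where 'a = complex, symmetric] by simp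
  then show ?thesis using x hnorm_nonneg by (simp add: power2_eq_iff_nonneg)
qed

lemma Cauchy_Schwarz:
  assumes x: "x \<in> carrier H" and y: "y \<in> carrier H"
  shows "cmod (cinner H x y) \<le> hnorm H x * hnorm H y"
proof (cases "y = \<zero>")
  case True
  then show ?thesis using x by simp
next
  case False
  let ?s = "cinner H x y" and ?n = "(hnorm H y)\<^sup>2"
  have pos: "?n > 0" using False hnorm_eq_zero[OF y] by simp
  (* The multiple of y that is closest to x. *)
  define c where "c = - (?s / of_real ?n)"
  have "cnj c * ?s = - of_real ((cmod ?s)\<^sup>2 / ?n)"
    unfolding c_def of_real_divide complex_norm_square by (simp add: mult.commute)
  then have "Re (cnj c * ?s) = - ((cmod ?s)\<^sup>2 / ?n)"
    by simp
  moreover have "(cmod c)\<^sup>2 * ?n = (cmod ?s)\<^sup>2 / ?n"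
    unfolding c_def using pos
    by (simp only: norm_minus_cancel norm_divide power_divide norm_of_real) (simp add: power2_eq_square)
  moreover have "0 \<le> (hnorm H x)\<^sup>2 + 2 * Re (cnj c * ?s) + (cmod c)\<^sup>2 * ?n"
    using hnorm_add_smult_sq[OF x y, of c] by (metis zero_le_power2)
  ultimately have "(cmod ?s)\<^sup>2 / ?n \<le> (hnorm H x)\<^sup>2" by linarith
  then have "(cmod ?s)\<^sup>2 \<le> (hnorm H x * hnorm H y)\<^sup>2"
    using pos by (simp add: pos_divide_le_eq power_mult_distrib)
  then show ?thesis by (rule power2_le_imp_le) (simp add: hnorm_nonneg x y)
qed

lemma hnorm_minus_commute:
  "\<lbrakk>x \<in> carrier H; y \<in> carrier H\<rbrakk> \<Longrightarrow> hnorm H (x \<ominus> y) = hnorm H (y \<ominus> x)"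
  using metric.commute[of x y] by (simp add: hdist_def)

lemma hnorm_triangle_minus:
  "\<lbrakk>x \<in> carrier H; y \<in> carrier H; z \<in> carrier H\<rbrakk>
    \<Longrightarrow> hnorm H (x \<ominus> z) \<le> hnorm H (x \<ominus> y) + hnorm H (y \<ominus> z)"
  using metric.triangle[of x y z] by (simp add: hdist_def)

lemma minus_eq_zero_iff: "\<lbrakk>x \<in> carrier H; y \<in> carrier H\<rbrakk> \<Longrightarrow> x \<ominus> y = \<zero> \<longleftrightarrow> x = y"
  using metric.zero[of x y] hnorm_eq_zero[of "x \<ominus> y"] by (simp add: hdist_def)

lemma cinner_finsum_left:
  assumes "finite I" "\<And>i. i \<in> I \<Longrightarrow> f i \<in> carrier H" "y \<in> carrier H"
  shows "cinner H (\<Oplus>\<^bsub>H\<^esub>i\<in>I. f i) y = (\<Sum>i\<in>I. cinner H (f i) y)"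
  using assms
proof (induction I rule: finite_induct)
  case (insert i I)
  then have "(\<Oplus>\<^bsub>H\<^esub>i\<in>insert i I. f i) = f i \<oplus> (\<Oplus>\<^bsub>H\<^esub>i\<in>I. f i)"
    by (intro M.finsum_insert) auto
  with insert show ?case by (simp add: cinner_add_left)
qed simp

text \<open>
  A description of closed subspaces by convergent sequences, free of topologies and of the additive
  inverse.
\<close>

lemma closed_subspace_iff:
  "closed_subspace H K \<longleftrightarrow> K \<subseteq> carrier H \<and> \<zero> \<in> K \<and> (\<forall>x\<in>K. \<forall>y\<in>K. x \<oplus> y \<in> K) \<and>
    (\<forall>c. \<forall>x\<in>K. c \<odot> x \<in> K) \<and>
    (\<forall>s l. range s \<subseteq> K \<and> l \<in> carrier H \<and> (\<lambda>n. hnorm H (s n \<ominus> l)) \<longlonglongrightarrow> 0 \<longrightarrow> l \<in> K)"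
    (is "_ = ?R")
proof -
  have lim: "limitin metric.mtopology s l sequentially \<longleftrightarrow>
      l \<in> carrier H \<and> (\<lambda>n. hnorm H (s n \<ominus> l)) \<longlonglongrightarrow> 0"
    if "range s \<subseteq> carrier H" for s l
  proof -
    have "s n \<in> carrier H" for n using that by auto
    then have "hdist H (s n) l = \<bar>hnorm H (s n \<ominus> l)\<bar>" if "l \<in> carrier H" for n
      using that by (simp add: hdist_def hnorm_nonneg)
    then show ?thesis
      unfolding metric.limitin_metric tendsto_iff dist_real_def
      using \<open>\<And>n. s n \<in> carrier H\<close> by auto
  qed
  show ?thesis
  proof
    assume K: "closed_subspace H K"
    then have sub: "submodule K complex_field H" and cl: "closedin metric.mtopology K"
      unfolding closed_subspace_def by auto
    have KH: "K \<subseteq> carrier H" using submoduleE(1)[OF sub] .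
    have "\<zero> \<in> K" using submodule.axioms(1)[OF sub] subgroup.one_closed by force
    moreover have "l \<in> K" if "range s \<subseteq> K \<and> l \<in> carrier H \<and> (\<lambda>n. hnorm H (s n \<ominus> l)) \<longlonglongrightarrow> 0" for s l
      using cl lim[of s l] that KH unfolding metric.metric_closedin_iff_sequentially_closed by blast
    ultimately show ?R
      using KH submoduleE(4,5)[OF sub] by auto
  next
    assume R: ?R
    have "submodule K complex_field H"
    proof (rule submoduleI)
      show "\<ominus> a \<in> K" if "a \<in> K" for a
      proof -
        have "a \<in> carrier H" using R that by blast
        then have "\<ominus> a = (- 1) \<odot> a"
          by (intro cinner_eqI) (auto simp: cinner_uminus_left cinner_simps)
        then show ?thesis using R that by simp
      qed
    qed (use R in auto)
    moreover have "closedin metric.mtopology K"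
      unfolding metric.metric_closedin_iff_sequentially_closed
    proof (intro conjI allI impI)
      show "K \<subseteq> carrier H" using R by blast
      fix s l assume a: "range s \<subseteq> K \<and> limitin metric.mtopology s l sequentially"
      then have "range s \<subseteq> carrier H" using R by blast
      from lim[OF this, of l] a R show "l \<in> K" by blast
    qed
    ultimately show "closed_subspace H K" unfolding closed_subspace_def by blast
  qed
qed

lemma closed_subspaceD:
  assumes "closed_subspace H K"
  shows "K \<subseteq> carrier H" "\<zero> \<in> K" "\<And>x y. x \<in> K \<Longrightarrow> y \<in> K \<Longrightarrow> x \<oplus> y \<in> K"
    "\<And>c x. x \<in> K \<Longrightarrow> c \<odot> x \<in> K"
    "\<And>s l. (\<And>n. s n \<in> K) \<Longrightarrow> l \<in> carrier H \<Longrightarrow> (\<lambda>n. hnorm H (s n \<ominus> l)) \<longlonglongrightarrow> 0 \<Longrightarrow> l \<in> K"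
proof -
  note K = assms[unfolded closed_subspace_iff]
  show "K \<subseteq> carrier H" "\<zero> \<in> K" "\<And>x y. x \<in> K \<Longrightarrow> y \<in> K \<Longrightarrow> x \<oplus> y \<in> K"
    "\<And>c x. x \<in> K \<Longrightarrow> c \<odot> x \<in> K" using K by simp_all
  show "l \<in> K" if "\<And>n. s n \<in> K" "l \<in> carrier H" "(\<lambda>n. hnorm H (s n \<ominus> l)) \<longlonglongrightarrow> 0" for s l
  proof -
    have "range s \<subseteq> K" using that(1) by blast
    then show ?thesis using K that(2,3) by simp
  qed
qed

lemma closed_subspace_minus:
  assumes K: "closed_subspace H K" and "x \<in> K" "y \<in> K"
  shows "x \<ominus> y \<in> K"
proof -
  have c: "x \<in> carrier H" "y \<in> carrier H" using assms closed_subspaceD(1)[OF K] by auto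
  then have "x \<ominus> y = x \<oplus> (- 1) \<odot> y"
    by (intro cinner_eqI) (auto simp: cinner_simps)
  then show ?thesis using assms closed_subspaceD[OF K] by simp
qed

lemma closed_subspace_kernel:
  assumes add: "\<And>x y. x \<in> carrier H \<Longrightarrow> y \<in> carrier H \<Longrightarrow> F (x \<oplus> y) = F x + F y"
    and smult: "\<And>c x. x \<in> carrier H \<Longrightarrow> F (c \<odot> x) = c * F x"
    and bound: "\<And>x. x \<in> carrier H \<Longrightarrow> cmod (F x) \<le> b * hnorm H x"
  shows "closed_subspace H {x \<in> carrier H. F x = (0::complex)}"
proof -
  have 0: "F l = 0" if s: "\<And>n. s n \<in> carrier H" "\<And>n. F (s n) = 0" and l: "l \<in> carrier H"
    and lim: "(\<lambda>n. hnorm H (s n \<ominus> l)) \<longlonglongrightarrow> 0" for s l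
  proof -
    have "F (s n \<oplus> (- 1) \<odot> l) = - F l" for n
      using add[of "s n" "(- 1) \<odot> l"] smult[of l "-1"] s l by simp
    moreover have "s n \<ominus> l = s n \<oplus> (- 1) \<odot> l" for n
      using s l by (intro cinner_eqI) (auto simp: cinner_simps)
    ultimately have "F (s n \<ominus> l) = - F l" for n by simp
    then have "cmod (F l) \<le> b * hnorm H (s n \<ominus> l)" for n
      using bound[of "s n \<ominus> l"] s l by simp
    then have "cmod (F l) \<le> 0"
      using tendsto_mult_right_zero[OF lim, of b] by (intro tendsto_lowerbound) auto
    then show ?thesis by simp
  qed
  moreover have "F \<zero> = 0" using smult[of \<zero> 0] by simp
  ultimately show ?thesis
    unfolding closed_subspace_iff
  proof (intro conjI allI ballI impI)
    fix s l assume "range s \<subseteq> {x \<in> carrier H. F x = 0} \<and> l \<in> carrier H \<and>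
      (\<lambda>n. hnorm H (s n \<ominus> l)) \<longlonglongrightarrow> 0"
    moreover from this have "s n \<in> carrier H" "F (s n) = 0" for n by auto
    ultimately show "l \<in> {x \<in> carrier H. F x = 0}" using 0[of s l] by simp
  qed (auto simp: add smult)
qed

end

context hilbert_space
begin

lemma Cauchy_convergent:
  assumes s: "\<And>n. s n \<in> carrier H"
    and C: "\<And>e. e > 0 \<Longrightarrow> \<exists>N. \<forall>m\<ge>N. \<forall>n\<ge>N. hnorm H (s m \<ominus> s n) < e"
  shows "\<exists>l\<in>carrier H. (\<lambda>n. hnorm H (s n \<ominus> l)) \<longlonglongrightarrow> 0"
proof -
  have "metric.MCauchy s"
    unfolding metric.MCauchy_def using s C by (auto simp: hdist_def)
  then obtain l where l: "limitin metric.mtopology s l sequentially"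
    using complete unfolding metric.mcomplete_def by blast
  then have lc: "l \<in> carrier H" by (simp add: metric.limitin_metric)
  moreover have "(\<lambda>n. hnorm H (s n \<ominus> l)) \<longlonglongrightarrow> 0"
    using l lc s unfolding metric.limitin_metric tendsto_iff dist_real_def
    by (simp add: hdist_def hnorm_nonneg)
  ultimately show ?thesis by blast
qed

text \<open>
  A sequence in \<open>K\<close> whose distances to \<open>x\<close> approach the infimum is Cauchy by the parallelogram law. Its
  limit attains the infimum, and the difference to \<open>x\<close> is orthogonal to \<open>K\<close> because moving the limit
  along a vector of \<open>K\<close> does not decrease the distance.
\<close>

theorem projection:
  assumes K: "closed_subspace H K" and x: "x \<in> carrier H"
  shows "\<exists>y\<in>K. \<forall>z\<in>K. cinner H (x \<ominus> y) z = 0"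
proof -
  note Kc = closed_subspaceD[OF K]
  have KH: "y \<in> carrier H" if "y \<in> K" for y using that Kc(1) by blast
  define d where "d = (INF y\<in>K. (hnorm H (x \<ominus> y))\<^sup>2)"
  have bdd: "bdd_below ((\<lambda>y. (hnorm H (x \<ominus> y))\<^sup>2) ` K)"
    by (rule bdd_belowI[of _ 0]) auto
  have d_le: "d \<le> (hnorm H (x \<ominus> y))\<^sup>2" if "y \<in> K" for y
    unfolding d_def using bdd that by (rule cINF_lower)
  have near: "\<exists>y\<in>K. (hnorm H (x \<ominus> y))\<^sup>2 < d + e" if "e > 0" for e
    using cINF_less_iff[OF _ bdd, of "d + e"] Kc(2) that unfolding d_def[symmetric] by auto
  obtain s where s: "\<And>n. s n \<in> K" "\<And>n. (hnorm H (x \<ominus> s n))\<^sup>2 < d + inverse (real (Suc n))"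
  proof -
    have "\<forall>n. \<exists>y. y \<in> K \<and> (hnorm H (x \<ominus> y))\<^sup>2 < d + inverse (real (Suc n))"
      using near by (metis inverse_positive_iff_positive of_nat_0_less_iff zero_less_Suc)
    then show ?thesis using that by metis
  qed
  have sH: "s n \<in> carrier H" for n using s(1) KH by blast
  (* The parallelogram law, together with d as a lower bound at the midpoint of y and z. *)
  have par: "(hnorm H (y \<ominus> z))\<^sup>2 \<le> 2 * (hnorm H (x \<ominus> y))\<^sup>2 + 2 * (hnorm H (x \<ominus> z))\<^sup>2 - 4 * d"
    if "y \<in> K" "z \<in> K" for y z
  proof -
    have c: "y \<in> carrier H" "z \<in> carrier H" using that KH by auto
    let ?m = "(1/2) \<odot> (y \<oplus> z)"
    have "?m \<in> K" using that Kc by auto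
    from d_le[OF this] have "4 * d \<le> 4 * (hnorm H (x \<ominus> ?m))\<^sup>2" by simp
    moreover have "(hnorm H (y \<ominus> z))\<^sup>2 + 4 * (hnorm H (x \<ominus> ?m))\<^sup>2 =
        2 * (hnorm H (x \<ominus> y))\<^sup>2 + 2 * (hnorm H (x \<ominus> z))\<^sup>2"
      using c x cinner_commute[of x y] cinner_commute[of x z] cinner_commute[of y z]
      by (simp add: hnorm_square cinner_simps algebra_simps)
    ultimately show ?thesis by linarith
  qed
  have "\<exists>l\<in>carrier H. (\<lambda>n. hnorm H (s n \<ominus> l)) \<longlonglongrightarrow> 0"
  proof (rule Cauchy_convergent[OF sH])
    fix e :: real assume "e > 0"
    then obtain N where N: "inverse (real (Suc N)) < e\<^sup>2 / 4"
      using reals_Archimedean[of "e\<^sup>2 / 4"] by auto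
    have "hnorm H (s m \<ominus> s n) < e" if "m \<ge> N" "n \<ge> N" for m n
    proof -
      have "inverse (real (Suc k)) \<le> inverse (real (Suc N))" if "k \<ge> N" for k
        using that by (intro le_imp_inverse_le) auto
      from this[OF that(1)] this[OF that(2)] have "(hnorm H (s m \<ominus> s n))\<^sup>2 < e\<^sup>2"
        using par[OF s(1) s(1), of m n] s(2)[of m] s(2)[of n] N by linarith
      then show ?thesis using \<open>e > 0\<close> by (simp add: power_less_imp_less_base)
    qed
    then show "\<exists>N. \<forall>m\<ge>N. \<forall>n\<ge>N. hnorm H (s m \<ominus> s n) < e" by blast
  qed
  then obtain y where y: "y \<in> carrier H" "(\<lambda>n. hnorm H (s n \<ominus> y)) \<longlonglongrightarrow> 0" by blast
  have yK: "y \<in> K" using Kc(5)[OF s(1) y] .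
  have "hnorm H (x \<ominus> y) \<le> sqrt d"
  proof (rule tendsto_lowerbound)
    show "(\<lambda>n. sqrt (d + inverse (real (Suc n))) + hnorm H (s n \<ominus> y)) \<longlonglongrightarrow> sqrt d"
      using tendsto_add[OF tendsto_real_sqrt[OF tendsto_add[OF tendsto_const LIMSEQ_inverse_real_of_nat, of d]] y(2)]
      by simp
    show "\<forall>\<^sub>F n in sequentially.
        hnorm H (x \<ominus> y) \<le> sqrt (d + inverse (real (Suc n))) + hnorm H (s n \<ominus> y)"
    proof (intro always_eventually allI)
      fix n
      have "hnorm H (x \<ominus> s n) \<le> sqrt (d + inverse (real (Suc n)))"
        using s(2)[of n] by (intro real_le_rsqrt) simp
      then show "hnorm H (x \<ominus> y) \<le> sqrt (d + inverse (real (Suc n))) + hnorm H (s n \<ominus> y)"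
        using hnorm_triangle_minus[OF x sH y(1), of n] by simp
    qed
  qed simp
  then have min: "(hnorm H (x \<ominus> y))\<^sup>2 \<le> d"
    using hnorm_nonneg[of "x \<ominus> y"] x y(1) d_le[OF yK]
    by (metis M.minus_closed abs_of_nonneg real_sqrt_le_iff real_sqrt_abs)
  have "cinner H (x \<ominus> y) z = 0" if z: "z \<in> K" for z
  proof -
    let ?s = "cinner H (x \<ominus> y) z"
    (* A step so short that the quadratic term of the squared distance stays below the linear gain. *)
    define t where "t = 1 / ((hnorm H z)\<^sup>2 + 1)"
    have zH: "z \<in> carrier H" using z KH by blast
    define c where "c = - (of_real t * ?s)"
    have t: "t > 0" "t * (hnorm H z)\<^sup>2 \<le> 1"
      unfolding t_def using add_nonneg_pos[OF zero_le_power2 zero_less_one, of "hnorm H z"]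
      by (auto simp: pos_divide_le_eq)
    have "y \<ominus> c \<odot> z \<in> K" using yK z Kc(4) closed_subspace_minus[OF K] by blast
    moreover have "x \<ominus> (y \<ominus> c \<odot> z) = (x \<ominus> y) \<oplus> c \<odot> z"
      using x y(1) zH by (intro cinner_eqI) (auto simp: cinner_simps)
    ultimately have "(hnorm H (x \<ominus> y))\<^sup>2 \<le> (hnorm H ((x \<ominus> y) \<oplus> c \<odot> z))\<^sup>2"
      using d_le min by fastforce
    also have "\<dots> = (hnorm H (x \<ominus> y))\<^sup>2 + 2 * Re (cnj c * ?s) + (cmod c)\<^sup>2 * (hnorm H z)\<^sup>2"
      using x y(1) zH by (intro hnorm_add_smult_sq) auto
    also have "cnj c * ?s = of_real (- (t * (cmod ?s)\<^sup>2))"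
      unfolding c_def of_real_minus of_real_mult complex_norm_square by simp
    also have "(cmod c)\<^sup>2 = t * (t * (cmod ?s)\<^sup>2)"
      unfolding c_def by (simp add: norm_mult power_mult_distrib power2_eq_square)
    finally have "2 * (t * (cmod ?s)\<^sup>2) \<le> (t * (cmod ?s)\<^sup>2) * (t * (hnorm H z)\<^sup>2)"
      by (simp add: algebra_simps)
    also have "\<dots> \<le> (t * (cmod ?s)\<^sup>2) * 1"
      using t by (intro mult_left_mono) auto
    finally have "t * (cmod ?s)\<^sup>2 \<le> 0" by simp
    then show ?thesis using t(1) by (simp add: mult_le_0_iff)
  qed
  then show ?thesis using yK by blast
qed

text \<open>
  The functional is a multiple of the inner product with a vector \<open>z\<close> orthogonal to its kernel, since the
  kernel has codimension one.
\<close>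

lemma Riesz_representation:
  assumes add: "\<And>x y. x \<in> carrier H \<Longrightarrow> y \<in> carrier H \<Longrightarrow> F (x \<oplus> y) = F x + F y"
    and smult: "\<And>c x. x \<in> carrier H \<Longrightarrow> F (c \<odot> x) = c * F x"
    and bound: "\<And>x. x \<in> carrier H \<Longrightarrow> cmod (F x) \<le> b * hnorm H x"
  shows "\<exists>y\<in>carrier H. \<forall>x\<in>carrier H. F x = cinner H x y"
proof (cases "\<forall>x\<in>carrier H. F x = 0")
  case True
  then show ?thesis by (intro bexI[of _ \<zero>]) auto
next
  case False
  then obtain x where x: "x \<in> carrier H" "F x \<noteq> 0" by blast
  define N where "N = {x \<in> carrier H. F x = 0}"
  obtain p where p: "p \<in> N" "\<And>z. z \<in> N \<Longrightarrow> cinner H (x \<ominus> p) z = 0"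
    using projection[OF closed_subspace_kernel[OF assms] x(1)] unfolding N_def by blast
  define z where "z = x \<ominus> p"
  have pc: "p \<in> carrier H" "F p = 0" using p(1) unfolding N_def by auto
  have z: "z \<in> carrier H" using x pc unfolding z_def by simp
  have "x = z \<oplus> p" unfolding z_def using x pc by (intro cinner_eqI) (auto simp: cinner_simps)
  then have Fz: "F z = F x" using add[of z p] z pc by simp
  have "z \<noteq> \<zero>" using Fz x(2) smult[of \<zero> 0] by auto
  then have nz: "cinner H z z \<noteq> 0" using cinner_self_eq_zero[OF z] by blast
  show ?thesis
  proof (intro bexI ballI)
    show "cnj (F z / cinner H z z) \<odot> z \<in> carrier H" using z by simp
    fix h assume h: "h \<in> carrier H"
    define v where "v = h \<oplus> (- (F h / F z)) \<odot> z"
    have "F v = F h + F ((- (F h / F z)) \<odot> z)" unfolding v_def using h z by (intro add) auto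
    also have "\<dots> = 0" using smult[OF z] Fz x(2) by simp
    finally have "v \<in> N" unfolding N_def v_def using h z by simp
    then have "cinner H z v = 0" using p(2) unfolding z_def by blast
    then have "cinner H v z = 0" using cinner_commute[of z v] z h unfolding v_def by simp
    then have "cinner H h z = (F h / F z) * cinner H z z"
      unfolding v_def using h z by (simp add: cinner_simps)
    then show "F h = cinner H h (cnj (F z / cinner H z z) \<odot> z)"
      using h z nz Fz x(2) by (simp add: cinner_smult_right)
  qed
qed

end

section \<open>Orthogonal sequences and bounded operators\<close>

text \<open>
  Zero entries are permitted, so that bases of finite-dimensional spaces are covered as well and
  Gram-Schmidt orthogonalization of a linearly dependent sequence needs no reindexing.
\<close>

definition ortho_seq :: "'a inner_space \<Rightarrow> (nat \<Rightarrow> 'a) \<Rightarrow> bool" where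
  "ortho_seq H e \<longleftrightarrow> (\<forall>k. e k \<in> carrier H) \<and>
    (\<forall>j k. cinner H (e j) (e k) = (if j = k \<and> e k \<noteq> \<zero>\<^bsub>H\<^esub> then 1 else 0))"

context complex_inner_space
begin

lemma bounded_opsI:
  assumes "\<And>x. x \<in> carrier H \<Longrightarrow> T x \<in> carrier H"
    and "\<And>x. x \<notin> carrier H \<Longrightarrow> T x = undefined"
    and "\<And>x y. x \<in> carrier H \<Longrightarrow> y \<in> carrier H \<Longrightarrow> T (x \<oplus> y) = T x \<oplus> T y"
    and "\<And>c x. x \<in> carrier H \<Longrightarrow> T (c \<odot> x) = c \<odot> T x"
    and "\<And>x. x \<in> carrier H \<Longrightarrow> hnorm H (T x) \<le> b * hnorm H x"
  shows "T \<in> bounded_ops H"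
  unfolding bounded_ops_def using assms
  by (intro CollectI conjI exI[of _ b]) (auto simp: PiE_def extensional_def)

lemma bounded_opsD:
  assumes "T \<in> bounded_ops H"
  shows "x \<in> carrier H \<Longrightarrow> T x \<in> carrier H"
    and "x \<notin> carrier H \<Longrightarrow> T x = undefined"
    and "x \<in> carrier H \<Longrightarrow> y \<in> carrier H \<Longrightarrow> T (x \<oplus> y) = T x \<oplus> T y"
    and "x \<in> carrier H \<Longrightarrow> T (c \<odot> x) = c \<odot> T x"
  using assms unfolding bounded_ops_def by (auto simp: PiE_def extensional_def)

lemma bounded_ops_bound:
  assumes "T \<in> bounded_ops H"
  obtains b where "b > 0" "\<And>x. x \<in> carrier H \<Longrightarrow> hnorm H (T x) \<le> b * hnorm H x"
proof -
  obtain b where b: "\<And>x. x \<in> carrier H \<Longrightarrow> hnorm H (T x) \<le> b * hnorm H x"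
    using assms unfolding bounded_ops_def by blast
  show ?thesis
  proof (rule that[of "max b 1"])
    fix x assume x: "x \<in> carrier H"
    have "b * hnorm H x \<le> max b 1 * hnorm H x"
      using hnorm_nonneg[OF x] by (intro mult_right_mono) auto
    with b[OF x] show "hnorm H (T x) \<le> max b 1 * hnorm H x" by linarith
  qed simp
qed

lemma bounded_ops_eqI:
  assumes "S \<in> bounded_ops H" "T \<in> bounded_ops H"
    and "\<And>x. x \<in> carrier H \<Longrightarrow> S x = T x"
  shows "S = T"
proof
  fix x
  show "S x = T x"
    using assms bounded_opsD(2)[of S x] bounded_opsD(2)[of T x] by (cases "x \<in> carrier H") auto
qed

lemma adjoint_op_eqI:
  assumes S: "S \<in> bounded_ops H" and T: "T \<in> bounded_ops H"
    and adj: "\<And>x y. x \<in> carrier H \<Longrightarrow> y \<in> carrier H \<Longrightarrow> cinner H (T x) y = cinner H x (S y)"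
  shows "adjoint_op H T = S"
  unfolding adjoint_op_def
proof (rule the_equality)
  fix S' assume S': "S' \<in> bounded_ops H \<and>
    (\<forall>x\<in>carrier H. \<forall>y\<in>carrier H. cinner H (T x) y = cinner H x (S' y))"
  show "S' = S"
  proof (rule bounded_ops_eqI)
    fix y assume y: "y \<in> carrier H"
    show "S' y = S y"
    proof (rule cinner_eqI)
      fix z assume z: "z \<in> carrier H"
      have "cinner H z (S' y) = cinner H z (S y)" using S' adj y z by metis
      then show "cinner H (S' y) z = cinner H (S y) z"
        using y z S S' bounded_opsD(1) cinner_commute by metis
    qed (use y S S' bounded_opsD(1) in auto)
  qed (use S S' in auto)
qed (use S adj in auto)

lemma orth_proj_eqI:
  assumes K: "closed_subspace H K" and x: "x \<in> carrier H" and y: "y \<in> K"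
    and orth: "\<And>z. z \<in> K \<Longrightarrow> cinner H (x \<ominus> y) z = 0"
  shows "orth_proj H K x = y"
  unfolding orth_proj_def
proof (rule the_equality)
  fix y' assume y': "y' \<in> K \<and> (\<forall>z\<in>K. cinner H (x \<ominus> y') z = 0)"
  have c: "y \<in> carrier H" "y' \<in> carrier H" using closed_subspaceD(1)[OF K] y y' by auto
  have d: "y' \<ominus> y \<in> K" using closed_subspace_minus[OF K] y y' by blast
  then have "cinner H (y' \<ominus> y) (y' \<ominus> y) = 0"
    using orth[OF d] bspec[OF conjunct2[OF y'] d] c x by (simp add: cinner_diff_left)
  then have "y' \<ominus> y = \<zero>" using c cinner_self_eq_zero by simp
  then show "y' = y" using minus_eq_zero_iff c by blast
qed (use y orth in auto)

text \<open>
  For \<open>z = \<Sum> a\<^sub>p y\<^sub>p\<close> with \<open>a\<^sub>p = \<langle>h, y\<^sub>p\<rangle>\<close>, the sum \<open>S\<close> to be estimated is \<open>\<langle>h, z\<rangle>\<close>. The product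
  form of the bound on the mixed inner products turns \<open>\<parallel>z\<parallel>\<^sup>2\<close> into at most \<open>2 S + (\<Sum> \<bar>a\<^sub>p\<bar> e\<^sub>p)\<^sup>2\<close>, which is at
  most \<open>3 S\<close>; the Cauchy-Schwarz inequality for \<open>h\<close> and \<open>z\<close> gives the claim.
\<close>

lemma Bessel_near_orthogonal:
  assumes "finite I" and y: "\<And>p. p \<in> I \<Longrightarrow> y p \<in> carrier H" and h: "h \<in> carrier H"
    and diag: "\<And>p. p \<in> I \<Longrightarrow> (hnorm H (y p))\<^sup>2 \<le> 2"
    and off: "\<And>p q. p \<in> I \<Longrightarrow> q \<in> I \<Longrightarrow> p \<noteq> q \<Longrightarrow> cmod (cinner H (y p) (y q)) \<le> e p * e q"
    and e: "\<And>p. p \<in> I \<Longrightarrow> 0 \<le> e p" "(\<Sum>p\<in>I. (e p)\<^sup>2) \<le> 1"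
  shows "(\<Sum>p\<in>I. (cmod (cinner H h (y p)))\<^sup>2) \<le> 3 * (hnorm H h)\<^sup>2"
proof -
  define a where "a p = cinner H h (y p)" for p
  define S where "S = (\<Sum>p\<in>I. (cmod (a p))\<^sup>2)"
  define z where "z = (\<Oplus>\<^bsub>H\<^esub>p\<in>I. a p \<odot> y p)"
  have z: "z \<in> carrier H" unfolding z_def using y by (intro M.finsum_closed) auto
  have zc: "cinner H z u = (\<Sum>p\<in>I. a p * cinner H (y p) u)" if "u \<in> carrier H" for u
    unfolding z_def using assms(1) y that by (simp add: cinner_finsum_left cinner_smult_left)
  have zy: "cinner H u z = (\<Sum>p\<in>I. cnj (a p) * cinner H u (y p))" if "u \<in> carrier H" for u
  proof -
    have "cinner H u z = (\<Sum>p\<in>I. cnj (a p * cinner H (y p) u))"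
      using cinner_commute[OF z that] zc[OF that] by simp
    also have "\<dots> = (\<Sum>p\<in>I. cnj (a p) * cinner H u (y p))"
    proof (rule sum.cong[OF refl])
      fix p assume "p \<in> I"
      from cinner_commute[OF y[OF this] that]
      show "cnj (a p * cinner H (y p) u) = cnj (a p) * cinner H u (y p)" by simp
    qed
    finally show ?thesis .
  qed
  have S0: "S \<ge> 0" unfolding S_def by (intro sum_nonneg) auto
  have "cinner H h z = of_real S"
    unfolding zy[OF h] S_def a_def of_real_sum complex_norm_square by (simp add: mult.commute)
  then have "S \<le> hnorm H h * hnorm H z"
    using Cauchy_Schwarz[OF h z] S0 by simp
  then have S1: "S\<^sup>2 \<le> (hnorm H h)\<^sup>2 * (hnorm H z)\<^sup>2"
    using S0 by (metis power_mono power_mult_distrib)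
  have prod_le: "cmod (a p * (cnj (a q) * cinner H (y p) (y q))) \<le>
      (if p = q then 2 * (cmod (a p))\<^sup>2 else 0) + (cmod (a p) * e p) * (cmod (a q) * e q)"
    if "p \<in> I" "q \<in> I" for p q
  proof (cases "p = q")
    case True
    have "cmod (cinner H (y p) (y p)) \<le> 2"
      using cinner_self[OF y[OF that(1)]] diag[OF that(1)] by (simp add: norm_power)
    then have "cmod (a p) * cmod (a p) * cmod (cinner H (y p) (y p)) \<le> cmod (a p) * cmod (a p) * 2"
      by (intro mult_left_mono) auto
    moreover have "0 \<le> (cmod (a p) * e p) * (cmod (a p) * e p)" by simp
    ultimately have "cmod (a p) * cmod (a p) * cmod (cinner H (y p) (y p)) \<le>
        2 * (cmod (a p))\<^sup>2 + (cmod (a p) * e p) * (cmod (a p) * e p)"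
      unfolding power2_eq_square by linarith
    then show ?thesis using True by (simp add: norm_mult mult.assoc)
  next
    case False
    have "cmod (a p) * cmod (a q) * cmod (cinner H (y p) (y q)) \<le> cmod (a p) * cmod (a q) * (e p * e q)"
      using off[OF that False] by (intro mult_left_mono) auto
    then show ?thesis using False by (simp add: norm_mult mult_ac)
  qed
  have "(hnorm H z)\<^sup>2 = Re (cinner H z z)" using z by (rule hnorm_square)
  also have "cinner H z z = (\<Sum>p\<in>I. \<Sum>q\<in>I. a p * (cnj (a q) * cinner H (y p) (y q)))"
    unfolding zc[OF z] using y zy by (simp add: sum_distrib_left)
  also have "Re \<dots> \<le> cmod \<dots>" by (rule complex_Re_le_cmod)
  also have "\<dots> \<le> (\<Sum>p\<in>I. \<Sum>q\<in>I. cmod (a p * (cnj (a q) * cinner H (y p) (y q))))"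
    by (rule order_trans[OF norm_sum]) (intro sum_mono norm_sum)
  also have "\<dots> \<le> (\<Sum>p\<in>I. \<Sum>q\<in>I. (if p = q then 2 * (cmod (a p))\<^sup>2 else 0) +
      (cmod (a p) * e p) * (cmod (a q) * e q))"
    using prod_le by (intro sum_mono)
  also have "\<dots> = (\<Sum>p\<in>I. \<Sum>q\<in>I. if p = q then 2 * (cmod (a p))\<^sup>2 else 0) +
      (\<Sum>p\<in>I. \<Sum>q\<in>I. (cmod (a p) * e p) * (cmod (a q) * e q))"
    by (simp only: sum.distrib)
  also have "(\<Sum>p\<in>I. \<Sum>q\<in>I. if p = q then 2 * (cmod (a p))\<^sup>2 else 0) = 2 * S"
    unfolding S_def sum_distrib_left using assms(1) by (intro sum.cong refl) simp
  also have "(\<Sum>p\<in>I. \<Sum>q\<in>I. (cmod (a p) * e p) * (cmod (a q) * e q)) =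
      (\<Sum>p\<in>I. cmod (a p) * e p)\<^sup>2"
    unfolding power2_eq_square sum_product ..
  also have "(\<Sum>p\<in>I. cmod (a p) * e p)\<^sup>2 \<le> S * (\<Sum>p\<in>I. (e p)\<^sup>2)"
    unfolding S_def by (rule Cauchy_Schwarz_ineq_sum)
  also have "S * (\<Sum>p\<in>I. (e p)\<^sup>2) \<le> S * 1"
    using e(2) S0 by (intro mult_left_mono) auto
  finally have "(hnorm H z)\<^sup>2 \<le> 3 * S" by simp
  then have "S\<^sup>2 \<le> (hnorm H h)\<^sup>2 * (3 * S)"
    using S1 by (meson mult_left_mono order_trans zero_le_power2)
  then have "S * S \<le> S * (3 * (hnorm H h)\<^sup>2)" by (simp add: power2_eq_square mult_ac)
  then have "S \<le> 3 * (hnorm H h)\<^sup>2"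
    using S0 by (cases "S = 0") auto
  then show ?thesis unfolding S_def a_def .
qed

text \<open>
  Gram-Schmidt orthogonalization of a dense sequence \<open>d\<close>. Each new vector \<open>e k\<close> is normalized, or zero
  if \<open>d k\<close> depends on its predecessors, and is chosen such that whatever is orthogonal to \<open>e 0, \<dots>, e k\<close> is
  orthogonal to \<open>d k\<close>. A vector orthogonal to a dense sequence vanishes.
\<close>

lemma ortho_seq_total_exists:
  assumes "separable H"
  shows "\<exists>e. ortho_seq H e \<and> (\<forall>x\<in>carrier H. (\<forall>k. cinner H x (e k) = 0) \<longrightarrow> x = \<zero>)"
proof -
  obtain C where C: "countable C" "C \<subseteq> carrier H" "metric.mtopology closure_of C = carrier H"
    using assms unfolding separable_def separable_space_def by auto
  define d where "d = from_nat_into (insert \<zero> C)"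
  have dH: "d k \<in> carrier H" for k
    using from_nat_into[of "insert \<zero> C" k] C(2) unfolding d_def by auto
  have d_surj: "\<exists>k. d k = x" if "x \<in> C" for x
    using from_nat_into_surj[of "insert \<zero> C" x] C(1) that unfolding d_def by auto
  define P where "P = (\<lambda>e k v. v \<in> carrier H \<and> (v = \<zero> \<or> cinner H v v = 1) \<and>
    (\<forall>j. j < k \<longrightarrow> cinner H v (e j) = 0) \<and>
    (\<forall>z\<in>carrier H. (\<forall>j. j < k \<longrightarrow> cinner H z (e j) = 0) \<and> cinner H z v = 0 \<longrightarrow>
      cinner H (d k) z = 0))"
  have "\<exists>e. \<forall>k. P e k (e k)"
  proof (rule dependent_wf_choice[OF wf_less])
    fix k :: nat and e
    assume IH: "\<And>j. (j, k) \<in> {(i, j). i < j} \<Longrightarrow> P e j (e j)"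
    then have e: "e j \<in> carrier H" "e j = \<zero> \<or> cinner H (e j) (e j) = 1" if "j < k" for j
      using that unfolding P_def by auto
    have ort: "cinner H (e i) (e j) = 0" if "i < k" "j < k" "i \<noteq> j" for i j
    proof (cases "j < i")
      case True
      then show ?thesis using IH[of i] that unfolding P_def by auto
    next
      case False
      then have "cinner H (e j) (e i) = 0" using IH[of j] that unfolding P_def by auto
      then show ?thesis using cinner_commute[of "e j" "e i"] e that by simp
    qed
    define p where "p = (\<Oplus>\<^bsub>H\<^esub>j\<in>{..<k}. cinner H (d k) (e j) \<odot> e j)"
    define w where "w = d k \<ominus> p"
    have p: "p \<in> carrier H" unfolding p_def using e by (intro M.finsum_closed) auto
    have w: "w \<in> carrier H" unfolding w_def using dH p by simp
    have pz: "cinner H p z = (\<Sum>j<k. cinner H (d k) (e j) * cinner H (e j) z)" if "z \<in> carrier H" for z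
    proof -
      have "cinner H p z = (\<Sum>j<k. cinner H (cinner H (d k) (e j) \<odot> e j) z)"
        unfolding p_def using e(1) that by (intro cinner_finsum_left) auto
      then show ?thesis using e(1) that by (simp add: cinner_smult_left)
    qed
    have we: "cinner H w (e i) = 0" if "i < k" for i
    proof -
      have "cinner H p (e i) = (\<Sum>j<k. if j = i then cinner H (d k) (e i) else 0)"
        unfolding pz[OF e(1)[OF that]] using e[OF that] ort that dH
        by (intro sum.cong) auto
      then show ?thesis unfolding w_def using that dH p e by (simp add: cinner_diff_left)
    qed
    have dz: "cinner H (d k) z = cinner H w z + (\<Sum>j<k. cinner H (d k) (e j) * cinner H (e j) z)"
      if "z \<in> carrier H" for z
      unfolding w_def using pz[OF that] that dH p by (simp add: cinner_diff_left)
    (* If w vanishes, then so does v, since the inverse of 0 is 0. *)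
    define v where "v = of_real (inverse (hnorm H w)) \<odot> w"
    have v: "v \<in> carrier H" unfolding v_def using w by simp
    have wz: "cinner H w z = 0" if "cinner H z v = 0" "z \<in> carrier H" for z
    proof (cases "hnorm H w = 0")
      case True
      then show ?thesis using w hnorm_eq_zero that by simp
    next
      case False
      then have "cinner H z w = 0" using that w unfolding v_def by (simp add: cinner_smult_right)
      then show ?thesis using cinner_commute[of z w] that w by simp
    qed
    show "\<exists>v. P e k v"
      unfolding P_def
    proof (intro exI[of _ v] conjI ballI impI allI)
      show "v = \<zero> \<or> cinner H v v = 1"
      proof (cases "hnorm H w = 0")
        case True
        then show ?thesis using w hnorm_eq_zero v_def by simp
      next
        case False
        then have "hnorm H v = 1"
          unfolding v_def using w hnorm_nonneg[OF w] by (simp add: hnorm_smult del: of_real_inverse)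
        then show ?thesis using cinner_self[OF v] by simp
      qed
      show "cinner H v (e j) = 0" if "j < k" for j
        using we[of j] that w e unfolding v_def by (simp add: cinner_smult_left)
      show "cinner H (d k) z = 0" if z: "z \<in> carrier H"
        and o: "(\<forall>j. j < k \<longrightarrow> cinner H z (e j) = 0) \<and> cinner H z v = 0" for z
      proof -
        have "cinner H (e j) z = 0" if "j < k" for j
          using o that e(1)[OF that] z cinner_commute[of z "e j"] by simp
        then show ?thesis using dz[OF z] wz[of z] o z by simp
      qed
    qed (rule v)
  qed (simp add: P_def)
  then obtain e where "\<forall>k. P e k (e k)" by blast
  then have e: "\<And>k. e k \<in> carrier H" "\<And>k. e k = \<zero> \<or> cinner H (e k) (e k) = 1"
    "\<And>j k. j < k \<Longrightarrow> cinner H (e k) (e j) = 0"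
    "\<And>k z. z \<in> carrier H \<Longrightarrow> \<forall>j. cinner H z (e j) = 0 \<Longrightarrow> cinner H (d k) z = 0"
    unfolding P_def by blast+
  have "cinner H (e j) (e k) = (if j = k \<and> e k \<noteq> \<zero> then 1 else 0)" for j k
  proof (cases j k rule: linorder_cases)
    case less
    then show ?thesis using e(3)[OF less] cinner_commute[of "e k" "e j"] e(1) by simp
  qed (use e in auto)
  then have "ortho_seq H e" unfolding ortho_seq_def using e(1) by blast
  moreover have "x = \<zero>" if x: "x \<in> carrier H" and ort: "\<forall>k. cinner H x (e k) = 0" for x
  proof (rule ccontr)
    assume "x \<noteq> \<zero>"
    then have pos: "hnorm H x > 0" using hnorm_eq_zero hnorm_nonneg x by (metis less_eq_real_def)
    then obtain c where "c \<in> C" "hdist H x c < hnorm H x"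
      using C(3) x by (force simp: metric.metric_closure_of)
    then obtain k where k: "hnorm H (x \<ominus> d k) < hnorm H x"
    proof -
      obtain k where "d k = c" using d_surj[OF \<open>c \<in> C\<close>] by blast
      then show thesis using \<open>hdist H x c < hnorm H x\<close> x dH[of k] by (intro that[of k]) (simp add: hdist_def)
    qed
    have "cinner H (d k) x = 0" using e(4) x ort by blast
    then have "(hnorm H x)\<^sup>2 = cmod (cinner H (x \<ominus> d k) x)"
      using x dH cinner_self[OF x] by (simp add: cinner_diff_left norm_power)
    also have "\<dots> \<le> hnorm H (x \<ominus> d k) * hnorm H x" using Cauchy_Schwarz x dH by simp
    also have "\<dots> < hnorm H x * hnorm H x" using k pos by (intro mult_strict_right_mono)
    finally show False by (simp add: power2_eq_square)
  qed
  ultimately show ?thesis by blast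
qed

text \<open>
  A vector minus its expansion in the finitely many non-zero \<open>e k\<close> is orthogonal to all \<open>e k\<close>. The basis
  in the definition of finite dimension is a set, so the expansion is indexed by the vectors themselves.
\<close>

lemma finite_dimensional_if_finite_ortho:
  assumes e: "ortho_seq H e" and tot: "\<And>x. x \<in> carrier H \<Longrightarrow> (\<And>k. cinner H x (e k) = 0) \<Longrightarrow> x = \<zero>"
    and fin: "finite {k. e k \<noteq> \<zero>}"
  shows "finite_dimensional H"
proof -
  define B where "B = e ` {k. e k \<noteq> \<zero>}"
  have B: "finite B" "B \<subseteq> carrier H"
    using fin e unfolding B_def ortho_seq_def by auto
  have ort: "cinner H b (e k) = (if b = e k then 1 else 0)" if "b \<in> B" "e k \<noteq> \<zero>" for b k
  proof -
    obtain j where j: "b = e j" "e j \<noteq> \<zero>" using \<open>b \<in> B\<close> unfolding B_def by blast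
    have "e j \<noteq> e k" if "j \<noteq> k"
    proof
      assume "e j = e k"
      then have "cinner H (e j) (e k) = 1" using e \<open>e k \<noteq> \<zero>\<close> unfolding ortho_seq_def by metis
      then show False using e that unfolding ortho_seq_def by simp
    qed
    then show ?thesis using e j that unfolding ortho_seq_def by auto
  qed
  have "x = (\<Oplus>\<^bsub>H\<^esub>b\<in>B. cinner H x b \<odot> b)" if x: "x \<in> carrier H" for x
  proof -
    define p where "p = (\<Oplus>\<^bsub>H\<^esub>b\<in>B. cinner H x b \<odot> b)"
    have p: "p \<in> carrier H" unfolding p_def using B by (intro M.finsum_closed) auto
    have "cinner H (x \<ominus> p) (e k) = 0" for k
    proof (cases "e k = \<zero>")
      case True
      then show ?thesis using x p by simp
    next
      case False
      have ek: "e k \<in> carrier H" "e k \<in> B" using e False unfolding ortho_seq_def B_def by auto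
      have bH: "b \<in> carrier H" if "b \<in> B" for b using B that by blast
      have "cinner H p (e k) = (\<Sum>b\<in>B. cinner H (cinner H x b \<odot> b) (e k))"
        unfolding p_def using B(1) ek bH by (intro cinner_finsum_left) auto
      also have "\<dots> = (\<Sum>b\<in>B. if b = e k then cinner H x b else 0)"
        using ort False ek bH by (intro sum.cong) (auto simp: cinner_smult_left)
      also have "\<dots> = cinner H x (e k)" using ek B(1) by simp
      finally show ?thesis using x p ek by (simp add: cinner_diff_left)
    qed
    then have "x \<ominus> p = \<zero>" using tot x p by simp
    then show ?thesis using minus_eq_zero_iff x p unfolding p_def by simp
  qed
  then show ?thesis unfolding finite_dimensional_def using B
    by (intro exI[of _ B] conjI ballI exI[of _ "\<lambda>b. cinner H _ b"])
qed

end

context hilbert_space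
begin

lemma bounded_form_operator:
  assumes "\<And>x y z. x \<in> carrier H \<Longrightarrow> y \<in> carrier H \<Longrightarrow> z \<in> carrier H \<Longrightarrow> B (x \<oplus> y) z = B x z + B y z"
    and "\<And>c x z. x \<in> carrier H \<Longrightarrow> z \<in> carrier H \<Longrightarrow> B (c \<odot> x) z = c * B x z"
    and "\<And>x y z. x \<in> carrier H \<Longrightarrow> y \<in> carrier H \<Longrightarrow> z \<in> carrier H \<Longrightarrow> B x (y \<oplus> z) = B x y + B x z"
    and "\<And>c x z. x \<in> carrier H \<Longrightarrow> z \<in> carrier H \<Longrightarrow> B x (c \<odot> z) = cnj c * B x z"
    and bound: "\<And>x y. x \<in> carrier H \<Longrightarrow> y \<in> carrier H \<Longrightarrow> cmod (B x y) \<le> b * hnorm H x * hnorm H y"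
  shows "\<exists>S\<in>bounded_ops H. \<forall>x\<in>carrier H. \<forall>y\<in>carrier H. cinner H (S x) y = B x y"
proof -
  have "\<exists>u\<in>carrier H. \<forall>y\<in>carrier H. cnj (B x y) = cinner H y u" if "x \<in> carrier H" for x
    using assms that by (intro Riesz_representation[where b = "b * hnorm H x"]) auto
  then obtain S where S: "\<And>x. x \<in> carrier H \<Longrightarrow> S x \<in> carrier H"
    "\<And>x y. x \<in> carrier H \<Longrightarrow> y \<in> carrier H \<Longrightarrow> cnj (B x y) = cinner H y (S x)"
    by metis
  define T where "T = restrict S (carrier H)"
  have T: "T x \<in> carrier H" if "x \<in> carrier H" for x using S(1) that unfolding T_def by simp
  have TB: "cinner H (T x) y = B x y" if "x \<in> carrier H" "y \<in> carrier H" for x y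
    using S(2)[OF that] cinner_commute[of y "S x"] S(1) that unfolding T_def
    by (metis complex_cnj_cnj restrict_apply')
  have "hnorm H (T x) \<le> b * hnorm H x" if x: "x \<in> carrier H" for x
  proof -
    have "cmod (B x (T x)) = (hnorm H (T x))\<^sup>2"
      using TB[OF x T[OF x]] cinner_self[OF T[OF x]] by (metis abs_power2 norm_of_real)
    then have "(hnorm H (T x))\<^sup>2 \<le> b * hnorm H x * hnorm H (T x)"
      using bound[OF x T[OF x]] by simp
    then have "hnorm H (T x) * hnorm H (T x) \<le> (b * hnorm H x) * hnorm H (T x)"
      by (simp add: power2_eq_square)
    moreover have "0 \<le> b * hnorm H x" if "hnorm H (T x) = 0"
    proof (cases "x = \<zero>")
      case False
      then have "hnorm H x > 0" using hnorm_eq_zero[OF x] hnorm_nonneg[OF x] by simp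
      moreover have "0 \<le> (b * hnorm H x) * hnorm H x"
        using bound[OF x x] norm_ge_zero order_trans by blast
      ultimately show ?thesis by (simp add: zero_le_mult_iff)
    qed simp
    ultimately show ?thesis
      using hnorm_nonneg[OF T[OF x]] by (cases "hnorm H (T x) = 0") auto
  qed
  then have "T \<in> bounded_ops H"
    using T TB assms(1,2) by (intro bounded_opsI)
      (auto intro!: cinner_eqI simp: cinner_simps T_def[THEN arg_cong[of _ _ "\<lambda>f. f _"]])
  then show ?thesis using TB by blast
qed

lemma adjoint_op:
  assumes T: "T \<in> bounded_ops H"
  shows "adjoint_op H T \<in> bounded_ops H"
    and "\<And>x y. x \<in> carrier H \<Longrightarrow> y \<in> carrier H \<Longrightarrow> cinner H (T x) y = cinner H x (adjoint_op H T y)"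
proof -
  obtain b where b: "b > 0" "\<And>x. x \<in> carrier H \<Longrightarrow> hnorm H (T x) \<le> b * hnorm H x"
    using bounded_ops_bound[OF T] by blast
  note Tc = bounded_opsD[OF T]
  have "\<exists>S\<in>bounded_ops H. \<forall>x\<in>carrier H. \<forall>y\<in>carrier H. cinner H (S x) y = cinner H x (T y)"
  proof (rule bounded_form_operator)
    fix x y assume c: "x \<in> carrier H" "y \<in> carrier H"
    have "cmod (cinner H x (T y)) \<le> hnorm H x * hnorm H (T y)" using Cauchy_Schwarz c Tc by blast
    also have "\<dots> \<le> hnorm H x * (b * hnorm H y)" using b(2) c hnorm_nonneg by (intro mult_left_mono) auto
    finally show "cmod (cinner H x (T y)) \<le> b * hnorm H x * hnorm H y" by (simp add: mult_ac)
  qed (simp_all add: cinner_simps Tc)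
  then obtain S where S: "S \<in> bounded_ops H"
    "\<And>x y. x \<in> carrier H \<Longrightarrow> y \<in> carrier H \<Longrightarrow> cinner H (S x) y = cinner H x (T y)" by blast
  have adj: "cinner H (T x) y = cinner H x (S y)" if "x \<in> carrier H" "y \<in> carrier H" for x y
    using S(2)[OF that(2,1)] cinner_commute[of x "S y"] cinner_commute[of "T x" y]
      bounded_opsD(1)[OF S(1)] Tc(1) cinner_commute that by metis
  have "adjoint_op H T = S" using S(1) T adj by (rule adjoint_op_eqI)
  then show "adjoint_op H T \<in> bounded_ops H"
    "\<And>x y. x \<in> carrier H \<Longrightarrow> y \<in> carrier H \<Longrightarrow> cinner H (T x) y = cinner H x (adjoint_op H T y)"
    using S(1) adj by auto
qed

text \<open>
  Equal matrices give equal columns \<open>S (e k) = T (e k)\<close>. To pass from the \<open>e k\<close> to all vectors without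
  expanding in series, the columns are read as rows of the adjoints: the adjoints of \<open>S\<close> and \<open>T\<close> agree, and
  hence so do \<open>S\<close> and \<open>T\<close>.
\<close>

lemma operator_eq_by_matrix:
  assumes S: "S \<in> bounded_ops H" and T: "T \<in> bounded_ops H" and eH: "\<And>k::nat. e k \<in> carrier H"
    and tot: "\<And>x. x \<in> carrier H \<Longrightarrow> (\<And>k. cinner H x (e k) = 0) \<Longrightarrow> x = \<zero>"
    and eq: "\<And>j k. cinner H (S (e k)) (e j) = cinner H (T (e k)) (e j)"
  shows "S = T"
proof -
  note Sc = bounded_opsD(1)[OF S] and Tc = bounded_opsD(1)[OF T]
  have col: "S (e k) = T (e k)" for k
  proof -
    have "S (e k) \<ominus> T (e k) = \<zero>"
    proof (rule tot)
      show "cinner H (S (e k) \<ominus> T (e k)) (e j) = 0" for j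
        using Sc[OF eH] Tc[OF eH] eH eq[of k j] by (simp add: cinner_diff_left)
    qed (simp add: Sc Tc eH)
    then show ?thesis using minus_eq_zero_iff[OF Sc[OF eH] Tc[OF eH]] by blast
  qed
  note Sa = bounded_opsD(1)[OF adjoint_op(1)[OF S]] and Ta = bounded_opsD(1)[OF adjoint_op(1)[OF T]]
  have adj: "adjoint_op H S y = adjoint_op H T y" if y: "y \<in> carrier H" for y
  proof -
    have "cinner H (e k) (adjoint_op H S y) = cinner H (e k) (adjoint_op H T y)" for k
      using adjoint_op(2)[OF S eH[of k] y] adjoint_op(2)[OF T eH[of k] y] col[of k] by simp
    then have "cinner H (adjoint_op H S y) (e k) = cinner H (adjoint_op H T y) (e k)" for k
      using cinner_commute[OF eH[of k] Sa[OF y]] cinner_commute[OF eH[of k] Ta[OF y]] by simp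
    then have "adjoint_op H S y \<ominus> adjoint_op H T y = \<zero>"
      using Sa[OF y] Ta[OF y] eH by (intro tot) (simp_all add: cinner_diff_left)
    then show ?thesis using minus_eq_zero_iff[OF Sa[OF y] Ta[OF y]] by blast
  qed
  show ?thesis
  proof (rule bounded_ops_eqI[OF S T])
    fix x assume x: "x \<in> carrier H"
    show "S x = T x"
    proof (rule cinner_eqI[OF Sc[OF x] Tc[OF x]])
      fix y assume y: "y \<in> carrier H"
      show "cinner H (S x) y = cinner H (T x) y"
        using adjoint_op(2)[OF S x y] adjoint_op(2)[OF T x y] adj[OF y] by simp
    qed
  qed
qed

lemma orth_proj:
  assumes K: "closed_subspace H K" and x: "x \<in> carrier H"
  shows "orth_proj H K x \<in> K"
    and "\<And>z. z \<in> K \<Longrightarrow> cinner H (orth_proj H K x) z = cinner H x z"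
proof -
  obtain y where y: "y \<in> K" "\<And>z. z \<in> K \<Longrightarrow> cinner H (x \<ominus> y) z = 0"
    using projection[OF K x] by blast
  then have eq: "orth_proj H K x = y" by (intro orth_proj_eqI[OF K x])
  show "orth_proj H K x \<in> K" using eq y by simp
  show "cinner H (orth_proj H K x) z = cinner H x z" if "z \<in> K" for z
  proof -
    have "y \<in> carrier H" "z \<in> carrier H" using closed_subspaceD(1)[OF K] y that by auto
    then show ?thesis using eq y(2)[OF that] x by (simp add: cinner_diff_left)
  qed
qed

lemma orth_proj_id: "closed_subspace H K \<Longrightarrow> x \<in> K \<Longrightarrow> orth_proj H K x = x"
proof (rule orth_proj_eqI)
  assume K: "closed_subspace H K" and x: "x \<in> K"
  show c: "x \<in> carrier H" using closed_subspaceD(1)[OF K] x by blast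
  fix z assume "z \<in> K"
  then have "z \<in> carrier H" using closed_subspaceD(1)[OF K] by blast
  then show "cinner H (x \<ominus> x) z = 0" using c by (simp add: cinner_diff_left)
qed

lemma subspace_of_hilbert_space:
  assumes K: "closed_subspace H K"
  shows "hilbert_space (subspace_of H K)"
proof -
  note Kc = closed_subspaceD[OF K]
  let ?S = "subspace_of H K"
  have simps: "carrier ?S = K" "cinner ?S = cinner H" "add ?S = add H" "smult ?S = smult H"
    "zero ?S = \<zero>" unfolding subspace_of_def by simp_all
  have sub: "submodule K complex_field H" using K unfolding closed_subspace_def by blast
  have "module complex_field ?S"
    using submodule.submodule_is_module[OF sub module_axioms] unfolding subspace_of_def .
  then interpret S: complex_inner_space ?S
  proof (intro complex_inner_space.intro complex_inner_space_axioms.intro, unfold simps)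
    have KH: "x \<in> carrier H" if "x \<in> K" for x using Kc(1) that by blast
    show "cinner H (x \<oplus> y) z = cinner H x z + cinner H y z" if "x \<in> K" "y \<in> K" "z \<in> K" for x y z
      using that KH by (simp add: cinner_add_left)
    show "cinner H (c \<odot> x) y = c * cinner H x y" if "x \<in> K" "y \<in> K" for c x y
      using that KH by (simp add: cinner_smult_left)
    show "cinner H y x = cnj (cinner H x y)" if "x \<in> K" "y \<in> K" for x y
      by (rule cinner_commute) (use that KH in auto)
    show "0 \<le> Re (cinner H x x)" if "x \<in> K" for x
      using that KH cinner_self_nonneg by blast
    show "x = \<zero>" if "x \<in> K" "cinner H x x = 0" for x
      using that KH cinner_self_eq_zero by blast
  qed
  have norm: "hnorm ?S x = hnorm H x" for x unfolding hnorm_def simps ..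
  have minus: "x \<ominus>\<^bsub>?S\<^esub> y = x \<ominus> y" if "x \<in> K" "y \<in> K" for x y
  proof (rule S.cinner_eqI)
    show "x \<ominus>\<^bsub>?S\<^esub> y \<in> carrier ?S" using that S.M.minus_closed[of x y] simps by simp
    show "x \<ominus> y \<in> carrier ?S" using that closed_subspace_minus[OF K] simps by simp
    fix z assume "z \<in> carrier ?S"
    then have z: "z \<in> K" unfolding simps .
    have "cinner H (x \<ominus>\<^bsub>?S\<^esub> y) z = cinner H x z - cinner H y z"
      using S.cinner_diff_left[of x y z, unfolded simps] that z .
    also have "\<dots> = cinner H (x \<ominus> y) z"
      by (rule cinner_diff_left[symmetric]) (use that z Kc(1) in auto)
    finally show "cinner ?S (x \<ominus>\<^bsub>?S\<^esub> y) z = cinner ?S (x \<ominus> y) z" unfolding simps .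
  qed
  have "S.metric.mcomplete"
    unfolding S.metric.mcomplete_def
  proof (intro allI impI)
    fix s assume s: "S.metric.MCauchy s"
    then have "range s \<subseteq> carrier ?S" unfolding S.metric.MCauchy_def by blast
    then have sK: "s n \<in> K" for n unfolding simps by blast
    have sH: "s n \<in> carrier H" for n using sK Kc(1) by blast
    have dist: "hdist ?S (s m) (s n) = hnorm H (s m \<ominus> s n)" for m n
      using sK[of m] sK[of n] minus[OF sK sK] unfolding hdist_def simps norm by simp
    have "\<exists>l\<in>carrier H. (\<lambda>n. hnorm H (s n \<ominus> l)) \<longlonglongrightarrow> 0"
      using s unfolding S.metric.MCauchy_def dist by (intro Cauchy_convergent[OF sH]) meson
    then obtain l where l: "l \<in> carrier H" "(\<lambda>n. hnorm H (s n \<ominus> l)) \<longlonglongrightarrow> 0" by blast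
    have lK: "l \<in> K" using Kc(5)[OF sK l] .
    have "hdist ?S (s n) l = \<bar>hnorm H (s n \<ominus> l)\<bar>" for n
      using sK[of n] lK minus[OF sK lK] hnorm_nonneg[of "s n \<ominus> l"] sH l(1)
      unfolding hdist_def simps norm by simp
    then have "limitin S.metric.mtopology s l sequentially"
      using l(2) lK sK unfolding S.metric.limitin_metric unfolding tendsto_iff dist_real_def simps
      by simp
    then show "\<exists>l. limitin S.metric.mtopology s l sequentially" by blast
  qed
  then show ?thesis by unfold_locales
qed

lemma cinner_compression:
  assumes K: "closed_subspace H K" and T: "T \<in> bounded_ops H" and x: "x \<in> K" and z: "z \<in> K"
  shows "cinner H (compression H K T x) z = cinner H (T x) z"
proof -
  have "x \<in> carrier H" using closed_subspaceD(1)[OF K] x by blast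
  then have "T x \<in> carrier H" by (rule bounded_opsD(1)[OF T])
  then show ?thesis
    unfolding compression_def using orth_proj_id[OF K x] orth_proj(2)[OF K _ z] x by simp
qed

lemma compression_bounded:
  assumes K: "closed_subspace H K" and T: "T \<in> bounded_ops H"
  shows "compression H K T \<in> bounded_ops (subspace_of H K)"
proof -
  interpret S: hilbert_space "subspace_of H K" using K by (rule subspace_of_hilbert_space)
  note Kc = closed_subspaceD[OF K] and Tc = bounded_opsD[OF T]
  have simps: "carrier (subspace_of H K) = K" "cinner (subspace_of H K) = cinner H"
    "add (subspace_of H K) = add H" "smult (subspace_of H K) = smult H"
    unfolding subspace_of_def by simp_all
  have KH: "x \<in> carrier H" if "x \<in> K" for x using Kc(1) that by blast
  have comp: "compression H K T x = orth_proj H K (T x)" if "x \<in> K" for x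
    unfolding compression_def using that orth_proj_id[OF K that] by simp
  have inn: "cinner H (compression H K T x) z = cinner H (T x) z" if "x \<in> K" "z \<in> K" for x z
    using K T that by (rule cinner_compression)
  have cl: "compression H K T x \<in> K" if "x \<in> K" for x
    using comp[OF that] orth_proj(1)[OF K] Tc(1) KH that by simp
  obtain b where b: "\<And>x. x \<in> carrier H \<Longrightarrow> hnorm H (T x) \<le> b * hnorm H x"
    using bounded_ops_bound[OF T] by blast
  show ?thesis
  proof (rule S.bounded_opsI, unfold simps)
    show "compression H K T x = undefined" if "x \<notin> K" for x
      using that unfolding compression_def by simp
    show "compression H K T (x \<oplus> y) = compression H K T x \<oplus> compression H K T y"
      if xy: "x \<in> K" "y \<in> K" for x y
    proof (rule S.cinner_eqI, unfold simps)
      fix z assume z: "z \<in> K"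
      have "cinner H (compression H K T (x \<oplus> y)) z = cinner H (T x) z + cinner H (T y) z"
        using inn[OF Kc(3)[OF xy] z] xy z KH Tc(1,3) by (simp add: cinner_add_left)
      also have "\<dots> = cinner H (compression H K T x \<oplus> compression H K T y) z"
        using inn[OF xy(1) z] inn[OF xy(2) z] cl xy z KH by (simp add: cinner_add_left)
      finally show "cinner H (compression H K T (x \<oplus> y)) z =
        cinner H (compression H K T x \<oplus> compression H K T y) z" .
    qed (use cl Kc(3) xy in auto)
    show "compression H K T (c \<odot> x) = c \<odot> compression H K T x" if x: "x \<in> K" for c x
    proof (rule S.cinner_eqI, unfold simps)
      fix z assume z: "z \<in> K"
      have "cinner H (compression H K T (c \<odot> x)) z = c * cinner H (T x) z"
        using inn[OF Kc(4)[OF x] z] x z KH Tc(1,4) by (simp add: cinner_smult_left)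
      also have "\<dots> = cinner H (c \<odot> compression H K T x) z"
        using inn[OF x z] cl x z KH by (simp add: cinner_smult_left)
      finally show "cinner H (compression H K T (c \<odot> x)) z = cinner H (c \<odot> compression H K T x) z" .
    qed (use cl Kc(4) x in auto)
    fix x assume x: "x \<in> K"
    let ?c = "compression H K T x"
    have "hnorm H ?c * hnorm H ?c = cmod (cinner H (T x) ?c)"
      using inn[OF x cl[OF x]] cinner_self[OF KH[OF cl[OF x]]]
      by (metis abs_power2 norm_of_real power2_eq_square)
    also have "\<dots> \<le> hnorm H (T x) * hnorm H ?c" using Cauchy_Schwarz Tc(1) KH cl x by simp
    finally have "hnorm H ?c \<le> hnorm H (T x)"
      using hnorm_nonneg[OF KH[OF cl[OF x]]] hnorm_nonneg[OF Tc(1)[OF KH[OF x]]]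
      by (cases "hnorm H ?c = 0") auto
    then show "hnorm (subspace_of H K) ?c \<le> b * hnorm (subspace_of H K) x"
      using b[OF KH[OF x]] unfolding hnorm_def simps by linarith
  qed (rule cl)
qed

end

section \<open>The limit space of weakly null sequences\<close>

text \<open>
  The weights have the form of a product bound suited to \<open>Bessel_near_orthogonal\<close>, and their squares have
  sum less than 1 over all pairs \<open>(i, k)\<close>.
\<close>

definition weight :: "nat \<Rightarrow> nat \<Rightarrow> real" where
  "weight i k = (1/2) ^ (i + k + 1)"

text \<open>
  Along the enumeration \<open>f\<close> of \<open>Z\<close>, the \<open>i\<close>-th block consists of the vectors \<open>x 0 (f i), \<dots>, x i (f i)\<close>;
  only finitely many of the sequences \<open>x k\<close> are considered at each index. All vectors of all blocks are
  almost orthogonal to each other.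
\<close>

definition near_orthogonal :: "'a inner_space \<Rightarrow> (nat \<Rightarrow> nat \<Rightarrow> 'a) \<Rightarrow> nat set \<Rightarrow> bool" where
  "near_orthogonal H x Z \<longleftrightarrow> (\<exists>f. strict_mono f \<and> range f = Z \<and>
    (\<forall>i. \<forall>k\<le>i. (hnorm H (x k (f i)))\<^sup>2 \<le> 2) \<and>
    (\<forall>i m. \<forall>k\<le>i. \<forall>l\<le>m. (i, k) \<noteq> (m, l) \<longrightarrow>
      cmod (cinner H (x k (f i)) (x l (f m))) \<le> weight i k * weight m l))"

definition bounded_seq :: "'a inner_space \<Rightarrow> (nat \<Rightarrow> 'a) \<Rightarrow> bool" where
  "bounded_seq H x \<longleftrightarrow> (\<forall>n. x n \<in> carrier H) \<and> (\<exists>b. \<forall>n. hnorm H (x n) \<le> b)"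

text \<open>
  The last two assumptions are what genericity of the filter provides. In the second one, \<open>G\<close> need not
  contain a set along which a given array is nearly orthogonal, but if it does not, then one of its sets
  has no such subset. The map \<open>w\<close> enumerates all arrays of vectors by real numbers.
\<close>

locale generic_sequences = hilbert_space H for H :: "'a inner_space" (structure) +
  fixes G :: "nat filter" and w :: "real \<Rightarrow> nat \<Rightarrow> nat \<Rightarrow> 'a"
  assumes G_nontrivial: "G \<noteq> bot" and G_free: "G \<le> sequentially"
    and w_surj: "(\<And>k n. x k n \<in> carrier H) \<Longrightarrow> \<exists>r. w r = x"
    and cinner_convergent: "bounded_seq H y \<Longrightarrow> bounded_seq H z \<Longrightarrow>
      \<exists>l. ((\<lambda>n. cinner H (y n) (z n)) \<longlongrightarrow> l) G"
    and near_orthogonal_decided: "(\<And>k n. x k n \<in> carrier H) \<Longrightarrow>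
      \<exists>Z. eventually (\<lambda>n. n \<in> Z) G \<and>
        (near_orthogonal H x Z \<or> (\<forall>Y\<subseteq>Z. infinite Y \<longrightarrow> \<not> near_orthogonal H x Y))"
begin

definition null_seqs :: "(nat \<Rightarrow> 'a) set" where
  "null_seqs = {x. bounded_seq H x \<and> (\<forall>h\<in>carrier H. ((\<lambda>n. cinner H (x n) h) \<longlongrightarrow> 0) G)}"

definition lim_inner :: "(nat \<Rightarrow> 'a) \<Rightarrow> (nat \<Rightarrow> 'a) \<Rightarrow> complex" where
  "lim_inner x y = Lim G (\<lambda>n. cinner H (x n) (y n))"

text \<open>
  A class of sequences is represented by the function of its inner products with all weakly null
  sequences, these being enumerated by real numbers. This is a canonical form of the class inside the
  type of functions from the reals to the complex numbers, and the vector space operations become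
  pointwise.
\<close>

definition coords :: "(nat \<Rightarrow> 'a) \<Rightarrow> real \<Rightarrow> complex" where
  "coords x = (\<lambda>r. if w r 0 \<in> null_seqs then lim_inner x (w r 0) else 0)"

definition lift :: "(real \<Rightarrow> complex) \<Rightarrow> nat \<Rightarrow> 'a" where
  "lift = inv_into null_seqs coords"

definition limit_space :: "(real \<Rightarrow> complex) inner_space" where
  "limit_space = \<lparr>carrier = coords ` null_seqs,
    mult = undefined, one = undefined,
    zero = (\<lambda>r. 0), add = (\<lambda>u v r. u r + v r),
    smult = (\<lambda>c u r. c * u r),
    cinner = (\<lambda>u v. lim_inner (lift u) (lift v))\<rparr>"

lemma seq_carrier: "x \<in> null_seqs \<Longrightarrow> x n \<in> carrier H"
  unfolding null_seqs_def bounded_seq_def by blast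

lemma seq_bound:
  assumes "x \<in> null_seqs"
  obtains b where "b > 0" "\<And>n. hnorm H (x n) \<le> b"
proof -
  obtain b where b: "\<And>n. hnorm H (x n) \<le> b"
    using assms unfolding null_seqs_def bounded_seq_def by blast
  show ?thesis by (rule that[of "max b 1"]) (use b in \<open>auto simp: le_max_iff_disj\<close>)
qed

lemma seq_weak_null: "x \<in> null_seqs \<Longrightarrow> h \<in> carrier H \<Longrightarrow> ((\<lambda>n. cinner H (x n) h) \<longlongrightarrow> 0) G"
  unfolding null_seqs_def by blast

lemma null_seqsI:
  assumes "\<And>n. x n \<in> carrier H" "\<And>n. hnorm H (x n) \<le> b"
    and "\<And>h. h \<in> carrier H \<Longrightarrow> ((\<lambda>n. cinner H (x n) h) \<longlongrightarrow> 0) G"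
  shows "x \<in> null_seqs"
  using assms unfolding null_seqs_def bounded_seq_def by blast

lemma null_seqs_add:
  assumes x: "x \<in> null_seqs" and y: "y \<in> null_seqs"
  shows "(\<lambda>n. x n \<oplus> y n) \<in> null_seqs"
proof -
  note c = seq_carrier[OF x] seq_carrier[OF y]
  obtain a b where a: "\<And>n. hnorm H (x n) \<le> a" and b: "\<And>n. hnorm H (y n) \<le> b"
    using seq_bound x y by metis
  show ?thesis
  proof (rule null_seqsI)
    show "hnorm H (x n \<oplus> y n) \<le> a + b" for n
      using hnorm_triangle[OF c(1) c(2), of n n] a[of n] b[of n] by linarith
    show "((\<lambda>n. cinner H (x n \<oplus> y n) h) \<longlongrightarrow> 0) G" if "h \<in> carrier H" for h
      using tendsto_add[OF seq_weak_null[OF x that] seq_weak_null[OF y that]] c that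
      by (simp add: cinner_add_left)
  qed (simp add: c)
qed

lemma null_seqs_op:
  assumes x: "x \<in> null_seqs" and T: "T \<in> bounded_ops H"
  shows "(\<lambda>n. T (x n)) \<in> null_seqs"
proof -
  note c = seq_carrier[OF x]
  obtain a where a: "\<And>n. hnorm H (x n) \<le> a" using seq_bound x by metis
  obtain b where b: "b > 0" "\<And>x. x \<in> carrier H \<Longrightarrow> hnorm H (T x) \<le> b * hnorm H x"
    using bounded_ops_bound[OF T] by blast
  show ?thesis
  proof (rule null_seqsI)
    show "hnorm H (T (x n)) \<le> b * a" for n
      using b(2)[OF c[of n]] mult_left_mono[OF a[of n], of b] b(1) by linarith
    show "((\<lambda>n. cinner H (T (x n)) h) \<longlongrightarrow> 0) G" if "h \<in> carrier H" for h
      using seq_weak_null[OF x bounded_opsD(1)[OF adjoint_op(1)[OF T] that]]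
      by (simp add: adjoint_op(2)[OF T c that])
  qed (simp add: bounded_opsD(1)[OF T c])
qed

lemma null_seqs_smult:
  assumes x: "x \<in> null_seqs"
  shows "(\<lambda>n. c \<odot> x n) \<in> null_seqs"
proof -
  note xc = seq_carrier[OF x]
  obtain a where a: "\<And>n. hnorm H (x n) \<le> a" using seq_bound x by metis
  show ?thesis
  proof (rule null_seqsI)
    show "hnorm H (c \<odot> x n) \<le> cmod c * a" for n
      using mult_left_mono[OF a[of n], of "cmod c"] xc by (simp add: hnorm_smult)
    show "((\<lambda>n. cinner H (c \<odot> x n) h) \<longlongrightarrow> 0) G" if "h \<in> carrier H" for h
      using tendsto_mult_right_zero[OF seq_weak_null[OF x that], of c] xc that
      by (simp add: cinner_smult_left)
  qed (simp add: xc)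
qed

lemma null_seqs_zero: "(\<lambda>n. \<zero>) \<in> null_seqs"
  by (rule null_seqsI[where b = 0]) auto

lemma null_seqs_diff:
  assumes x: "x \<in> null_seqs" and y: "y \<in> null_seqs"
  shows "(\<lambda>n. x n \<ominus> y n) \<in> null_seqs"
proof -
  have "x n \<ominus> y n = x n \<oplus> (- 1) \<odot> y n" for n
    using seq_carrier[OF x] seq_carrier[OF y] by (intro cinner_eqI) (auto simp: cinner_simps)
  then show ?thesis using null_seqs_add[OF x null_seqs_smult[OF y, of "- 1"]] by simp
qed

lemma lim_inner_tendsto:
  assumes "x \<in> null_seqs" "y \<in> null_seqs"
  shows "((\<lambda>n. cinner H (x n) (y n)) \<longlongrightarrow> lim_inner x y) G"
proof -
  obtain l where l: "((\<lambda>n. cinner H (x n) (y n)) \<longlongrightarrow> l) G"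
    using cinner_convergent assms unfolding null_seqs_def by blast
  then have "lim_inner x y = l" unfolding lim_inner_def by (rule tendsto_Lim[OF G_nontrivial])
  then show ?thesis using l by simp
qed

lemma lim_inner_eqI:
  assumes "((\<lambda>n. cinner H (x n) (y n)) \<longlongrightarrow> l) G"
  shows "lim_inner x y = l"
  unfolding lim_inner_def using assms by (rule tendsto_Lim[OF G_nontrivial])

lemma lim_inner_add_left:
  assumes "x \<in> null_seqs" "y \<in> null_seqs" "z \<in> null_seqs"
  shows "lim_inner (\<lambda>n. x n \<oplus> y n) z = lim_inner x z + lim_inner y z"
  using tendsto_add[OF lim_inner_tendsto[OF assms(1,3)] lim_inner_tendsto[OF assms(2,3)]] assms
  by (intro lim_inner_eqI) (simp add: cinner_add_left seq_carrier)

lemma lim_inner_diff_left: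
  assumes "x \<in> null_seqs" "y \<in> null_seqs" "z \<in> null_seqs"
  shows "lim_inner (\<lambda>n. x n \<ominus> y n) z = lim_inner x z - lim_inner y z"
  using tendsto_diff[OF lim_inner_tendsto[OF assms(1,3)] lim_inner_tendsto[OF assms(2,3)]] assms
  by (intro lim_inner_eqI) (simp add: cinner_diff_left seq_carrier)

lemma lim_inner_smult_left:
  assumes "x \<in> null_seqs" "z \<in> null_seqs"
  shows "lim_inner (\<lambda>n. c \<odot> x n) z = c * lim_inner x z"
  using tendsto_mult_left[OF lim_inner_tendsto[OF assms], of c] assms
  by (intro lim_inner_eqI) (simp add: cinner_smult_left seq_carrier)

lemma lim_inner_commute:
  assumes "x \<in> null_seqs" "y \<in> null_seqs"
  shows "lim_inner y x = cnj (lim_inner x y)"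
proof (rule lim_inner_eqI)
  have "cnj (cinner H (x n) (y n)) = cinner H (y n) (x n)" for n
    using cinner_commute[OF seq_carrier[OF assms(1)] seq_carrier[OF assms(2)], of n n] by simp
  then show "((\<lambda>n. cinner H (y n) (x n)) \<longlongrightarrow> cnj (lim_inner x y)) G"
    using tendsto_cnj[OF lim_inner_tendsto[OF assms]] by simp
qed

lemma lim_hnorm:
  assumes x: "x \<in> null_seqs"
  shows "((\<lambda>n. hnorm H (x n)) \<longlongrightarrow> sqrt (Re (lim_inner x x))) G"
  unfolding hnorm_def by (intro tendsto_real_sqrt tendsto_Re lim_inner_tendsto x)

lemma lim_inner_self_nonneg: "x \<in> null_seqs \<Longrightarrow> 0 \<le> Re (lim_inner x x)"
  using tendsto_lowerbound[OF tendsto_Re[OF lim_inner_tendsto] _ G_nontrivial, of x x 0]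
    cinner_self_nonneg seq_carrier by simp

text \<open>
  By the Cauchy-Schwarz inequality at each index. Hence sequences of norm 0 in the limit are
  represented by 0.
\<close>

lemma lim_inner_null:
  assumes x: "x \<in> null_seqs" and y: "y \<in> null_seqs" and null: "Re (lim_inner x x) = 0"
  shows "lim_inner x y = 0"
proof (rule lim_inner_eqI)
  obtain b where b: "\<And>n. hnorm H (y n) \<le> b" using seq_bound y by metis
  have lim: "((\<lambda>n. hnorm H (x n)) \<longlongrightarrow> 0) G" using lim_hnorm[OF x] null by simp
  show "((\<lambda>n. cinner H (x n) (y n)) \<longlongrightarrow> 0) G"
  proof (rule Lim_null_comparison)
    show "\<forall>\<^sub>F n in G. norm (cinner H (x n) (y n)) \<le> hnorm H (x n) * b"
    proof (intro always_eventually allI)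
      fix n
      note c = seq_carrier[OF x, of n] seq_carrier[OF y, of n]
      show "norm (cinner H (x n) (y n)) \<le> hnorm H (x n) * b"
        using Cauchy_Schwarz[OF c] mult_left_mono[OF b[of n] hnorm_nonneg[OF c(1)]] by linarith
    qed
    show "((\<lambda>n. hnorm H (x n) * b) \<longlongrightarrow> 0) G" using tendsto_mult_left_zero[OF lim] .
  qed
qed

lemma w_null_seq:
  assumes "y \<in> null_seqs"
  obtains r where "w r 0 = y"
  using w_surj[of "\<lambda>k. y"] seq_carrier[OF assms] by metis

lemma coords_eq_iff: "coords x = coords x' \<longleftrightarrow> (\<forall>y\<in>null_seqs. lim_inner x y = lim_inner x' y)"
proof
  assume e: "coords x = coords x'"
  show "\<forall>y\<in>null_seqs. lim_inner x y = lim_inner x' y"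
  proof
    fix y assume y: "y \<in> null_seqs"
    then obtain r where "w r 0 = y" by (rule w_null_seq)
    then show "lim_inner x y = lim_inner x' y" using fun_cong[OF e, of r] y unfolding coords_def by simp
  qed
qed (auto simp: coords_def)

lemma lim_inner_cong:
  assumes "x \<in> null_seqs" "x' \<in> null_seqs" "y \<in> null_seqs" "y' \<in> null_seqs"
    and "coords x = coords x'" "coords y = coords y'"
  shows "lim_inner x y = lim_inner x' y'"
proof -
  have "lim_inner x y = lim_inner x' y" using assms coords_eq_iff by blast
  also have "\<dots> = cnj (lim_inner y x')" using assms by (intro lim_inner_commute)
  also have "lim_inner y x' = lim_inner y' x'" using assms coords_eq_iff by blast
  also have "cnj (lim_inner y' x') = lim_inner x' y'" using assms by (intro lim_inner_commute[symmetric])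
  finally show ?thesis .
qed

lemma lift: "u \<in> carrier limit_space \<Longrightarrow> lift u \<in> null_seqs"
  "u \<in> carrier limit_space \<Longrightarrow> coords (lift u) = u"
  unfolding lift_def limit_space_def by (simp_all add: inv_into_into f_inv_into_f)

lemma coords_carrier [simp]: "x \<in> null_seqs \<Longrightarrow> coords x \<in> carrier limit_space"
  unfolding limit_space_def by simp

lemma limit_space_cinner:
  assumes "x \<in> null_seqs" "y \<in> null_seqs"
  shows "cinner limit_space (coords x) (coords y) = lim_inner x y"
proof -
  have "cinner limit_space (coords x) (coords y) = lim_inner (lift (coords x)) (lift (coords y))"
    unfolding limit_space_def by simp
  also have "\<dots> = lim_inner x y" using assms lift by (intro lim_inner_cong) auto
  finally show ?thesis .
qed

lemma coords_add:
  assumes "x \<in> null_seqs" "y \<in> null_seqs"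
  shows "coords x \<oplus>\<^bsub>limit_space\<^esub> coords y = coords (\<lambda>n. x n \<oplus> y n)"
  unfolding limit_space_def coords_def using assms by (auto simp: lim_inner_add_left)

lemma coords_smult:
  assumes "x \<in> null_seqs"
  shows "c \<odot>\<^bsub>limit_space\<^esub> coords x = coords (\<lambda>n. c \<odot> x n)"
  unfolding limit_space_def coords_def using assms by (auto simp: lim_inner_smult_left)

lemma coords_zero: "\<zero>\<^bsub>limit_space\<^esub> = coords (\<lambda>n. \<zero>)"
proof -
  have "lim_inner (\<lambda>n. \<zero>) y = 0" if "y \<in> null_seqs" for y
    using seq_carrier[OF that] by (intro lim_inner_eqI) simp
  then show ?thesis unfolding limit_space_def coords_def by auto
qed

lemma limit_space_inner_space: "complex_inner_space limit_space"
proof -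
  have ex: "\<exists>x\<in>null_seqs. u = coords x" if "u \<in> carrier limit_space" for u
    using that unfolding limit_space_def by auto
  have add: "u \<oplus>\<^bsub>limit_space\<^esub> v \<in> carrier limit_space"
    if "u \<in> carrier limit_space" "v \<in> carrier limit_space" for u v
    using ex[OF that(1)] ex[OF that(2)] by (auto simp: coords_add null_seqs_add)
  have smult: "c \<odot>\<^bsub>limit_space\<^esub> u \<in> carrier limit_space" if "u \<in> carrier limit_space" for c u
    using ex[OF that] by (auto simp: coords_smult null_seqs_smult)
  have ops: "add limit_space = (\<lambda>u v r. u r + v r)" "smult limit_space = (\<lambda>c u r. c * u r)"
    "zero limit_space = (\<lambda>r. 0)"
    unfolding limit_space_def by simp_all
  have zero: "\<zero>\<^bsub>limit_space\<^esub> \<in> carrier limit_space"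
    unfolding coords_zero using null_seqs_zero by simp
  have "abelian_group limit_space"
  proof (rule abelian_groupI)
    fix u assume u: "u \<in> carrier limit_space"
    have "(- 1) \<odot>\<^bsub>limit_space\<^esub> u \<oplus>\<^bsub>limit_space\<^esub> u = \<zero>\<^bsub>limit_space\<^esub>" by (simp add: ops)
    then show "\<exists>v\<in>carrier limit_space. v \<oplus>\<^bsub>limit_space\<^esub> u = \<zero>\<^bsub>limit_space\<^esub>"
      using smult[OF u] by blast
  qed (rule add zero | simp add: ops add_ac)+
  with cring_from_type_algebra have "module complex_field limit_space"
    by (rule moduleI) (simp_all add: smult, simp_all add: ops algebra_simps)
  then show ?thesis
  proof (intro complex_inner_space.intro complex_inner_space_axioms.intro)
    fix u v z c
    assume u: "u \<in> carrier limit_space"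
    from ex[OF u] obtain x where x: "x \<in> null_seqs" "u = coords x" by blast
    show "0 \<le> Re (cinner limit_space u u)"
      using x by (simp add: limit_space_cinner lim_inner_self_nonneg)
    show "u = \<zero>\<^bsub>limit_space\<^esub>" if "cinner limit_space u u = 0"
    proof -
      have "lim_inner x x = 0" using that x by (simp add: limit_space_cinner)
      then have "lim_inner x y = 0" if "y \<in> null_seqs" for y
        using x that by (intro lim_inner_null) auto
      then have "coords x = (\<lambda>r. 0)" unfolding coords_def by auto
      then show ?thesis using x ops(3) by simp
    qed
    assume v: "v \<in> carrier limit_space"
    from ex[OF v] obtain y where y: "y \<in> null_seqs" "v = coords y" by blast
    show "cinner limit_space (c \<odot>\<^bsub>limit_space\<^esub> u) v = c * cinner limit_space u v"
      using x y by (simp add: coords_smult limit_space_cinner null_seqs_smult lim_inner_smult_left)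
    show "cinner limit_space v u = cnj (cinner limit_space u v)"
      using x y lim_inner_commute[OF x(1) y(1)] by (simp add: limit_space_cinner)
    assume z: "z \<in> carrier limit_space"
    from ex[OF z] obtain t where t: "t \<in> null_seqs" "z = coords t" by blast
    show "cinner limit_space (u \<oplus>\<^bsub>limit_space\<^esub> v) z = cinner limit_space u z + cinner limit_space v z"
      using x y t by (simp add: coords_add limit_space_cinner null_seqs_add lim_inner_add_left)
  qed
qed

sublocale L: complex_inner_space limit_space
  by (rule limit_space_inner_space)

lemma hnorm_coords: "x \<in> null_seqs \<Longrightarrow> hnorm limit_space (coords x) = sqrt (Re (lim_inner x x))"
  unfolding hnorm_def by (simp add: limit_space_cinner)

lemma coords_diff:
  assumes x: "x \<in> null_seqs" and y: "y \<in> null_seqs"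
  shows "coords x \<ominus>\<^bsub>limit_space\<^esub> coords y = coords (\<lambda>n. x n \<ominus> y n)"
proof (rule L.cinner_eqI)
  fix z assume "z \<in> carrier limit_space"
  then obtain t where z: "t \<in> null_seqs" "z = coords t" using lift by metis
  show "cinner limit_space (coords x \<ominus>\<^bsub>limit_space\<^esub> coords y) z =
      cinner limit_space (coords (\<lambda>n. x n \<ominus> y n)) z"
    unfolding z(2) using x y z(1) null_seqs_diff[OF x y]
    by (simp add: L.cinner_diff_left limit_space_cinner lim_inner_diff_left)
qed (use x y null_seqs_diff[OF x y] in auto)

lemma hnorm_coords_diff_le:
  assumes x: "x \<in> null_seqs" and y: "y \<in> null_seqs"
    and le: "\<forall>\<^sub>F n in G. hnorm H (x n \<ominus> y n) \<le> b"
  shows "hnorm limit_space (coords x \<ominus>\<^bsub>limit_space\<^esub> coords y) \<le> b"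
  unfolding coords_diff[OF x y] hnorm_coords[OF null_seqs_diff[OF x y]]
  using lim_hnorm[OF null_seqs_diff[OF x y]] le by (rule tendsto_upperbound[OF _ _ G_nontrivial])

text \<open>
  A limit of a rapidly converging sequence of classes is obtained on representatives: \<open>y n\<close> is \<open>x k n\<close> for
  an index \<open>k = \<kappa> n\<close> such that the steps before \<open>k\<close> are as small at \<open>n\<close> as they are in the limit. The index
  \<open>\<kappa> n\<close> tends to infinity along \<open>G\<close>.
\<close>

lemma diagonal_limit:
  fixes x :: "nat \<Rightarrow> nat \<Rightarrow> 'a"
  assumes x: "\<And>k. x k \<in> null_seqs"
    and step: "\<And>k. \<forall>\<^sub>F n in G. hnorm H (x k n \<ominus> x (Suc k) n) < (1/2) ^ k"
  shows "\<exists>y\<in>null_seqs. \<forall>k. \<forall>\<^sub>F n in G. hnorm H (x k n \<ominus> y n) \<le> 2 * (1/2) ^ k"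
proof -
  define D where "D k n = hnorm H (x k n \<ominus> x (Suc k) n)" for k n
  (* The bound k = n makes the index finite; it is harmless because G contains all cofinite sets. *)
  define \<kappa> where "\<kappa> n = (LEAST k. k = n \<or> \<not> D k n < (1/2) ^ k)" for n
  define y where "y n = x (\<kappa> n) n" for n
  note c = seq_carrier[OF x]
  have \<kappa>: "\<kappa> n = n \<or> \<not> D (\<kappa> n) n < (1/2) ^ \<kappa> n" for n
    unfolding \<kappa>_def by (rule LeastI[of _ n]) simp
  have small: "D k n < (1/2) ^ k" if "k < \<kappa> n" for k n
    using not_less_Least[OF that[unfolded \<kappa>_def]] by simp
  have tele: "hnorm H (x k n \<ominus> x (k + j) n) \<le> 2 * (1/2) ^ k - 2 * (1/2) ^ (k + j)"
    if "k + j \<le> \<kappa> n" for k j n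
    using that
  proof (induction j)
    case 0
    have "x k n \<ominus> x k n = \<zero>" using minus_eq_zero_iff c by blast
    then show ?case by simp
  next
    case (Suc j)
    have "hnorm H (x k n \<ominus> x (k + Suc j) n) \<le>
        hnorm H (x k n \<ominus> x (k + j) n) + hnorm H (x (k + j) n \<ominus> x (k + Suc j) n)"
      using hnorm_triangle_minus c by blast
    also have "hnorm H (x (k + j) n \<ominus> x (k + Suc j) n) \<le> (1/2) ^ (k + j)"
      using small[of "k + j" n] Suc.prems unfolding D_def by simp
    finally show ?case using Suc by simp
  qed
  have close: "hnorm H (x k n \<ominus> y n) \<le> 2 * (1/2) ^ k" if "k \<le> \<kappa> n" for k n
  proof -
    have "hnorm H (x k n \<ominus> y n) \<le> 2 * (1/2) ^ k - 2 * (1/2) ^ \<kappa> n"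
      using tele[of k "\<kappa> n - k" n] that unfolding y_def by simp
    moreover have "0 \<le> (1/2 :: real) ^ \<kappa> n" by simp
    ultimately show ?thesis by linarith
  qed
  have late: "\<forall>\<^sub>F n in G. k \<le> \<kappa> n" for k
  proof -
    have "\<forall>\<^sub>F n in G. \<forall>j\<in>{..<k}. D j n < (1/2) ^ j"
      using step unfolding D_def by (intro eventually_ball_finite) auto
    moreover have "\<forall>\<^sub>F n in G. k \<le> n"
      using filter_leD[OF G_free eventually_ge_at_top] .
    ultimately show ?thesis
    proof eventually_elim
      case (elim n)
      show ?case
      proof (rule ccontr)
        assume "\<not> k \<le> \<kappa> n"
        with elim(1) have "D (\<kappa> n) n < (1/2) ^ \<kappa> n" by simp
        then show False using \<kappa>[of n] elim(2) \<open>\<not> k \<le> \<kappa> n\<close> by simp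
      qed
    qed
  qed
  have y: "y \<in> null_seqs"
  proof -
    obtain b where b: "\<And>n. hnorm H (x 0 n) \<le> b" using seq_bound x by metis
    have yc: "y n \<in> carrier H" for n unfolding y_def using c by blast
    show ?thesis
    proof (rule null_seqsI[OF yc])
      fix n
      have "y n = x 0 n \<ominus> (x 0 n \<ominus> y n)"
        using c yc by (intro cinner_eqI) (auto simp: cinner_simps)
      then have "hnorm H (y n) \<le> hnorm H (x 0 n) + hnorm H (x 0 n \<ominus> y n)"
        using hnorm_triangle[of "x 0 n" "\<ominus> (x 0 n \<ominus> y n)"] hnorm_uminus[of "x 0 n \<ominus> y n"] c[of 0 n] yc[of n]
        by (simp add: a_minus_def[of _ _ "x 0 n \<ominus> y n"])
      then show "hnorm H (y n) \<le> b + 2" using b[of n] close[of 0 n] by simp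
    next
      fix h assume h: "h \<in> carrier H"
      show "((\<lambda>n. cinner H (y n) h) \<longlongrightarrow> 0) G"
      proof (rule tendstoI)
        fix e :: real assume e: "e > 0"
        (* The summand 1 avoids a division by zero if h vanishes. *)
        define \<delta> where "\<delta> = e / (4 * (hnorm H h + 1))"
        have hn: "hnorm H h \<ge> 0" using hnorm_nonneg[OF h] .
        then have "\<delta> > 0" unfolding \<delta>_def using e by simp
        then obtain k where k: "(1/2) ^ k < \<delta>" using real_arch_pow_inv[of \<delta> "1/2"] by auto
        have "\<forall>\<^sub>F n in G. dist (cinner H (x k n) h) 0 < e / 2"
          using tendstoD[OF seq_weak_null[OF x h], of "e / 2"] e by simp
        with late[of k] show "\<forall>\<^sub>F n in G. dist (cinner H (y n) h) 0 < e"
        proof eventually_elim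
          case (elim n)
          have "cmod (cinner H (x k n \<ominus> y n) h) \<le> hnorm H (x k n \<ominus> y n) * hnorm H h"
            using Cauchy_Schwarz[of "x k n \<ominus> y n" h] c yc h by simp
          also have "\<dots> \<le> (2 * \<delta>) * hnorm H h"
            using close[OF elim(1)] k hn by (intro mult_right_mono) auto
          also have "\<dots> \<le> (2 * \<delta>) * (hnorm H h + 1)"
            using \<open>\<delta> > 0\<close> by (intro mult_left_mono) auto
          also have "\<dots> = e / 2" unfolding \<delta>_def using hn by (simp add: field_simps)
          finally have "cmod (cinner H (x k n) h - cinner H (y n) h) \<le> e / 2"
            using c yc h by (simp add: cinner_diff_left)
          moreover have "cmod (cinner H (x k n) h) < e / 2" using elim(2) by simp
          ultimately have "cmod (cinner H (y n) h) < e"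
            using norm_triangle_ineq4[of "cinner H (x k n) h" "cinner H (x k n) h - cinner H (y n) h"] by simp
          then show ?case by simp
        qed
      qed
    qed
  qed
  have "\<forall>\<^sub>F n in G. hnorm H (x k n \<ominus> y n) \<le> 2 * (1/2) ^ k" for k
    using late[of k] by eventually_elim (rule close)
  then show ?thesis using y by blast
qed

lemma limit_space_hilbert_space: "hilbert_space limit_space"
proof -
  have "L.metric.mcomplete"
    unfolding L.metric.mcomplete_def
  proof (intro allI impI)
    fix s assume s: "L.metric.MCauchy s"
    then have sL: "s n \<in> carrier limit_space" for n
      unfolding L.metric.MCauchy_def by blast
    have "\<exists>N. \<forall>n n'. N \<le> n \<longrightarrow> N \<le> n' \<longrightarrow> hdist limit_space (s n) (s n') < (1/2) ^ k" for k :: nat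
      using s unfolding L.metric.MCauchy_def by simp
    then obtain N where N: "\<And>k n n'. N k \<le> n \<Longrightarrow> N k \<le> n' \<Longrightarrow>
        hdist limit_space (s n) (s n') < (1/2) ^ k"
      by metis
    define r where "r k = (\<Sum>j\<le>k. N j + 1)" for k
    have r: "strict_mono r" unfolding r_def by (simp add: strict_mono_Suc_iff)
    have rN: "N k \<le> r k" for k
      unfolding r_def using member_le_sum[of k "{..k}" "\<lambda>j. N j + 1"] by simp
    define x where "x k = lift (s (r k))" for k
    have x: "x k \<in> null_seqs" "coords (x k) = s (r k)" for k
      unfolding x_def using lift[OF sL] by auto
    have step: "\<forall>\<^sub>F n in G. hnorm H (x k n \<ominus> x (Suc k) n) < (1/2) ^ k" for k
    proof -
      have "r k \<le> r (Suc k)" using strict_mono_leD[OF r] by simp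
      then have "hdist limit_space (s (r k)) (s (r (Suc k))) < (1/2) ^ k"
        using rN[of k] by (intro N) auto
      then have "sqrt (Re (lim_inner (\<lambda>n. x k n \<ominus> x (Suc k) n) (\<lambda>n. x k n \<ominus> x (Suc k) n))) < (1/2) ^ k"
        unfolding x(2)[symmetric] hdist_def
        by (simp add: x(1) coords_diff hnorm_coords null_seqs_diff)
      then show ?thesis
        using order_tendstoD(2)[OF lim_hnorm[OF null_seqs_diff[OF x(1)[of k] x(1)[of "Suc k"]]]] by blast
    qed
    obtain y where y: "y \<in> null_seqs" "\<And>k. \<forall>\<^sub>F n in G. hnorm H (x k n \<ominus> y n) \<le> 2 * (1/2) ^ k"
      using diagonal_limit[OF x(1) step] by blast
    have bound: "hdist limit_space ((s \<circ> r) k) (coords y) \<le> 2 * (1/2) ^ k" for k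
      using hnorm_coords_diff_le[OF x(1) y(1) y(2)] x y(1) sL by (simp add: hdist_def)
    have lim: "(\<lambda>k. 2 * (1/2) ^ k :: real) \<longlonglongrightarrow> 0"
      using tendsto_mult_right_zero[OF LIMSEQ_power_zero[of "1/2 :: real"], of 2] by simp
    have "limitin L.metric.mtopology (s \<circ> r) (coords y) sequentially"
      unfolding L.metric.limitin_metric
    proof (intro conjI allI impI)
      fix e :: real assume "e > 0"
      from order_tendstoD(2)[OF lim this]
      show "\<forall>\<^sub>F k in sequentially. (s \<circ> r) k \<in> carrier limit_space \<and>
          hdist limit_space ((s \<circ> r) k) (coords y) < e"
        by eventually_elim (use bound sL in \<open>auto intro: le_less_trans\<close>)
    qed (use y in simp)
    then show "\<exists>l. limitin L.metric.mtopology s l sequentially"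
      using L.metric.MCauchy_convergent_subsequence[OF s r] by blast
  qed
  then show ?thesis by unfold_locales
qed

sublocale L: hilbert_space limit_space
  by (rule limit_space_hilbert_space)

end

section \<open>The action of the Calkin algebra\<close>

context complex_inner_space
begin

lemma bounded_ops_add:
  assumes S: "S \<in> bounded_ops H" and T: "T \<in> bounded_ops H"
  shows "S \<oplus>\<^bsub>op_algebra H\<^esub> T \<in> bounded_ops H"
proof -
  note Sc = bounded_opsD[OF S] and Tc = bounded_opsD[OF T]
  obtain a where a: "\<And>x. x \<in> carrier H \<Longrightarrow> hnorm H (S x) \<le> a * hnorm H x"
    using bounded_ops_bound[OF S] by blast
  obtain b where b: "\<And>x. x \<in> carrier H \<Longrightarrow> hnorm H (T x) \<le> b * hnorm H x"
    using bounded_ops_bound[OF T] by blast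
  have eq: "S \<oplus>\<^bsub>op_algebra H\<^esub> T = (\<lambda>x\<in>carrier H. S x \<oplus> T x)" by (simp add: op_algebra_def)
  show ?thesis unfolding eq
  proof (rule bounded_opsI)
    fix x assume x: "x \<in> carrier H"
    show "hnorm H ((\<lambda>x\<in>carrier H. S x \<oplus> T x) x) \<le> (a + b) * hnorm H x"
      using hnorm_triangle[OF Sc(1)[OF x] Tc(1)[OF x]] a[OF x] b[OF x] x by (simp add: distrib_right)
  qed (use Sc Tc in \<open>auto simp: M.add.m_ac smult_r_distr\<close>)
qed

lemma bounded_ops_smult:
  assumes S: "S \<in> bounded_ops H"
  shows "c \<odot>\<^bsub>op_algebra H\<^esub> S \<in> bounded_ops H"
proof -
  note Sc = bounded_opsD[OF S]
  obtain a where a: "\<And>x. x \<in> carrier H \<Longrightarrow> hnorm H (S x) \<le> a * hnorm H x"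
    using bounded_ops_bound[OF S] by blast
  have eq: "c \<odot>\<^bsub>op_algebra H\<^esub> S = (\<lambda>x\<in>carrier H. c \<odot> S x)" by (simp add: op_algebra_def)
  have "c \<odot> (d \<odot> S x) = d \<odot> (c \<odot> S x)" if "x \<in> carrier H" for d x
    using Sc(1)[OF that] by (intro cinner_eqI) (auto simp: cinner_simps)
  then show ?thesis unfolding eq
  proof (intro bounded_opsI)
    fix x assume x: "x \<in> carrier H"
    show "hnorm H ((\<lambda>x\<in>carrier H. c \<odot> S x) x) \<le> (cmod c * a) * hnorm H x"
      using mult_left_mono[OF a[OF x], of "cmod c"] Sc(1)[OF x] x by (simp add: hnorm_smult mult.assoc)
  qed (use Sc in \<open>auto simp: smult_r_distr\<close>)
qed

lemma bounded_ops_compose: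
  assumes S: "S \<in> bounded_ops H" and T: "T \<in> bounded_ops H"
  shows "S \<otimes>\<^bsub>op_algebra H\<^esub> T \<in> bounded_ops H"
proof -
  note Sc = bounded_opsD[OF S] and Tc = bounded_opsD[OF T]
  obtain a where a: "a > 0" "\<And>x. x \<in> carrier H \<Longrightarrow> hnorm H (S x) \<le> a * hnorm H x"
    using bounded_ops_bound[OF S] by blast
  obtain b where b: "\<And>x. x \<in> carrier H \<Longrightarrow> hnorm H (T x) \<le> b * hnorm H x"
    using bounded_ops_bound[OF T] by blast
  have eq: "S \<otimes>\<^bsub>op_algebra H\<^esub> T = compose (carrier H) S T" by (simp add: op_algebra_def)
  show ?thesis unfolding eq
  proof (rule bounded_opsI)
    fix x assume x: "x \<in> carrier H"
    have "hnorm H (S (T x)) \<le> a * hnorm H (T x)" using a(2) Tc(1) x by blast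
    also have "\<dots> \<le> a * (b * hnorm H x)" using b[OF x] a(1) by (intro mult_left_mono) auto
    finally show "hnorm H (compose (carrier H) S T x) \<le> (a * b) * hnorm H x"
      using x by (simp add: compose_def mult.assoc)
  qed (use Sc Tc in \<open>auto simp: compose_def\<close>)
qed

lemma bounded_ops_id: "(\<lambda>x\<in>carrier H. x) \<in> bounded_ops H"
  by (rule bounded_opsI[where b = 1]) auto

lemma zero_compact: "(\<lambda>x\<in>carrier H. \<zero>) \<in> compact_ops H"
proof -
  have "(\<lambda>x\<in>carrier H. \<zero>) ` {x \<in> carrier H. hnorm H x \<le> 1} = {\<zero>}"
    using hnorm_zero M.zero_closed by (force simp del: hnorm_zero)
  moreover have "(\<lambda>x\<in>carrier H. \<zero>) \<in> bounded_ops H"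
    by (rule bounded_opsI[where b = 0]) auto
  moreover have "htopology H closure_of {\<zero>} = {\<zero>}"
    using metric.Hausdorff_space_mtopology closedin_Hausdorff_singleton[of "htopology H" "\<zero>"]
    by (simp add: closure_of_closedin)
  ultimately show ?thesis unfolding compact_ops_def by simp
qed

end

context generic_sequences
begin

definition limit_op :: "('a \<Rightarrow> 'a) \<Rightarrow> (real \<Rightarrow> complex) \<Rightarrow> real \<Rightarrow> complex" where
  "limit_op T = (\<lambda>u\<in>carrier limit_space. coords (\<lambda>n. T (lift u n)))"

lemma lim_inner_adjoint:
  assumes T: "T \<in> bounded_ops H" and x: "x \<in> null_seqs" and y: "y \<in> null_seqs"
  shows "lim_inner (\<lambda>n. T (x n)) y = lim_inner x (\<lambda>n. adjoint_op H T (y n))"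
  unfolding lim_inner_def using adjoint_op(2)[OF T seq_carrier[OF x] seq_carrier[OF y]] by simp

text \<open>
  The operator acts on representatives. This is well defined as the adjoint moves it to the other side
  of the inner product, where only the class of the sequence matters.
\<close>

lemma limit_op_coords:
  assumes T: "T \<in> bounded_ops H" and x: "x \<in> null_seqs"
  shows "limit_op T (coords x) = coords (\<lambda>n. T (x n))"
proof -
  have l: "lift (coords x) \<in> null_seqs" "coords (lift (coords x)) = coords x"
    using lift[of "coords x"] x by auto
  have "coords (\<lambda>n. T (lift (coords x) n)) = coords (\<lambda>n. T (x n))"
    unfolding coords_eq_iff
  proof
    fix y assume y: "y \<in> null_seqs"
    have "(\<lambda>n. adjoint_op H T (y n)) \<in> null_seqs" using null_seqs_op[OF y adjoint_op(1)[OF T]] .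
    then show "lim_inner (\<lambda>n. T (lift (coords x) n)) y = lim_inner (\<lambda>n. T (x n)) y"
      unfolding lim_inner_adjoint[OF T l(1) y] lim_inner_adjoint[OF T x y]
      using l(2) unfolding coords_eq_iff by blast
  qed
  then show ?thesis unfolding limit_op_def using x by simp
qed

lemma limit_space_cases:
  assumes "u \<in> carrier limit_space"
  obtains x where "x \<in> null_seqs" "u = coords x"
  using lift[OF assms] by metis

lemma limit_op_bounded:
  assumes T: "T \<in> bounded_ops H"
  shows "limit_op T \<in> bounded_ops limit_space"
proof -
  note Tc = bounded_opsD[OF T]
  obtain b where b: "b > 0" "\<And>x. x \<in> carrier H \<Longrightarrow> hnorm H (T x) \<le> b * hnorm H x"
    using bounded_ops_bound[OF T] by blast
  show ?thesis
  proof (rule L.bounded_opsI)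
    fix u v c
    show "limit_op T u = undefined" if "u \<notin> carrier limit_space"
      using that unfolding limit_op_def by simp
    assume "u \<in> carrier limit_space"
    then obtain x where x: "x \<in> null_seqs" "u = coords x" by (rule limit_space_cases)
    note Tx = null_seqs_op[OF x(1) T]
    show "limit_op T u \<in> carrier limit_space"
      unfolding x(2) limit_op_coords[OF T x(1)] using Tx by simp
    show "limit_op T (c \<odot>\<^bsub>limit_space\<^esub> u) = c \<odot>\<^bsub>limit_space\<^esub> limit_op T u"
      using x Tx null_seqs_smult[OF x(1), of c] Tc(4)[OF seq_carrier[OF x(1)], of c]
      by (simp add: coords_smult limit_op_coords T)
    have "sqrt (Re (lim_inner (\<lambda>n. T (x n)) (\<lambda>n. T (x n)))) \<le> b * sqrt (Re (lim_inner x x))"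
      by (rule tendsto_le[OF G_nontrivial tendsto_mult_left[OF lim_hnorm[OF x(1)]] lim_hnorm[OF Tx]])
        (simp add: b seq_carrier[OF x(1)])
    then show "hnorm limit_space (limit_op T u) \<le> b * hnorm limit_space u"
      unfolding x(2) limit_op_coords[OF T x(1)] hnorm_coords[OF x(1)] hnorm_coords[OF Tx] .
    assume "v \<in> carrier limit_space"
    then obtain y where y: "y \<in> null_seqs" "v = coords y" by (rule limit_space_cases)
    show "limit_op T (u \<oplus>\<^bsub>limit_space\<^esub> v) = limit_op T u \<oplus>\<^bsub>limit_space\<^esub> limit_op T v"
      using x y Tx null_seqs_op[OF y(1) T] null_seqs_add[OF x(1) y(1)]
        Tc(3)[OF seq_carrier[OF x(1)] seq_carrier[OF y(1)]]
      by (simp add: coords_add limit_op_coords T)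
  qed
qed

text \<open>
  Operators of the limit space are compared on representing sequences, where all operations are
  computed entrywise in \<open>H\<close>.
\<close>

lemma limit_fun_eqI:
  assumes "S \<in> extensional (carrier limit_space)" "T \<in> extensional (carrier limit_space)"
    and "\<And>x. x \<in> null_seqs \<Longrightarrow> S (coords x) = T (coords x)"
  shows "S = T"
  using assms by (intro extensionalityI[of S "carrier limit_space"]) (auto elim: limit_space_cases)

lemma limit_op_extensional: "limit_op T \<in> extensional (carrier limit_space)"
  unfolding limit_op_def by simp

lemma limit_op_add:
  assumes S: "S \<in> bounded_ops H" and T: "T \<in> bounded_ops H"
  shows "limit_op (S \<oplus>\<^bsub>op_algebra H\<^esub> T) = limit_op S \<oplus>\<^bsub>op_algebra limit_space\<^esub> limit_op T"
proof (rule limit_fun_eqI[OF limit_op_extensional])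
  fix x assume x: "x \<in> null_seqs"
  then show "limit_op (S \<oplus>\<^bsub>op_algebra H\<^esub> T) (coords x) =
    (limit_op S \<oplus>\<^bsub>op_algebra limit_space\<^esub> limit_op T) (coords x)"
    using limit_op_coords[OF bounded_ops_add[OF S T] x] seq_carrier[OF x]
      null_seqs_op[OF x S] null_seqs_op[OF x T]
    by (simp add: op_algebra_def limit_op_coords S T coords_add)
qed (simp add: op_algebra_def)

lemma limit_op_smult:
  assumes S: "S \<in> bounded_ops H"
  shows "limit_op (c \<odot>\<^bsub>op_algebra H\<^esub> S) = c \<odot>\<^bsub>op_algebra limit_space\<^esub> limit_op S"
proof (rule limit_fun_eqI[OF limit_op_extensional])
  fix x assume x: "x \<in> null_seqs"
  then show "limit_op (c \<odot>\<^bsub>op_algebra H\<^esub> S) (coords x) =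
    (c \<odot>\<^bsub>op_algebra limit_space\<^esub> limit_op S) (coords x)"
    using limit_op_coords[OF bounded_ops_smult[OF S] x, of c] seq_carrier[OF x] null_seqs_op[OF x S]
    by (simp add: op_algebra_def limit_op_coords S coords_smult)
qed (simp add: op_algebra_def)

lemma limit_op_compose:
  assumes S: "S \<in> bounded_ops H" and T: "T \<in> bounded_ops H"
  shows "limit_op (S \<otimes>\<^bsub>op_algebra H\<^esub> T) = limit_op S \<otimes>\<^bsub>op_algebra limit_space\<^esub> limit_op T"
proof (rule limit_fun_eqI[OF limit_op_extensional])
  fix x assume x: "x \<in> null_seqs"
  then show "limit_op (S \<otimes>\<^bsub>op_algebra H\<^esub> T) (coords x) =
    (limit_op S \<otimes>\<^bsub>op_algebra limit_space\<^esub> limit_op T) (coords x)"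
    using limit_op_coords[OF bounded_ops_compose[OF S T] x] seq_carrier[OF x] null_seqs_op[OF x T]
    by (simp add: op_algebra_def limit_op_coords S T compose_def)
qed (simp add: op_algebra_def)

lemma limit_op_adjoint:
  assumes T: "T \<in> bounded_ops H"
  shows "limit_op (adjoint_op H T) = adjoint_op limit_space (limit_op T)"
proof (rule L.adjoint_op_eqI[symmetric])
  note T' = adjoint_op(1)[OF T]
  show "limit_op (adjoint_op H T) \<in> bounded_ops limit_space" "limit_op T \<in> bounded_ops limit_space"
    using T T' by (simp_all add: limit_op_bounded)
  fix u v assume "u \<in> carrier limit_space" "v \<in> carrier limit_space"
  then obtain x y where x: "x \<in> null_seqs" "u = coords x" and y: "y \<in> null_seqs" "v = coords y"
    by (metis limit_space_cases)
  show "cinner limit_space (limit_op T u) v = cinner limit_space u (limit_op (adjoint_op H T) v)"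
    unfolding x(2) y(2) limit_op_coords[OF T x(1)] limit_op_coords[OF T' y(1)]
    using x(1) y(1) null_seqs_op[OF x(1) T] null_seqs_op[OF y(1) T'] lim_inner_adjoint[OF T x(1) y(1)]
    by (simp add: limit_space_cinner)
qed

text \<open>
  A compact operator takes weakly null sequences to norm null sequences. Put \<open>y n = T (x n)\<close>. Up to a
  scalar, \<open>y n\<close> is \<open>\<delta>\<close>-close to one of finitely many vectors \<open>h\<close>, and \<open>\<langle>y n, h\<rangle>\<close> is eventually small for all
  of them at once, so that \<open>\<langle>y n, y n\<rangle>\<close> is small.
\<close>

lemma compact_op_null:
  assumes T: "T \<in> compact_ops H" and x: "x \<in> null_seqs"
  shows "coords (\<lambda>n. T (x n)) = \<zero>\<^bsub>limit_space\<^esub>"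
proof -
  have Tb: "T \<in> bounded_ops H" using T unfolding compact_ops_def by blast
  note Tc = bounded_opsD[OF Tb]
  note xc = seq_carrier[OF x]
  define y where "y n = T (x n)" for n
  have y: "y \<in> null_seqs" unfolding y_def using null_seqs_op[OF x Tb] .
  note yc = seq_carrier[OF y]
  obtain b where b: "b > 0" "\<And>n. hnorm H (x n) \<le> b" using seq_bound x by metis
  define C where "C = htopology H closure_of (T ` {x \<in> carrier H. hnorm H x \<le> 1})"
  have tb: "metric.mtotally_bounded C"
    using T metric.compactin_imp_mtotally_bounded unfolding compact_ops_def C_def by blast
  have yC: "of_real (inverse b) \<odot> y n \<in> C" for n
  proof -
    have "inverse b * hnorm H (x n) \<le> inverse b * b" using b by (intro mult_left_mono) auto
    then have "of_real (inverse b) \<odot> x n \<in> {x \<in> carrier H. hnorm H x \<le> 1}"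
      using b xc[of n] by (simp add: hnorm_smult norm_inverse del: of_real_inverse)
    then have "T (of_real (inverse b) \<odot> x n) \<in> T ` {x \<in> carrier H. hnorm H x \<le> 1}" by blast
    moreover have "T ` {x \<in> carrier H. hnorm H x \<le> 1} \<subseteq> topspace (htopology H)"
      using Tc(1) by auto
    ultimately have "T (of_real (inverse b) \<odot> x n) \<in> C"
      unfolding C_def using closure_of_subset by blast
    then show ?thesis unfolding y_def using Tc(4)[OF xc] by simp
  qed
  obtain a where a: "a > 0" "\<And>n. hnorm H (y n) \<le> a" using seq_bound y by metis
  have "lim_inner y y = 0"
  proof (rule lim_inner_eqI, rule tendstoI)
    fix e :: real assume e: "e > 0"
    define \<delta> where "\<delta> = e / (2 * a * b)"
    have \<delta>: "\<delta> > 0" unfolding \<delta>_def using e a b by simp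
    obtain K where K: "finite K" "K \<subseteq> C" "C \<subseteq> (\<Union>h\<in>K. metric.mball h \<delta>)"
      using tb[unfolded metric.mtotally_bounded_def, rule_format, OF \<delta>] by blast
    have KH: "h \<in> carrier H" if "h \<in> K" for h
      using metric.mtotally_bounded_imp_subset[OF tb] K(2) that by blast
    have "\<forall>\<^sub>F n in G. \<forall>h\<in>K. cmod (cinner H (y n) h) < e / (2 * b)"
      using K(1)
    proof (rule eventually_ball_finite, intro ballI)
      fix h assume "h \<in> K"
      show "\<forall>\<^sub>F n in G. cmod (cinner H (y n) h) < e / (2 * b)"
        using tendstoD[OF seq_weak_null[OF y KH[OF \<open>h \<in> K\<close>]], of "e / (2 * b)"] e b by simp
    qed
    then show "\<forall>\<^sub>F n in G. dist (cinner H (y n) (y n)) 0 < e"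
    proof eventually_elim
      case (elim n)
      define z where "z = of_real (inverse b) \<odot> y n"
      have z: "z \<in> carrier H" unfolding z_def using yc by simp
      obtain h where h: "h \<in> K" "hdist H h z < \<delta>"
        using yC[of n] K(3) unfolding z_def[symmetric] by (auto simp: metric.in_mball)
      have hz: "hnorm H (z \<ominus> h) < \<delta>"
        using h z KH[OF h(1)] hnorm_minus_commute[of z h] by (simp add: hdist_def)
      have "y n = of_real b \<odot> z"
        unfolding z_def using b yc[of n] by (intro cinner_eqI) (auto simp: cinner_simps)
      then have "cinner H (y n) (y n) = cinner H (y n) (of_real b \<odot> z)"
        by (rule arg_cong)
      also have "\<dots> = of_real b * cinner H (y n) z"
        using yc[of n] z by (simp add: cinner_smult_right)
      also have "cinner H (y n) z = cinner H (y n) (z \<ominus> h) + cinner H (y n) h"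
        using yc[of n] z KH[OF h(1)] by (simp add: cinner_diff_right)
      finally have "cmod (cinner H (y n) (y n)) \<le> b * (cmod (cinner H (y n) (z \<ominus> h)) + cmod (cinner H (y n) h))"
        using b by (simp add: norm_mult norm_triangle_ineq)
      also have "cmod (cinner H (y n) (z \<ominus> h)) \<le> hnorm H (y n) * hnorm H (z \<ominus> h)"
        using Cauchy_Schwarz yc z KH[OF h(1)] by simp
      also have "\<dots> \<le> a * \<delta>"
        using a hz hnorm_nonneg[of "z \<ominus> h"] z KH[OF h(1)] by (intro mult_mono) auto
      also have "a * \<delta> + cmod (cinner H (y n) h) < a * \<delta> + e / (2 * b)"
        using elim h(1) by simp
      also have "b * (a * \<delta> + e / (2 * b)) = e"
        unfolding \<delta>_def using a b by (simp add: field_simps)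
      finally show ?case using b by simp
    qed
  qed
  then have "coords y = coords (\<lambda>n. \<zero>)"
    unfolding coords_eq_iff
  proof (intro ballI)
    fix t assume t: "t \<in> null_seqs"
    have "lim_inner (\<lambda>n. \<zero>) t = 0" using seq_carrier[OF t] by (intro lim_inner_eqI) simp
    then show "lim_inner y t = lim_inner (\<lambda>n. \<zero>) t"
      using lim_inner_null[OF y t] \<open>lim_inner y y = 0\<close> by simp
  qed
  then show ?thesis unfolding y_def coords_zero .
qed

lemma limit_op_compact:
  assumes T: "T \<in> compact_ops H"
  shows "limit_op T = \<zero>\<^bsub>op_algebra limit_space\<^esub>"
proof (rule limit_fun_eqI[OF limit_op_extensional])
  have "T \<in> bounded_ops H" using T unfolding compact_ops_def by blast
  then show "limit_op T (coords x) = \<zero>\<^bsub>op_algebra limit_space\<^esub> (coords x)" if "x \<in> null_seqs" for x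
    using compact_op_null[OF T that] that by (simp add: limit_op_coords op_algebra_def)
qed (simp add: op_algebra_def)

text \<open>
  The value does not depend on the chosen operator, since two operators in a coset differ by a compact
  operator, which acts as zero.
\<close>

definition calkin_rep :: "('a \<Rightarrow> 'a) set \<Rightarrow> (real \<Rightarrow> complex) \<Rightarrow> real \<Rightarrow> complex" where
  "calkin_rep S = limit_op (SOME T. T \<in> S)"

text \<open>
  The operations of the quotient are unions of cosets, so \<open>calkin_rep\<close> is evaluated on them by
  evaluating \<open>limit_op\<close> on each member of the union.
\<close>

lemma calkin_rep_eq:
  assumes "S \<noteq> {}" "\<And>T. T \<in> S \<Longrightarrow> limit_op T = R"
  shows "calkin_rep S = R"
  unfolding calkin_rep_def using assms some_in_eq by metis

lemma limit_op_coset: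
  assumes "T \<in> bounded_ops H" "S \<in> compact_ops H +>\<^bsub>op_algebra H\<^esub> T"
  shows "limit_op S = limit_op T" "S \<in> bounded_ops H"
proof -
  obtain C where C: "C \<in> compact_ops H" "S = C \<oplus>\<^bsub>op_algebra H\<^esub> T"
    using assms(2) unfolding a_r_coset_def' by blast
  then have Cb: "C \<in> bounded_ops H" unfolding compact_ops_def by blast
  show "S \<in> bounded_ops H" using C(2) bounded_ops_add[OF Cb assms(1)] by simp
  have "limit_op S = \<zero>\<^bsub>op_algebra limit_space\<^esub> \<oplus>\<^bsub>op_algebra limit_space\<^esub> limit_op T"
    using C limit_op_add[OF Cb assms(1)] limit_op_compact[OF C(1)] by simp
  also have "\<dots> = limit_op T"
    using L.bounded_opsD(1)[OF limit_op_bounded[OF assms(1)]] limit_op_extensional[of T]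
    by (intro limit_fun_eqI) (auto simp: op_algebra_def)
  finally show "limit_op S = limit_op T" .
qed

lemma coset_nonempty: "compact_ops H +>\<^bsub>op_algebra H\<^esub> T \<noteq> {}"
  using zero_compact unfolding a_r_coset_def' by blast

lemma calkin_rep_coset:
  assumes "T \<in> bounded_ops H"
  shows "calkin_rep (compact_ops H +>\<^bsub>op_algebra H\<^esub> T) = limit_op T"
  using coset_nonempty limit_op_coset(1)[OF assms] by (rule calkin_rep_eq)

lemma calkin_carrier:
  "carrier (calkin_algebra H) = (\<lambda>T. compact_ops H +>\<^bsub>op_algebra H\<^esub> T) ` bounded_ops H"
  unfolding calkin_algebra_def quotient_star_algebra_def FactRing_def A_RCOSETS_def'
  by (auto simp: op_algebra_def)

lemma calkin_rep_star_representation: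
  "star_representation (calkin_algebra H) limit_space calkin_rep"
proof -
  let ?I = "compact_ops H" and ?A = "op_algebra H"
  have star_op: "star ?A = adjoint_op H" by (simp add: op_algebra_def)
  have ops: "c \<oplus>\<^bsub>calkin_algebra H\<^esub> d = c <+>\<^bsub>?A\<^esub> d"
    "c \<otimes>\<^bsub>calkin_algebra H\<^esub> d = (\<Union>a\<in>c. \<Union>b\<in>d. ?I +>\<^bsub>?A\<^esub> (a \<otimes>\<^bsub>?A\<^esub> b))"
    "z \<odot>\<^bsub>calkin_algebra H\<^esub> c = (\<Union>a\<in>c. ?I +>\<^bsub>?A\<^esub> (z \<odot>\<^bsub>?A\<^esub> a))"
    "star (calkin_algebra H) c = (\<Union>a\<in>c. ?I +>\<^bsub>?A\<^esub> adjoint_op H a)" for c d z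
    unfolding calkin_algebra_def quotient_star_algebra_def FactRing_def
    by (simp_all add: rcoset_mult_def star_op)
  have carrier: "\<exists>T\<in>bounded_ops H. c = ?I +>\<^bsub>?A\<^esub> T" if "c \<in> carrier (calkin_algebra H)" for c
  proof -
    from that have "c \<in> (\<lambda>T. ?I +>\<^bsub>?A\<^esub> T) ` bounded_ops H" by (simp only: calkin_carrier)
    then show ?thesis by (rule imageE) (rule bexI)
  qed
  have "star_hom (calkin_algebra H) (op_algebra limit_space) calkin_rep"
    unfolding star_hom_def
  proof (intro conjI ballI allI Pi_I)
    fix c z assume "c \<in> carrier (calkin_algebra H)"
    then obtain T where T: "T \<in> bounded_ops H" "c = ?I +>\<^bsub>?A\<^esub> T" using carrier by blast
    have cT: "limit_op S = limit_op T" "S \<in> bounded_ops H" if "S \<in> c" for S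
      using limit_op_coset[OF T(1)] that unfolding T(2) by auto
    have ne: "c \<noteq> {}" unfolding T(2) by (rule coset_nonempty)
    have rc: "calkin_rep c = limit_op T" unfolding T(2) by (rule calkin_rep_coset[OF T(1)])
    show "calkin_rep c \<in> carrier (op_algebra limit_space)"
      unfolding rc using limit_op_bounded[OF T(1)] by (simp add: op_algebra_def)
    show "calkin_rep (z \<odot>\<^bsub>calkin_algebra H\<^esub> c) = z \<odot>\<^bsub>op_algebra limit_space\<^esub> calkin_rep c"
      unfolding ops rc
    proof (rule calkin_rep_eq)
      fix R assume "R \<in> (\<Union>a\<in>c. ?I +>\<^bsub>?A\<^esub> (z \<odot>\<^bsub>?A\<^esub> a))"
      then obtain S where S: "S \<in> c" "R \<in> ?I +>\<^bsub>?A\<^esub> (z \<odot>\<^bsub>?A\<^esub> S)" by blast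
      show "limit_op R = z \<odot>\<^bsub>op_algebra limit_space\<^esub> limit_op T"
        using limit_op_coset(1)[OF bounded_ops_smult[OF cT(2)[OF S(1)]] S(2)]
          limit_op_smult[OF cT(2)[OF S(1)]] cT(1)[OF S(1)] by simp
    qed (use ne in \<open>auto simp: coset_nonempty\<close>)
    show "calkin_rep (star (calkin_algebra H) c) = star (op_algebra limit_space) (calkin_rep c)"
      unfolding ops rc
    proof (rule calkin_rep_eq)
      fix R assume "R \<in> (\<Union>a\<in>c. ?I +>\<^bsub>?A\<^esub> adjoint_op H a)"
      then obtain S where S: "S \<in> c" "R \<in> ?I +>\<^bsub>?A\<^esub> adjoint_op H S" by blast
      show "limit_op R = star (op_algebra limit_space) (limit_op T)"
        using limit_op_coset(1)[OF adjoint_op(1)[OF cT(2)[OF S(1)]] S(2)]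
          limit_op_adjoint[OF cT(2)[OF S(1)]] cT(1)[OF S(1)] by (simp add: op_algebra_def)
    qed (use ne in \<open>auto simp: coset_nonempty\<close>)
    fix d assume "d \<in> carrier (calkin_algebra H)"
    then obtain U where U: "U \<in> bounded_ops H" "d = ?I +>\<^bsub>?A\<^esub> U" using carrier by blast
    have dU: "limit_op S = limit_op U" "S \<in> bounded_ops H" if "S \<in> d" for S
      using limit_op_coset[OF U(1)] that unfolding U(2) by auto
    have nd: "d \<noteq> {}" unfolding U(2) by (rule coset_nonempty)
    have rd: "calkin_rep d = limit_op U" unfolding U(2) by (rule calkin_rep_coset[OF U(1)])
    show "calkin_rep (c \<oplus>\<^bsub>calkin_algebra H\<^esub> d) = calkin_rep c \<oplus>\<^bsub>op_algebra limit_space\<^esub> calkin_rep d"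
      unfolding ops rc rd
    proof (rule calkin_rep_eq)
      show "c <+>\<^bsub>?A\<^esub> d \<noteq> {}" using ne nd unfolding set_add_def' by blast
      fix R assume "R \<in> c <+>\<^bsub>?A\<^esub> d"
      then obtain S S' where S: "S \<in> c" "S' \<in> d" "R = S \<oplus>\<^bsub>?A\<^esub> S'" unfolding set_add_def' by blast
      show "limit_op R = limit_op T \<oplus>\<^bsub>op_algebra limit_space\<^esub> limit_op U"
        using limit_op_add[OF cT(2)[OF S(1)] dU(2)[OF S(2)]] cT(1)[OF S(1)] dU(1)[OF S(2)] S(3) by simp
    qed
    show "calkin_rep (c \<otimes>\<^bsub>calkin_algebra H\<^esub> d) = calkin_rep c \<otimes>\<^bsub>op_algebra limit_space\<^esub> calkin_rep d"
      unfolding ops rc rd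
    proof (rule calkin_rep_eq)
      fix R assume "R \<in> (\<Union>a\<in>c. \<Union>b\<in>d. ?I +>\<^bsub>?A\<^esub> (a \<otimes>\<^bsub>?A\<^esub> b))"
      then obtain S S' where S: "S \<in> c" "S' \<in> d" "R \<in> ?I +>\<^bsub>?A\<^esub> (S \<otimes>\<^bsub>?A\<^esub> S')" by blast
      show "limit_op R = limit_op T \<otimes>\<^bsub>op_algebra limit_space\<^esub> limit_op U"
        using limit_op_coset(1)[OF bounded_ops_compose[OF cT(2)[OF S(1)] dU(2)[OF S(2)]] S(3)]
          limit_op_compose[OF cT(2)[OF S(1)] dU(2)[OF S(2)]] cT(1)[OF S(1)] dU(1)[OF S(2)] by simp
    qed (use ne nd in \<open>auto simp: coset_nonempty\<close>)
  qed
  then show ?thesis unfolding star_representation_def using limit_space_hilbert_space by blast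
qed

end

section \<open>Interpolation of matrices\<close>

lemma sum_power_half_le: "(\<Sum>l\<le>n. (1/2 :: real) ^ l) \<le> 2"
proof -
  have "(\<Sum>l\<le>n. (1/2 :: real) ^ l) = 2 - (1/2) ^ n" by (induction n) auto
  then show ?thesis by simp
qed

lemma weight_pos: "weight i k > 0"
  unfolding weight_def by simp

lemma weight_le: "weight i k \<le> (1/2) ^ i" "weight i k \<le> (1/2) ^ k"
  unfolding weight_def by (rule power_decreasing; simp)+

lemma sum_weight_square_le: "(\<Sum>l\<le>n. (weight m l)\<^sup>2) \<le> (1/2) * (1/4) ^ m"
proof -
  have "(weight m l)\<^sup>2 \<le> (1/4) * (1/4) ^ m * (1/2) ^ l" for l
  proof -
    have "(weight m l)\<^sup>2 = (1/4) * (1/4) ^ m * (1/4) ^ l"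
    proof -
      have "(1/4 :: real) ^ n = (1/2) ^ n * (1/2) ^ n" for n by (simp flip: power_mult_distrib)
      then show ?thesis unfolding weight_def by (simp add: power_add power2_eq_square)
    qed
    moreover have "(1/4 :: real) ^ l \<le> (1/2) ^ l" by (intro power_mono) auto
    ultimately show ?thesis by (simp add: mult_left_mono)
  qed
  then have "(\<Sum>l\<le>n. (weight m l)\<^sup>2) \<le> (\<Sum>l\<le>n. (1/4) * (1/4) ^ m * (1/2) ^ l)"
    by (intro sum_mono)
  also have "\<dots> = (1/4) * (1/4) ^ m * (\<Sum>l\<le>n. (1/2) ^ l)" by (simp only: sum_distrib_left)
  also have "\<dots> \<le> (1/4) * (1/4) ^ m * 2" by (intro mult_left_mono sum_power_half_le) auto
  finally show ?thesis by simp
qed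

lemma sum_weight_square_triangle_le: "(\<Sum>m\<le>N. \<Sum>l\<le>m. (weight m l)\<^sup>2) \<le> 1"
proof -
  have "(\<Sum>l\<le>m. (weight m l)\<^sup>2) \<le> (1/2) * (1/2) ^ m" for m
  proof -
    have "(1/4 :: real) ^ m \<le> (1/2) ^ m" by (intro power_mono) auto
    then show ?thesis using sum_weight_square_le[of m m] by linarith
  qed
  then have "(\<Sum>m\<le>N. \<Sum>l\<le>m. (weight m l)\<^sup>2) \<le> (\<Sum>m\<le>N. (1/2) * (1/2) ^ m)"
    by (intro sum_mono)
  also have "\<dots> = (1/2) * (\<Sum>m\<le>N. (1/2) ^ m)" by (simp only: sum_distrib_left)
  also have "\<dots> \<le> 1" using sum_power_half_le[of N] by simp
  finally show ?thesis .
qed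

definition matrix_form :: "(nat \<Rightarrow> nat \<Rightarrow> complex) \<Rightarrow> nat \<Rightarrow> (nat \<Rightarrow> complex) \<Rightarrow> (nat \<Rightarrow> complex) \<Rightarrow> complex" where
  "matrix_form t N a c = (\<Sum>k\<le>N. \<Sum>j\<le>N. t j k * a k * cnj (c j))"

definition matrix_bounded :: "(nat \<Rightarrow> nat \<Rightarrow> complex) \<Rightarrow> real \<Rightarrow> bool" where
  "matrix_bounded t b \<longleftrightarrow> 0 \<le> b \<and> (\<forall>N a c. cmod (matrix_form t N a c) \<le>
    b * L2_set (\<lambda>k. cmod (a k)) {..N} * L2_set (\<lambda>k. cmod (c k)) {..N})"

lemma matrix_form_add:
  "matrix_form t N (\<lambda>k. a k + a' k) c = matrix_form t N a c + matrix_form t N a' c"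
  "matrix_form t N a (\<lambda>k. c k + c' k) = matrix_form t N a c + matrix_form t N a c'"
  unfolding matrix_form_def by (simp_all add: algebra_simps sum.distrib)

lemma matrix_form_scale:
  "matrix_form t N (\<lambda>k. z * a k) c = z * matrix_form t N a c"
  "matrix_form t N a (\<lambda>k. z * c k) = cnj z * matrix_form t N a c"
  unfolding matrix_form_def sum_distrib_left by (simp_all add: mult_ac)

lemma matrix_form_unit:
  assumes "j \<le> N" "k \<le> N"
  shows "matrix_form t N (\<lambda>l. if l = k then 1 else 0) (\<lambda>l. if l = j then 1 else 0) = t j k"
proof -
  have "matrix_form t N (\<lambda>l. if l = k then 1 else 0) (\<lambda>l. if l = j then 1 else 0) =
      (\<Sum>l\<le>N. if l = k then (\<Sum>i\<le>N. if i = j then t j k else 0) else 0)"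
    unfolding matrix_form_def
    by (intro sum.cong refl) (simp add: if_distrib[of cnj] if_distrib[of "(*) _"] cong: if_cong)
  then show ?thesis using assms by simp
qed

context hilbert_space
begin

text \<open>
  The operator is \<open>S h = \<Sum>\<^sub>i \<Sum>\<^sub>j\<^sub>,\<^sub>k t\<^sub>j\<^sub>k \<langle>h, y i k\<rangle> y i j\<close>, the inner sum ranging over \<open>j, k \<le> i\<close>; it is
  constructed from its sesquilinear form. With \<open>A i h\<close> the Euclidean norm of \<open>\<langle>h, y i k\<rangle>\<close> over \<open>k \<le> i\<close>, the
  \<open>i\<close>-th term of the form is at most \<open>b (A i h) (A i h')\<close>, and \<open>\<Sum>\<^sub>i (A i h)\<^sup>2 \<le> 3 \<parallel>h\<parallel>\<^sup>2\<close>, so the form is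
  bounded. At two vectors of the \<open>i\<close>-th block, the terms of the other blocks are negligible because the
  blocks are almost orthogonal, and the term of the \<open>i\<close>-th block is close to \<open>t j k\<close> if both vectors are
  almost normalized, because the coefficients are then close to those of unit vectors.
\<close>

lemma near_orthogonal_block_operator:
  fixes y :: "nat \<Rightarrow> nat \<Rightarrow> 'a"
  assumes y: "\<And>i k. y i k \<in> carrier H"
    and diag: "\<And>i k. k \<le> i \<Longrightarrow> (hnorm H (y i k))\<^sup>2 \<le> 2"
    and off: "\<And>i k m l. k \<le> i \<Longrightarrow> l \<le> m \<Longrightarrow> (i, k) \<noteq> (m, l) \<Longrightarrow>
      cmod (cinner H (y i k) (y m l)) \<le> weight i k * weight m l"
    and t: "matrix_bounded t b"
  shows "\<exists>S\<in>bounded_ops H. \<forall>i j k. j \<le> i \<longrightarrow> k \<le> i \<longrightarrow>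
    cmod (cinner H (S (y i k)) (y i j) - t j k) \<le>
      b * (3 * \<bar>(hnorm H (y i k))\<^sup>2 - 1\<bar> + \<bar>(hnorm H (y i j))\<^sup>2 - 1\<bar> + 10 * (1/2) ^ i)"
proof -
  have b: "b \<ge> 0" using t unfolding matrix_bounded_def by blast
  have tb: "cmod (matrix_form t N a c) \<le> b * L2_set (\<lambda>k. cmod (a k)) {..N} * L2_set (\<lambda>k. cmod (c k)) {..N}"
    for N a c using t unfolding matrix_bounded_def by blast
  define \<alpha> where "\<alpha> m h = (\<lambda>l. cinner H h (y m l))" for m h
  define A where "A m h = L2_set (\<lambda>l. cmod (\<alpha> m h l)) {..m}" for m h
  define B where "B m h h' = matrix_form t m (\<alpha> m h) (\<alpha> m h')" for m h h'
  have A0: "A m h \<ge> 0" for m h unfolding A_def by simp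
  have A2: "(A m h)\<^sup>2 = (\<Sum>l\<le>m. (cmod (cinner H h (y m l)))\<^sup>2)" for m h
    unfolding A_def \<alpha>_def L2_set_def by (simp add: sum_nonneg)
  have Bessel: "(\<Sum>m\<le>N. (A m h)\<^sup>2) \<le> 3 * (hnorm H h)\<^sup>2" if h: "h \<in> carrier H" for N h
  proof -
    have "(\<Sum>m\<le>N. (A m h)\<^sup>2) =
        (\<Sum>p\<in>Sigma {..N} (\<lambda>m. {..m}). (cmod (cinner H h (y (fst p) (snd p))))\<^sup>2)"
      unfolding A2 by (subst sum.Sigma) (auto simp: case_prod_beta)
    also have "\<dots> \<le> 3 * (hnorm H h)\<^sup>2"
    proof (rule Bessel_near_orthogonal[where e = "\<lambda>p. weight (fst p) (snd p)"])
      have "(\<Sum>p\<in>Sigma {..N} (\<lambda>m. {..m}). (weight (fst p) (snd p))\<^sup>2) =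
          (\<Sum>m\<le>N. \<Sum>l\<le>m. (weight m l)\<^sup>2)"
        by (subst sum.Sigma) (auto simp: case_prod_beta)
      then show "(\<Sum>p\<in>Sigma {..N} (\<lambda>m. {..m}). (weight (fst p) (snd p))\<^sup>2) \<le> 1"
        using sum_weight_square_triangle_le by simp
      fix p q assume "p \<in> Sigma {..N} (\<lambda>m. {..m})" "q \<in> Sigma {..N} (\<lambda>m. {..m})" "p \<noteq> q"
      then show "cmod (cinner H (y (fst p) (snd p)) (y (fst q) (snd q))) \<le>
          weight (fst p) (snd p) * weight (fst q) (snd q)"
        by (intro off) (auto simp: prod_eq_iff)
    qed (use y h diag weight_pos in \<open>auto simp: less_imp_le\<close>)
    finally show ?thesis .
  qed
  have pair: "(\<Sum>m\<le>N. A m h * A m h') \<le> 3 * hnorm H h * hnorm H h'"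
    if h: "h \<in> carrier H" "h' \<in> carrier H" for N h h'
  proof -
    have "(\<Sum>m\<le>N. A m h * A m h')\<^sup>2 \<le> (\<Sum>m\<le>N. (A m h)\<^sup>2) * (\<Sum>m\<le>N. (A m h')\<^sup>2)"
      by (rule Cauchy_Schwarz_ineq_sum)
    also have "\<dots> \<le> (3 * (hnorm H h)\<^sup>2) * (3 * (hnorm H h')\<^sup>2)"
      using Bessel h by (intro mult_mono) (auto intro: sum_nonneg)
    also have "\<dots> = (3 * hnorm H h * hnorm H h')\<^sup>2" by (simp add: power2_eq_square)
    finally show ?thesis by (rule power2_le_imp_le) (simp add: hnorm_nonneg h)
  qed
  have Bb: "cmod (B m h h') \<le> b * (A m h * A m h')" for m h h'
    using tb[of m "\<alpha> m h" "\<alpha> m h'"] unfolding B_def A_def by (simp add: mult.assoc)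
  have partial: "(\<Sum>m\<le>N. cmod (B m h h')) \<le> 3 * b * hnorm H h * hnorm H h'"
    if h: "h \<in> carrier H" "h' \<in> carrier H" for N h h'
  proof -
    have "(\<Sum>m\<le>N. cmod (B m h h')) \<le> (\<Sum>m\<le>N. b * (A m h * A m h'))"
      using Bb by (intro sum_mono)
    also have "\<dots> = b * (\<Sum>m\<le>N. A m h * A m h')" by (simp only: sum_distrib_left)
    also have "\<dots> \<le> b * (3 * hnorm H h * hnorm H h')" using pair[OF h] b by (intro mult_left_mono)
    finally show ?thesis by (simp add: mult_ac)
  qed
  have summ: "summable (\<lambda>m. cmod (B m h h'))" if h: "h \<in> carrier H" "h' \<in> carrier H" for h h'
    using partial[OF h]
    by (intro bounded_imp_summable[where B = "3 * b * hnorm H h * hnorm H h'"]) auto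
  note sB = summable_norm_cancel[OF summ]
  define F where "F h h' = (\<Sum>m. B m h h')" for h h'
  have "\<exists>S\<in>bounded_ops H. \<forall>h\<in>carrier H. \<forall>h'\<in>carrier H. cinner H (S h) h' = F h h'"
  proof (rule bounded_form_operator)
    fix h h' h'' c
    assume h: "h \<in> carrier H" and h': "h' \<in> carrier H"
    show "cmod (F h h') \<le> (3 * b) * hnorm H h * hnorm H h'"
    proof -
      have "cmod (F h h') \<le> (\<Sum>m. cmod (B m h h'))"
        unfolding F_def by (rule summable_norm[OF summ[OF h h']])
      also have "\<dots> \<le> 3 * b * hnorm H h * hnorm H h'"
      proof (rule suminf_le_const[OF summ[OF h h']])
        fix n
        have "(\<Sum>m<n. cmod (B m h h')) \<le> (\<Sum>m\<le>n. cmod (B m h h'))"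
          by (intro sum_mono2) auto
        then show "(\<Sum>m<n. cmod (B m h h')) \<le> 3 * b * hnorm H h * hnorm H h'"
          using partial[OF h h', of n] by linarith
      qed
      finally show ?thesis .
    qed
    have "\<alpha> m (c \<odot> h) = (\<lambda>l. c * \<alpha> m h l)" for m
      unfolding \<alpha>_def using h y by (simp add: cinner_smult_left)
    then show "F (c \<odot> h) h' = c * F h h'"
      unfolding F_def B_def using suminf_mult[OF sB[OF h h'], of c]
      by (simp add: matrix_form_scale B_def)
    have "\<alpha> m (c \<odot> h') = (\<lambda>l. c * \<alpha> m h' l)" for m
      unfolding \<alpha>_def using h' y by (simp add: cinner_smult_left)
    then show "F h (c \<odot> h') = cnj c * F h h'"
      unfolding F_def B_def using suminf_mult[OF sB[OF h h'], of "cnj c"]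
      by (simp add: matrix_form_scale B_def)
    assume h'': "h'' \<in> carrier H"
    have "\<alpha> m (h \<oplus> h') = (\<lambda>l. \<alpha> m h l + \<alpha> m h' l)" for m
      unfolding \<alpha>_def using h h' y by (simp add: cinner_add_left)
    then show "F (h \<oplus> h') h'' = F h h'' + F h' h''"
      unfolding F_def B_def using suminf_add[OF sB[OF h h''] sB[OF h' h'']]
      by (simp add: matrix_form_add B_def)
    have "\<alpha> m (h' \<oplus> h'') = (\<lambda>l. \<alpha> m h' l + \<alpha> m h'' l)" for m
      unfolding \<alpha>_def using h' h'' y by (simp add: cinner_add_left)
    then show "F h (h' \<oplus> h'') = F h h' + F h h''"
      unfolding F_def B_def using suminf_add[OF sB[OF h h'] sB[OF h h'']]
      by (simp add: matrix_form_add B_def)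
  qed
  then obtain S where S: "S \<in> bounded_ops H"
    "\<And>h h'. h \<in> carrier H \<Longrightarrow> h' \<in> carrier H \<Longrightarrow> cinner H (S h) h' = F h h'" by blast
  have "cmod (cinner H (S (y i k)) (y i j) - t j k) \<le>
      b * (3 * \<bar>(hnorm H (y i k))\<^sup>2 - 1\<bar> + \<bar>(hnorm H (y i j))\<^sup>2 - 1\<bar> + 10 * (1/2) ^ i)"
    if jk: "j \<le> i" "k \<le> i" for i j k
  proof -
    define d where "d r = (\<lambda>l :: nat. if l = r then 1 else 0 :: complex)" for r
    let ?p = "y i k" and ?q = "y i j"
    have far: "A m (y i r) \<le> (1/2) ^ i * (1/2) ^ m" if "m \<noteq> i" "r \<le> i" for m r
    proof (rule power2_le_imp_le)
      have "(A m (y i r))\<^sup>2 \<le> (\<Sum>l\<le>m. (weight i r)\<^sup>2 * (weight m l)\<^sup>2)"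
        unfolding A2
      proof (rule sum_mono)
        fix l assume "l \<in> {..m}"
        then have "cmod (cinner H (y i r) (y m l)) \<le> weight i r * weight m l"
          using off[of r i l m] that by auto
        then show "(cmod (cinner H (y i r) (y m l)))\<^sup>2 \<le> (weight i r)\<^sup>2 * (weight m l)\<^sup>2"
          unfolding power_mult_distrib[symmetric] by (intro power_mono) auto
      qed
      also have "\<dots> = (weight i r)\<^sup>2 * (\<Sum>l\<le>m. (weight m l)\<^sup>2)" by (simp only: sum_distrib_left)
      also have "\<dots> \<le> ((1/2) ^ i)\<^sup>2 * ((1/2) ^ m)\<^sup>2"
      proof (intro mult_mono power_mono weight_le)
        have "((1/2 :: real) ^ m)\<^sup>2 = (1/4) ^ m"
          by (simp add: power2_eq_square flip: power_mult_distrib)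
        then show "(\<Sum>l\<le>m. (weight m l)\<^sup>2) \<le> ((1/2) ^ m)\<^sup>2"
          using sum_weight_square_le[of m m] zero_le_power[of "1/4 :: real" m] by linarith
      qed (use weight_pos in \<open>auto intro: sum_nonneg less_imp_le\<close>)
      finally show "(A m (y i r))\<^sup>2 \<le> ((1/2) ^ i * (1/2) ^ m)\<^sup>2" by (simp only: power_mult_distrib)
    qed simp
    have near: "L2_set (\<lambda>l. cmod (\<alpha> i (y i r) l - d r l)) {..i} \<le> \<bar>(hnorm H (y i r))\<^sup>2 - 1\<bar> + 2 * (1/2) ^ i"
      if r: "r \<le> i" for r
    proof -
      have "L2_set (\<lambda>l. cmod (\<alpha> i (y i r) l - d r l)) {..i} \<le> (\<Sum>l\<le>i. cmod (\<alpha> i (y i r) l - d r l))"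
        by (rule L2_set_le_sum) simp
      also have "\<dots> \<le> (\<Sum>l\<le>i. (if l = r then \<bar>(hnorm H (y i r))\<^sup>2 - 1\<bar> else 0) + (1/2) ^ i * (1/2) ^ l)"
      proof (rule sum_mono)
        fix l assume l: "l \<in> {..i}"
        show "cmod (\<alpha> i (y i r) l - d r l) \<le>
            (if l = r then \<bar>(hnorm H (y i r))\<^sup>2 - 1\<bar> else 0) + (1/2) ^ i * (1/2) ^ l"
        proof (cases "l = r")
          case True
          have "\<alpha> i (y i r) l - d r l = of_real ((hnorm H (y i r))\<^sup>2 - 1)"
            unfolding \<alpha>_def d_def using True cinner_self[OF y] by simp
          then have "cmod (\<alpha> i (y i r) l - d r l) = \<bar>(hnorm H (y i r))\<^sup>2 - 1\<bar>"
            by (simp only: norm_of_real)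
          then show ?thesis using True by simp
        next
          case False
          have "cmod (cinner H (y i r) (y i l)) \<le> weight i r * weight i l"
            using off[of r i l i] r l False by auto
          also have "\<dots> \<le> (1/2) ^ i * (1/2) ^ l"
            using weight_pos by (intro mult_mono weight_le) (auto intro: less_imp_le)
          finally show ?thesis using False unfolding \<alpha>_def d_def by simp
        qed
      qed
      also have "\<dots> = \<bar>(hnorm H (y i r))\<^sup>2 - 1\<bar> + (1/2) ^ i * (\<Sum>l\<le>i. (1/2) ^ l)"
        using r by (simp add: sum.distrib sum_distrib_left)
      also have "\<dots> \<le> \<bar>(hnorm H (y i r))\<^sup>2 - 1\<bar> + (1/2) ^ i * 2"
        by (intro add_left_mono mult_left_mono sum_power_half_le) simp
      finally show ?thesis by (simp add: mult.commute)
    qed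
    have d1: "L2_set (\<lambda>l. cmod (d r l)) {..i} \<le> 1" for r
    proof -
      have "L2_set (\<lambda>l. cmod (d r l)) {..i} \<le> (\<Sum>l\<le>i. cmod (d r l))" by (rule L2_set_le_sum) simp
      also have "\<dots> = (\<Sum>l\<le>i. if l = r then 1 else 0)" unfolding d_def by (intro sum.cong) auto
      also have "\<dots> \<le> 1" by simp
      finally show ?thesis .
    qed
    have q3: "A i ?q \<le> 3"
    proof (rule power2_le_imp_le)
      have "(A i ?q)\<^sup>2 \<le> (\<Sum>m\<le>i. (A m ?q)\<^sup>2)" by (rule member_le_sum) auto
      also have "\<dots> \<le> 3 * (hnorm H ?q)\<^sup>2" by (rule Bessel[OF y])
      also have "\<dots> \<le> 3\<^sup>2" using diag[OF jk(1)] by simp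
      finally show "(A i ?q)\<^sup>2 \<le> 3\<^sup>2" .
    qed simp
    have diagonal: "cmod (B i ?p ?q - t j k) \<le>
        b * (\<bar>(hnorm H ?p)\<^sup>2 - 1\<bar> + 2 * (1/2) ^ i) * 3 + b * 1 * (\<bar>(hnorm H ?q)\<^sup>2 - 1\<bar> + 2 * (1/2) ^ i)"
    proof -
      let ?u = "\<lambda>l. \<alpha> i ?p l - d k l" and ?v = "\<lambda>l. \<alpha> i ?q l - d j l"
      have "B i ?p ?q = matrix_form t i ?u (\<alpha> i ?q) + matrix_form t i (d k) (\<alpha> i ?q)"
        unfolding B_def matrix_form_add(1)[symmetric] by simp
      moreover have "matrix_form t i (d k) (\<alpha> i ?q) = matrix_form t i (d k) ?v + matrix_form t i (d k) (d j)"
        unfolding matrix_form_add(2)[symmetric] by simp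
      moreover have "matrix_form t i (d k) (d j) = t j k"
        unfolding d_def using jk by (rule matrix_form_unit)
      ultimately have "cmod (B i ?p ?q - t j k) \<le>
          cmod (matrix_form t i ?u (\<alpha> i ?q)) + cmod (matrix_form t i (d k) ?v)"
        using norm_triangle_ineq by simp
      also have "cmod (matrix_form t i ?u (\<alpha> i ?q)) \<le> b * (\<bar>(hnorm H ?p)\<^sup>2 - 1\<bar> + 2 * (1/2) ^ i) * 3"
        using near[OF jk(2)] q3 b unfolding A_def
        by (intro order_trans[OF tb] mult_mono) auto
      also have "cmod (matrix_form t i (d k) ?v) \<le> b * 1 * (\<bar>(hnorm H ?q)\<^sup>2 - 1\<bar> + 2 * (1/2) ^ i)"
        using near[OF jk(1)] d1 b
        by (intro order_trans[OF tb] mult_mono) auto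
      finally show ?thesis by simp
    qed
    have rest: "cmod (F ?p ?q - B i ?p ?q) \<le> 2 * b * (1/2) ^ i"
    proof -
      define R where "R m = (if m = i then 0 else B m ?p ?q)" for m
      have Rb: "cmod (R m) \<le> b * (1/2) ^ i * (1/2) ^ m" for m
      proof (cases "m = i")
        case False
        have half: "(1/2 :: real) ^ i * (1/2) ^ m \<le> 1" "(0 :: real) \<le> (1/2) ^ i * (1/2) ^ m"
          by (auto simp: mult_le_one power_le_one)
        have "cmod (B m ?p ?q) \<le> b * (A m ?p * A m ?q)" by (rule Bb)
        also have "\<dots> \<le> b * (((1/2) ^ i * (1/2) ^ m) * ((1/2) ^ i * (1/2) ^ m))"
          using far[OF False jk(2)] far[OF False jk(1)] A0 b half by (intro mult_left_mono mult_mono) auto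
        also have "\<dots> \<le> b * (((1/2) ^ i * (1/2) ^ m) * 1)"
          using b half by (intro mult_left_mono) auto
        finally show ?thesis using False unfolding R_def by (simp add: mult.assoc)
      qed (simp add: R_def b)
      have "F ?p ?q = (\<Sum>m. R m + (if m = i then B i ?p ?q else 0))"
        unfolding F_def R_def by (intro arg_cong[of _ _ suminf]) auto
      also have "\<dots> = suminf R + B i ?p ?q"
      proof -
        have R: "summable R"
          by (rule summable_comparison_test'[where g = "\<lambda>m. b * (1/2) ^ i * (1/2) ^ m" and N = 0])
            (use Rb in \<open>auto intro!: summable_mult summable_geometric\<close>)
        have "(\<lambda>m. if m = i then B i ?p ?q else 0) sums B i ?p ?q"
          using sums_single[of i "\<lambda>_. B i ?p ?q"] by simp
        then show ?thesis using sums_unique[OF sums_add[OF summable_sums[OF R]]] by fastforce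
      qed
      finally have "F ?p ?q - B i ?p ?q = suminf R" by simp
      moreover have geo: "(\<lambda>m. b * (1/2) ^ i * (1/2) ^ m) sums (b * (1/2) ^ i * 2)"
        using sums_mult[OF geometric_sums[of "1/2 :: real"], of "b * (1/2) ^ i"] by simp
      ultimately show ?thesis
        using norm_suminf_le[OF Rb sums_summable[OF geo]] sums_unique[OF geo, symmetric]
        by (simp add: mult_ac)
    qed
    have "cmod (cinner H (S ?p) ?q - t j k) \<le> cmod (F ?p ?q - B i ?p ?q) + cmod (B i ?p ?q - t j k)"
      unfolding S(2)[OF y y] using norm_triangle_ineq[of "F ?p ?q - B i ?p ?q" "B i ?p ?q - t j k"] by simp
    with rest diagonal show ?thesis by (simp add: algebra_simps)
  qed
  then show ?thesis using S(1) by blast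
qed

text \<open>
  The form of the matrix is \<open>\<langle>T v, v'\<rangle>\<close> for the vectors \<open>v\<close> and \<open>v'\<close> with the given coefficients, whose
  norms are at most the Euclidean norms of the coefficients.
\<close>

lemma ortho_seq_matrix_bounded:
  assumes e: "ortho_seq H e" and T: "T \<in> bounded_ops H"
  shows "\<exists>b. matrix_bounded (\<lambda>j k. cinner H (T (e k)) (e j)) b"
proof -
  obtain b where b: "b > 0" "\<And>x. x \<in> carrier H \<Longrightarrow> hnorm H (T x) \<le> b * hnorm H x"
    using bounded_ops_bound[OF T] by blast
  have eH: "e k \<in> carrier H" for k using e unfolding ortho_seq_def by blast
  have ee: "cinner H (e j) (e k) = (if j = k \<and> e k \<noteq> \<zero> then 1 else 0)" for j k
    using e unfolding ortho_seq_def by blast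
  have bound: "cmod (matrix_form (\<lambda>j k. cinner H (T (e k)) (e j)) N a c) \<le>
      b * L2_set (\<lambda>k. cmod (a k)) {..N} * L2_set (\<lambda>k. cmod (c k)) {..N}" for N a c
  proof -
    define v where "v a = (\<Oplus>\<^bsub>H\<^esub>k\<in>{..N}. a k \<odot> e k)" for a
    have v: "v a \<in> carrier H" for a unfolding v_def using eH by (intro M.finsum_closed) auto
    have vu: "cinner H (v a) u = (\<Sum>k\<le>N. a k * cinner H (e k) u)" if u: "u \<in> carrier H" for a u
    proof -
      have "cinner H (v a) u = (\<Sum>k\<le>N. cinner H (a k \<odot> e k) u)"
        unfolding v_def using eH u by (intro cinner_finsum_left) auto
      then show ?thesis using eH u by (simp add: cinner_smult_left)
    qed
    have uv: "cinner H u (v a) = (\<Sum>k\<le>N. cnj (a k) * cinner H u (e k))" if u: "u \<in> carrier H" for a u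
    proof -
      have "cinner H u (v a) = (\<Sum>k\<le>N. cnj (a k * cinner H (e k) u))"
        using cinner_commute[OF v u] vu[OF u] by simp
      also have "\<dots> = (\<Sum>k\<le>N. cnj (a k) * cinner H u (e k))"
      proof (rule sum.cong[OF refl])
        fix k
        show "cnj (a k * cinner H (e k) u) = cnj (a k) * cinner H u (e k)"
          using cinner_commute[OF eH u, of k] by simp
      qed
      finally show ?thesis .
    qed
    have norm: "hnorm H (v a) \<le> L2_set (\<lambda>k. cmod (a k)) {..N}" for a
    proof (rule power2_le_imp_le)
      have "cinner H (v a) (e k) = (\<Sum>j\<le>N. if j = k then (if e k \<noteq> \<zero> then a k else 0) else 0)" for k
        unfolding vu[OF eH] ee by (intro sum.cong) auto
      then have ve: "cinner H (v a) (e k) = (if e k \<noteq> \<zero> then a k else 0)" if "k \<le> N" for k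
        using that by simp
      have "(hnorm H (v a))\<^sup>2 = Re (cinner H (v a) (v a))" by (rule hnorm_square[OF v])
      also have "\<dots> = (\<Sum>k\<le>N. Re (cnj (a k) * cinner H (v a) (e k)))" unfolding uv[OF v] by simp
      also have "\<dots> \<le> (\<Sum>k\<le>N. (cmod (a k))\<^sup>2)"
      proof (rule sum_mono)
        fix k assume "k \<in> {..N}"
        have "cnj (a k) * a k = of_real ((cmod (a k))\<^sup>2)"
          using complex_norm_square[of "a k"] by (simp add: mult.commute)
        then have "Re (cnj (a k) * a k) = (cmod (a k))\<^sup>2" by (simp only: Re_complex_of_real)
        then show "Re (cnj (a k) * cinner H (v a) (e k)) \<le> (cmod (a k))\<^sup>2"
          using ve[of k] \<open>k \<in> {..N}\<close> by (cases "e k = \<zero>") simp_all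
      qed
      finally show "(hnorm H (v a))\<^sup>2 \<le> (L2_set (\<lambda>k. cmod (a k)) {..N})\<^sup>2"
        unfolding L2_set_def by (simp add: sum_nonneg)
    qed simp
    have Tv: "T (v a) \<in> carrier H" using bounded_opsD(1)[OF T v] .
    have "cinner H (T (v a)) u = (\<Sum>k\<le>N. a k * cinner H (T (e k)) u)" if u: "u \<in> carrier H" for u
      using adjoint_op(2)[OF T v u] vu[OF bounded_opsD(1)[OF adjoint_op(1)[OF T] u]]
        adjoint_op(2)[OF T eH u] by simp
    then have "cinner H (T (v a)) (v c) = (\<Sum>j\<le>N. \<Sum>k\<le>N. cnj (c j) * (a k * cinner H (T (e k)) (e j)))"
      unfolding uv[OF Tv] using eH by (simp add: sum_distrib_left)
    also have "\<dots> = matrix_form (\<lambda>j k. cinner H (T (e k)) (e j)) N a c"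
      unfolding matrix_form_def by (subst sum.swap) (simp add: mult_ac)
    finally have "cmod (matrix_form (\<lambda>j k. cinner H (T (e k)) (e j)) N a c) \<le> hnorm H (T (v a)) * hnorm H (v c)"
      using Cauchy_Schwarz[OF Tv v] by metis
    also have "\<dots> \<le> (b * L2_set (\<lambda>k. cmod (a k)) {..N}) * L2_set (\<lambda>k. cmod (c k)) {..N}"
      using norm[of c] order_trans[OF b(2)[OF v] mult_left_mono[OF norm, of b]] b(1) hnorm_nonneg v
      by (intro mult_mono) auto
    finally show ?thesis .
  qed
  then show ?thesis unfolding matrix_bounded_def using b(1) by (intro exI[of _ b]) auto
qed

end

context generic_sequences
begin

text \<open>
  Different \<open>x k\<close> are orthogonal in the limit, which makes each block almost orthogonal far out in \<open>G\<close>.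
  Each \<open>x k\<close> is weakly null, which makes a block far out almost orthogonal to all earlier blocks. Hence
  every set in \<open>G\<close> has an infinite subset along which \<open>x\<close> is nearly orthogonal. As the question has been
  decided by a set in \<open>G\<close>, that set is itself such a subset.
\<close>

lemma near_orthogonal_subsequence:
  assumes x: "\<And>k. x k \<in> null_seqs"
    and ortho: "\<And>j k. j \<noteq> k \<Longrightarrow> lim_inner (x j) (x k) = 0"
    and norm: "\<And>k. Re (lim_inner (x k) (x k)) \<le> 1"
  shows "\<exists>Z. near_orthogonal H x Z \<and> eventually (\<lambda>n. n \<in> Z) G"
proof -
  obtain Z where Z: "eventually (\<lambda>n. n \<in> Z) G"
    "near_orthogonal H x Z \<or> (\<forall>Y\<subseteq>Z. infinite Y \<longrightarrow> \<not> near_orthogonal H x Y)"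
    using near_orthogonal_decided[of x] seq_carrier[OF x] by blast
  define P where "P i n \<longleftrightarrow> n \<in> Z \<and> (\<forall>k\<in>{..i}. (hnorm H (x k n))\<^sup>2 \<le> 2) \<and>
    (\<forall>k\<in>{..i}. \<forall>l\<in>{..i}. k \<noteq> l \<longrightarrow> cmod (cinner H (x k n) (x l n)) \<le> weight i k * weight i l)" for i n
  define Q where "Q m i a n \<longleftrightarrow> a < n \<and> (\<forall>k\<in>{..i}. \<forall>l\<in>{..m}.
    cmod (cinner H (x k n) (x l a)) \<le> weight i k * weight m l)" for m i a n :: nat
  have small: "\<forall>\<^sub>F n in G. cmod (c n) \<le> weight i k * weight m l" if "(c \<longlongrightarrow> 0) G" for c i k m l
  proof -
    have "\<forall>\<^sub>F n in G. cmod (c n) < weight i k * weight m l"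
      using tendstoD[OF that mult_pos_pos[OF weight_pos weight_pos]] by simp
    then show ?thesis by eventually_elim simp
  qed
  have "\<exists>f. \<forall>i. P i (f i) \<and> (\<forall>m<i. Q m i (f m) (f i))"
  proof (rule diagonal_selection[OF G_nontrivial])
    fix i
    have "\<forall>\<^sub>F n in G. (hnorm H (x k n))\<^sup>2 \<le> 2" for k
    proof -
      have "((\<lambda>n. (hnorm H (x k n))\<^sup>2) \<longlongrightarrow> Re (lim_inner (x k) (x k))) G"
        using tendsto_Re[OF lim_inner_tendsto[OF x x]] seq_carrier[OF x] by (simp add: hnorm_square)
      then have "\<forall>\<^sub>F n in G. (hnorm H (x k n))\<^sup>2 < 2"
        using order_tendstoD(2) norm[of k] by fastforce
      then show ?thesis by eventually_elim simp
    qed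
    moreover have "\<forall>\<^sub>F n in G. k \<noteq> l \<longrightarrow> cmod (cinner H (x k n) (x l n)) \<le> weight i k * weight i l" for k l
    proof (cases "k = l")
      case False
      show ?thesis
        using small[of "\<lambda>n. cinner H (x k n) (x l n)"] lim_inner_tendsto[OF x x, of k l] ortho[OF False]
        by simp
    qed simp
    ultimately show "eventually (P i) G"
      unfolding P_def using Z(1) by (intro eventually_conj eventually_ball_finite ballI finite_atMost) auto
  next
    fix m i a
    have "\<forall>\<^sub>F n in G. a < n" using filter_leD[OF G_free eventually_gt_at_top] .
    moreover have "\<forall>\<^sub>F n in G. cmod (cinner H (x k n) (x l a)) \<le> weight i k * weight m l" for k l
      by (rule small[OF seq_weak_null[OF x seq_carrier[OF x]]])
    ultimately show "eventually (Q m i a) G"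
      unfolding Q_def by (intro eventually_conj eventually_ball_finite ballI) auto
  qed
  then obtain f where f: "\<And>i. P i (f i)" "\<And>m i. m < i \<Longrightarrow> Q m i (f m) (f i)" by blast
  have mono: "strict_mono f" using f(2) unfolding Q_def strict_mono_def by blast
  have "near_orthogonal H x (range f)"
    unfolding near_orthogonal_def
  proof (intro exI[of _ f] conjI allI impI)
    show "(hnorm H (x k (f i)))\<^sup>2 \<le> 2" if "k \<le> i" for i k
      using f(1)[of i] that unfolding P_def by simp
    fix i m k l :: nat assume kl: "k \<le> i" "l \<le> m" "(i, k) \<noteq> (m, l)"
    show "cmod (cinner H (x k (f i)) (x l (f m))) \<le> weight i k * weight m l"
    proof (cases i m rule: linorder_cases)
      case less
      then have "cmod (cinner H (x l (f m)) (x k (f i))) \<le> weight m l * weight i k"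
        using f(2)[OF less] kl unfolding Q_def by simp
      moreover have "cinner H (x k (f i)) (x l (f m)) = cnj (cinner H (x l (f m)) (x k (f i)))"
        by (rule cinner_commute[OF seq_carrier[OF x] seq_carrier[OF x]])
      ultimately show ?thesis by (simp add: mult.commute)
    next
      case equal
      then show ?thesis using f(1)[of i] kl unfolding P_def by auto
    next
      case greater
      then show ?thesis using f(2)[OF greater] kl unfolding Q_def by simp
    qed
  qed (rule mono, rule refl)
  moreover have "range f \<subseteq> Z" using f(1) unfolding P_def by blast
  moreover have "infinite (range f)" using mono by (simp add: range_inj_infinite strict_mono_imp_inj_on)
  ultimately show ?thesis using Z by blast
qed

text \<open>
  The heart of the matter: a bounded matrix in a countable orthonormal system of the limit space is
  realized by an operator on \<open>H\<close>. Zero entries of \<open>e\<close> give no information about \<open>t\<close> and are excluded.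
\<close>

lemma matrix_interpolation:
  assumes e: "ortho_seq limit_space e" and t: "matrix_bounded t b"
  shows "\<exists>S\<in>bounded_ops H. \<forall>j k. e j \<noteq> \<zero>\<^bsub>limit_space\<^esub> \<longrightarrow> e k \<noteq> \<zero>\<^bsub>limit_space\<^esub> \<longrightarrow>
    cinner limit_space (limit_op S (e k)) (e j) = t j k"
proof -
  define x where "x k = lift (e k)" for k
  have eL: "e k \<in> carrier limit_space" for k using e unfolding ortho_seq_def by blast
  have x: "x k \<in> null_seqs" "coords (x k) = e k" for k
    unfolding x_def using lift[OF eL] by auto
  have xx: "lim_inner (x j) (x k) = (if j = k \<and> e k \<noteq> \<zero>\<^bsub>limit_space\<^esub> then 1 else 0)" for j k
    using limit_space_cinner[OF x(1) x(1), of j k] e x(2) unfolding ortho_seq_def by simp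
  obtain Z where Z: "near_orthogonal H x Z" "eventually (\<lambda>n. n \<in> Z) G"
  proof -
    have "\<exists>Z. near_orthogonal H x Z \<and> eventually (\<lambda>n. n \<in> Z) G"
      by (rule near_orthogonal_subsequence[OF x(1)]) (simp_all add: xx)
    then show thesis using that by (elim exE conjE)
  qed
  from Z(1)[unfolded near_orthogonal_def] obtain f where f_near: "strict_mono f \<and> range f = Z \<and>
    (\<forall>i. \<forall>k\<le>i. (hnorm H (x k (f i)))\<^sup>2 \<le> 2) \<and>
    (\<forall>i m. \<forall>k\<le>i. \<forall>l\<le>m. (i, k) \<noteq> (m, l) \<longrightarrow>
      cmod (cinner H (x k (f i)) (x l (f m))) \<le> weight i k * weight m l)" by (rule exE)
  have f: "strict_mono f" "range f = Z"
    "\<And>i k. k \<le> i \<Longrightarrow> (hnorm H (x k (f i)))\<^sup>2 \<le> 2"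
    "\<And>i m k l. k \<le> i \<Longrightarrow> l \<le> m \<Longrightarrow> (i, k) \<noteq> (m, l) \<Longrightarrow>
      cmod (cinner H (x k (f i)) (x l (f m))) \<le> weight i k * weight m l"
    using f_near by simp_all
  obtain S where S: "S \<in> bounded_ops H" "\<And>i j k. j \<le> i \<Longrightarrow> k \<le> i \<Longrightarrow>
    cmod (cinner H (S (x k (f i))) (x j (f i)) - t j k) \<le>
      b * (3 * \<bar>(hnorm H (x k (f i)))\<^sup>2 - 1\<bar> + \<bar>(hnorm H (x j (f i)))\<^sup>2 - 1\<bar> + 10 * (1/2) ^ i)"
    using near_orthogonal_block_operator[of "\<lambda>i k. x k (f i)" t b] f(3,4) t seq_carrier[OF x(1)] by blast
  (* The number of the block to which an index belongs; it tends to infinity along G. *)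
  define g where "g = inv_into UNIV f"
  have inj: "inj f" using f(1) by (rule strict_mono_imp_inj_on)
  have fg: "\<forall>\<^sub>F n in G. f (g n) = n"
    using Z(2) unfolding g_def f(2)[symmetric] by eventually_elim (rule f_inv_into_f)
  have late: "\<forall>\<^sub>F n in G. i \<le> g n" for i
  proof -
    have "\<forall>\<^sub>F n in G. f i \<le> n" using filter_leD[OF G_free eventually_ge_at_top] .
    with fg show ?thesis
    proof eventually_elim
      case (elim n)
      then have "f i \<le> f (g n)" by simp
      then show ?case using f(1) by (simp add: strict_mono_less_eq)
    qed
  qed
  have "cinner limit_space (limit_op S (e k)) (e j) = t j k"
    if nz: "e j \<noteq> \<zero>\<^bsub>limit_space\<^esub>" "e k \<noteq> \<zero>\<^bsub>limit_space\<^esub>" for j k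
  proof -
    have norm: "((\<lambda>n. (hnorm H (x r n))\<^sup>2) \<longlongrightarrow> 1) G" if "e r \<noteq> \<zero>\<^bsub>limit_space\<^esub>" for r
      using tendsto_Re[OF lim_inner_tendsto[OF x(1)[of r] x(1)[of r]]] xx[of r r] that seq_carrier[OF x(1)]
      by (simp add: hnorm_square)
    have "filterlim g sequentially G" using late by (simp add: filterlim_at_top)
    then have "((\<lambda>n. (1/2 :: real) ^ g n) \<longlongrightarrow> 0) G"
      using filterlim_compose[OF LIMSEQ_power_zero[of "1/2 :: real"]] by simp
    then have lim: "((\<lambda>n. b * (3 * \<bar>(hnorm H (x k n))\<^sup>2 - 1\<bar> + \<bar>(hnorm H (x j n))\<^sup>2 - 1\<bar> + 10 * (1/2) ^ g n))
        \<longlongrightarrow> b * (3 * \<bar>1 - 1\<bar> + \<bar>1 - 1\<bar> + 10 * 0)) G"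
      by (intro tendsto_intros norm nz)
    have "((\<lambda>n. cinner H (S (x k n)) (x j n) - t j k) \<longlongrightarrow> 0) G"
    proof (rule Lim_null_comparison)
      show "\<forall>\<^sub>F n in G. norm (cinner H (S (x k n)) (x j n) - t j k) \<le>
          b * (3 * \<bar>(hnorm H (x k n))\<^sup>2 - 1\<bar> + \<bar>(hnorm H (x j n))\<^sup>2 - 1\<bar> + 10 * (1/2) ^ g n)"
        using fg late[of j] late[of k]
      proof eventually_elim
        case (elim n)
        then show ?case using S(2)[of j "g n" k] by simp
      qed
    qed (use lim in simp)
    then have "lim_inner (\<lambda>n. S (x k n)) (x j) = t j k"
      by (intro lim_inner_eqI) (rule LIM_zero_cancel)
    then show ?thesis
      using limit_op_coords[OF S(1) x(1)] limit_space_cinner[OF null_seqs_op[OF x(1) S(1)] x(1)] x(2)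
      by metis
  qed
  then show ?thesis using S(1) by blast
qed

section \<open>Irreducibility and infinite transitivity\<close>

text \<open>
  An orthonormal sequence is weakly null by Bessel's inequality, and all its entries have norm 1.
\<close>

lemma limit_space_nontrivial:
  assumes "separable H" "\<not> finite_dimensional H"
  shows "\<exists>u\<in>carrier limit_space. u \<noteq> \<zero>\<^bsub>limit_space\<^esub>"
proof -
  from ortho_seq_total_exists[OF assms(1)]
  obtain e where e: "ortho_seq H e" "\<forall>x\<in>carrier H. (\<forall>k. cinner H x (e k) = 0) \<longrightarrow> x = \<zero>"
    by (elim exE conjE)
  have "x = \<zero>" if "x \<in> carrier H" "\<And>k. cinner H x (e k) = 0" for x
    using e(2) that by simp
  from finite_dimensional_if_finite_ortho[OF e(1) this]
  have inf: "infinite {k. e k \<noteq> \<zero>}" using assms(2) by auto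
  define s where "s = enumerate {k. e k \<noteq> \<zero>}"
  have s: "strict_mono s" "\<And>n. e (s n) \<noteq> \<zero>"
    unfolding s_def using strict_mono_enumerate[OF inf] enumerate_in_set[OF inf] by auto
  define x where "x n = e (s n)" for n
  have xc: "x n \<in> carrier H" for n using e(1) unfolding x_def ortho_seq_def by blast
  have "s m \<noteq> s n" if "m \<noteq> n" for m n using strict_mono_eq[OF s(1)] that by simp
  then have xx: "cinner H (x m) (x n) = (if m = n then 1 else 0)" for m n
    using e(1) s(2) unfolding x_def ortho_seq_def by simp
  have norm: "(hnorm H (x n))\<^sup>2 = 1" for n using hnorm_square[OF xc] xx by simp
  have null: "(\<lambda>n. cinner H (x n) h) \<longlonglongrightarrow> 0" if h: "h \<in> carrier H" for h
  proof -
    have "(\<Sum>n\<le>N. (cmod (cinner H h (x n)))\<^sup>2) \<le> 3 * (hnorm H h)\<^sup>2" for N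
      using xc h norm xx by (intro Bessel_near_orthogonal[where e = "\<lambda>_. 0"]) auto
    then have "summable (\<lambda>n. (cmod (cinner H h (x n)))\<^sup>2)"
      by (intro bounded_imp_summable[where B = "3 * (hnorm H h)\<^sup>2"]) auto
    then have "(\<lambda>n. (cmod (cinner H h (x n)))\<^sup>2) \<longlonglongrightarrow> 0" by (rule summable_LIMSEQ_zero)
    then have "(\<lambda>n. sqrt ((cmod (cinner H h (x n)))\<^sup>2)) \<longlonglongrightarrow> sqrt 0" by (rule tendsto_real_sqrt)
    moreover have "cmod (cinner H h (x n)) = cmod (cinner H (x n) h)" for n
      using cinner_commute[OF xc h, of n] by simp
    ultimately show ?thesis by (simp add: tendsto_norm_zero_iff)
  qed
  have x: "x \<in> null_seqs"
  proof (rule null_seqsI[OF xc])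
    show "hnorm H (x n) \<le> 1" for n
      by (rule power2_le_imp_le) (simp_all add: norm)
  qed (rule tendsto_mono[OF G_free null])
  have "lim_inner x x = 1" using xx by (intro lim_inner_eqI) simp
  then have "coords x \<noteq> \<zero>\<^bsub>limit_space\<^esub>"
    using limit_space_cinner[OF x x] L.cinner_zero_left[of "coords x"] x by auto
  then show ?thesis using x by (intro bexI[of _ "coords x"]) auto
qed

lemma calkin_rep_image:
  assumes "T \<in> bounded_ops H"
  shows "\<exists>c\<in>carrier (calkin_algebra H). calkin_rep c = limit_op T"
  using calkin_rep_coset[OF assms] assms unfolding calkin_carrier by blast

lemma calkin_rep_cases:
  assumes "c \<in> carrier (calkin_algebra H)"
  obtains T where "T \<in> bounded_ops H" "calkin_rep c = limit_op T"
  using assms calkin_rep_coset unfolding calkin_carrier by blast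

lemma unit_multiple_exists:
  assumes "v \<in> carrier limit_space" "v \<noteq> \<zero>\<^bsub>limit_space\<^esub>"
  shows "\<exists>c. cinner limit_space (c \<odot>\<^bsub>limit_space\<^esub> v) (c \<odot>\<^bsub>limit_space\<^esub> v) = 1"
proof
  let ?c = "complex_of_real (inverse (hnorm limit_space v))"
  have "hnorm limit_space v > 0" using L.hnorm_eq_zero L.hnorm_nonneg assms by (metis less_eq_real_def)
  then have "hnorm limit_space (?c \<odot>\<^bsub>limit_space\<^esub> v) = 1"
    using assms(1) by (simp add: L.hnorm_smult norm_inverse del: of_real_inverse)
  then show "cinner limit_space (?c \<odot>\<^bsub>limit_space\<^esub> v) (?c \<odot>\<^bsub>limit_space\<^esub> v) = 1"
    using L.cinner_self[of "?c \<odot>\<^bsub>limit_space\<^esub> v"] assms(1) by simp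
qed

text \<open>
  If \<open>V\<close> is a proper non-zero closed invariant subspace, interpolation provides an operator whose image
  takes a unit vector \<open>f\<close> of \<open>V\<close> to a vector having inner product 1 with a unit vector \<open>g\<close> orthogonal to \<open>V\<close>.
\<close>

lemma calkin_rep_irreducible:
  assumes "u \<in> carrier limit_space" "u \<noteq> \<zero>\<^bsub>limit_space\<^esub>"
  shows "irreducible_rep (calkin_algebra H) limit_space calkin_rep"
  unfolding irreducible_rep_def
proof (intro conjI allI impI)
  obtain x where x: "x \<in> null_seqs" "u = coords x" using assms(1) by (rule limit_space_cases)
  obtain c where c: "c \<in> carrier (calkin_algebra H)" "calkin_rep c = limit_op (\<lambda>x\<in>carrier H. x)"
    using calkin_rep_image[OF bounded_ops_id] by blast
  have "calkin_rep c u = u"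
    unfolding c(2) x(2) limit_op_coords[OF bounded_ops_id x(1)] using seq_carrier[OF x(1)] by simp
  moreover have "\<zero>\<^bsub>op_algebra limit_space\<^esub> u = \<zero>\<^bsub>limit_space\<^esub>"
    using assms(1) by (simp add: op_algebra_def)
  ultimately have "calkin_rep c \<noteq> \<zero>\<^bsub>op_algebra limit_space\<^esub>" using assms(2) by metis
  then show "\<exists>c\<in>carrier (calkin_algebra H). calkin_rep c \<noteq> \<zero>\<^bsub>op_algebra limit_space\<^esub>"
    using c(1) by blast
next
  fix V
  assume "closed_subspace limit_space V \<and> (\<forall>c\<in>carrier (calkin_algebra H). calkin_rep c ` V \<subseteq> V)"
  then have V: "closed_subspace limit_space V"
    and inv: "\<And>c. c \<in> carrier (calkin_algebra H) \<Longrightarrow> calkin_rep c ` V \<subseteq> V" by auto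
  note Vc = L.closed_subspaceD[OF V]
  show "V = {\<zero>\<^bsub>limit_space\<^esub>} \<or> V = carrier limit_space"
  proof (rule ccontr)
    assume proper: "\<not> (V = {\<zero>\<^bsub>limit_space\<^esub>} \<or> V = carrier limit_space)"
    then obtain v where v: "v \<in> V" "v \<noteq> \<zero>\<^bsub>limit_space\<^esub>" using Vc(2) by blast
    obtain y where y: "y \<in> carrier limit_space" "y \<notin> V" using proper Vc(1) by blast
    obtain p where p: "p \<in> V" "\<And>z. z \<in> V \<Longrightarrow> cinner limit_space (y \<ominus>\<^bsub>limit_space\<^esub> p) z = 0"
      using L.projection[OF V y(1)] by blast
    define q where "q = y \<ominus>\<^bsub>limit_space\<^esub> p"
    have pL: "p \<in> carrier limit_space" using p(1) Vc(1) by blast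
    have q: "q \<in> carrier limit_space" "q \<noteq> \<zero>\<^bsub>limit_space\<^esub>"
      unfolding q_def using y p(1) pL L.minus_eq_zero_iff[OF y(1) pL] by auto
    have vL: "v \<in> carrier limit_space" using v(1) Vc(1) by blast
    obtain a where a: "cinner limit_space (a \<odot>\<^bsub>limit_space\<^esub> v) (a \<odot>\<^bsub>limit_space\<^esub> v) = 1"
      using unit_multiple_exists[OF vL v(2)] by blast
    obtain b where b: "cinner limit_space (b \<odot>\<^bsub>limit_space\<^esub> q) (b \<odot>\<^bsub>limit_space\<^esub> q) = 1"
      using unit_multiple_exists[OF q] by blast
    define f where "f = a \<odot>\<^bsub>limit_space\<^esub> v"
    define g where "g = b \<odot>\<^bsub>limit_space\<^esub> q"
    have fV: "f \<in> V" unfolding f_def using v(1) Vc(4) by blast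
    have fL: "f \<in> carrier limit_space" using fV Vc(1) by blast
    have gL: "g \<in> carrier limit_space" unfolding g_def using q(1) by simp
    have ff: "cinner limit_space f f = 1" and gg: "cinner limit_space g g = 1"
      using a b unfolding f_def g_def by auto
    have gV: "cinner limit_space g z = 0" if "z \<in> V" for z
      using p(2)[OF that] that Vc(1) q(1) unfolding g_def q_def[symmetric]
      by (auto simp: L.cinner_smult_left subset_iff)
    have gf: "cinner limit_space g f = 0" using gV[OF fV] .
    have fg: "cinner limit_space f g = 0" using L.cinner_commute[OF gL fL] gf by simp
    have nz: "f \<noteq> \<zero>\<^bsub>limit_space\<^esub>" "g \<noteq> \<zero>\<^bsub>limit_space\<^esub>"
      using ff gg L.cinner_zero_left[OF fL] L.cinner_zero_left[OF gL] by auto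
    define e where "e k = (if k = 0 then f else if k = 1 then g else \<zero>\<^bsub>limit_space\<^esub>)" for k :: nat
    have "ortho_seq limit_space e"
      unfolding ortho_seq_def e_def using fL gL ff gg fg gf nz by auto
    moreover define t :: "nat \<Rightarrow> nat \<Rightarrow> complex" where "t j k = (if j = 1 \<and> k = 0 then 1 else 0)" for j k
    have "matrix_bounded t 1"
      unfolding matrix_bounded_def
    proof (intro conjI allI)
      fix N and c d :: "nat \<Rightarrow> complex"
      have "matrix_form t N c d = (\<Sum>k\<le>N. if k = 0 then (\<Sum>j\<le>N. if j = 1 then c 0 * cnj (d 1) else 0) else 0)"
        unfolding matrix_form_def
      proof (rule sum.cong[OF refl])
        fix k
        show "(\<Sum>j\<le>N. t j k * c k * cnj (d j)) =
          (if k = 0 then (\<Sum>j\<le>N. if j = 1 then c 0 * cnj (d 1) else 0) else 0)"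
        proof (cases "k = 0")
          case True
          show ?thesis unfolding True if_True refl simp_thms by (intro sum.cong refl) (simp add: t_def)
        qed (simp add: t_def)
      qed
      also have "\<dots> = (if 1 \<le> N then c 0 * cnj (d 1) else 0)" by simp
      finally have "cmod (matrix_form t N c d) = (if 1 \<le> N then cmod (c 0) * cmod (d 1) else 0)"
        by (simp add: norm_mult)
      moreover have "cmod (c 0) \<le> L2_set (\<lambda>k. cmod (c k)) {..N}" by (rule member_le_L2_set) auto
      moreover have "cmod (d 1) \<le> L2_set (\<lambda>k. cmod (d k)) {..N}" if "1 \<le> N"
        using that by (intro member_le_L2_set) auto
      ultimately show "cmod (matrix_form t N c d) \<le>
          1 * L2_set (\<lambda>k. cmod (c k)) {..N} * L2_set (\<lambda>k. cmod (d k)) {..N}"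
        by (auto intro: mult_mono)
    qed simp
    ultimately obtain S where S: "S \<in> bounded_ops H" "\<forall>j k. e j \<noteq> \<zero>\<^bsub>limit_space\<^esub> \<longrightarrow>
        e k \<noteq> \<zero>\<^bsub>limit_space\<^esub> \<longrightarrow> cinner limit_space (limit_op S (e k)) (e j) = t j k"
      using matrix_interpolation by blast
    have one: "cinner limit_space (limit_op S f) g = 1"
      using S(2)[rule_format, of 1 0] nz unfolding e_def t_def by simp
    obtain c where c: "c \<in> carrier (calkin_algebra H)" "calkin_rep c = limit_op S"
      using calkin_rep_image[OF S(1)] by blast
    have SfV: "limit_op S f \<in> V" using inv[OF c(1)] fV unfolding c(2) by blast
    then have "cinner limit_space g (limit_op S f) = 0" by (rule gV)
    moreover have "limit_op S f \<in> carrier limit_space" using SfV Vc(1) by blast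
    ultimately have "cinner limit_space (limit_op S f) g = 0"
      using L.cinner_commute[OF gL] by simp
    then show False using one by simp
  qed
qed

text \<open>
  Given \<open>T\<close> on \<open>K\<close>, interpolate its matrix in an orthonormal basis of \<open>K\<close>; an operator on \<open>K\<close> is determined
  by its matrix.
\<close>

lemma calkin_rep_infinitely_transitive:
  "infinitely_transitive (calkin_algebra H) limit_space calkin_rep"
  unfolding infinitely_transitive_def
proof (intro allI impI)
  fix K assume K': "closed_subspace limit_space K \<and> separable (subspace_of limit_space K)"
  then have K: "closed_subspace limit_space K" by blast
  interpret S: hilbert_space "subspace_of limit_space K" using K by (rule L.subspace_of_hilbert_space)
  have simps: "carrier (subspace_of limit_space K) = K"
    "cinner (subspace_of limit_space K) = cinner limit_space"
    "zero (subspace_of limit_space K) = \<zero>\<^bsub>limit_space\<^esub>"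
    unfolding subspace_of_def by simp_all
  have KL: "z \<in> carrier limit_space" if "z \<in> K" for z
    using L.closed_subspaceD(1)[OF K] that by blast
  show "(\<lambda>c. compression limit_space K (calkin_rep c)) ` carrier (calkin_algebra H) =
    bounded_ops (subspace_of limit_space K)" (is "?A = ?B")
  proof
    show "?A \<subseteq> ?B"
    proof (rule image_subsetI)
      fix c assume "c \<in> carrier (calkin_algebra H)"
      then obtain T where "T \<in> bounded_ops H" "calkin_rep c = limit_op T" by (rule calkin_rep_cases)
      then show "compression limit_space K (calkin_rep c) \<in> ?B"
        using L.compression_bounded[OF K limit_op_bounded] by simp
    qed
    show "?B \<subseteq> ?A"
    proof
      fix T assume T: "T \<in> ?B"
      obtain e where e: "ortho_seq (subspace_of limit_space K) e"
        and tot: "\<forall>x\<in>K. (\<forall>k. cinner limit_space x (e k) = 0) \<longrightarrow> x = \<zero>\<^bsub>limit_space\<^esub>"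
        using S.ortho_seq_total_exists K' unfolding simps by blast
      have eK: "e k \<in> K" for k using e unfolding ortho_seq_def simps by blast
      have "ortho_seq limit_space e" using e KL unfolding ortho_seq_def simps by blast
      moreover define t where "t j k = cinner limit_space (T (e k)) (e j)" for j k
      obtain b where "matrix_bounded t b"
        using S.ortho_seq_matrix_bounded[OF e T] unfolding simps t_def[symmetric] by blast
      ultimately obtain R where R: "R \<in> bounded_ops H" "\<forall>j k. e j \<noteq> \<zero>\<^bsub>limit_space\<^esub> \<longrightarrow>
          e k \<noteq> \<zero>\<^bsub>limit_space\<^esub> \<longrightarrow> cinner limit_space (limit_op R (e k)) (e j) = t j k"
        using matrix_interpolation by blast
      let ?C = "compression limit_space K (limit_op R)"
      have C: "?C \<in> ?B" using L.compression_bounded[OF K limit_op_bounded[OF R(1)]] .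
      have zero: "W \<zero>\<^bsub>limit_space\<^esub> = \<zero>\<^bsub>limit_space\<^esub>" if W: "W \<in> ?B" for W
      proof -
        have null: "0 \<odot>\<^bsub>subspace_of limit_space K\<^esub> z = \<zero>\<^bsub>subspace_of limit_space K\<^esub>"
          if "z \<in> carrier (subspace_of limit_space K)" for z
          using S.smult_l_null[of z] that by simp
        have "W \<zero>\<^bsub>subspace_of limit_space K\<^esub> =
            0 \<odot>\<^bsub>subspace_of limit_space K\<^esub> W \<zero>\<^bsub>subspace_of limit_space K\<^esub>"
          using S.bounded_opsD(4)[OF W S.M.zero_closed, of 0] null[OF S.M.zero_closed] by (simp only:)
        also have "\<dots> = \<zero>\<^bsub>subspace_of limit_space K\<^esub>"
          by (rule null[OF S.bounded_opsD(1)[OF W S.M.zero_closed]])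
        finally show ?thesis unfolding simps(3) .
      qed
      have "cinner limit_space (?C (e k)) (e j) = cinner limit_space (T (e k)) (e j)" for j k
      proof (cases "e j = \<zero>\<^bsub>limit_space\<^esub> \<or> e k = \<zero>\<^bsub>limit_space\<^esub>")
        case True
        have "?C (e k) \<in> carrier limit_space" "T (e k) \<in> carrier limit_space"
          using S.bounded_opsD(1)[OF C] S.bounded_opsD(1)[OF T] eK KL unfolding simps by blast+
        then show ?thesis using True zero[OF C] zero[OF T] by auto
      next
        case False
        then show ?thesis
          using L.cinner_compression[OF K limit_op_bounded[OF R(1)] eK eK] R(2)
          unfolding t_def by simp
      qed
      then have "?C = T"
        using eK tot by (intro S.operator_eq_by_matrix[OF C T, of e]) (simp_all add: simps)
      moreover obtain c where "c \<in> carrier (calkin_algebra H)" "calkin_rep c = limit_op R"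
        using calkin_rep_image[OF R(1)] by blast
      ultimately show "T \<in> ?A" by (metis image_eqI)
    qed
  qed
qed

end

section \<open>Existence of the filter\<close>

lemma convergent_along_infinite_subset:
  fixes c :: "nat \<Rightarrow> complex"
  assumes "infinite A" "\<And>n. cmod (c n) \<le> b"
  shows "\<exists>Y\<subseteq>A. infinite Y \<and> (\<exists>l. (c \<longlongrightarrow> l) (inf sequentially (principal Y)))"
proof -
  have "bounded (range (\<lambda>i. c (enumerate A i)))" using assms(2) by (auto simp: bounded_iff)
  then obtain l r where r: "strict_mono r" "((\<lambda>i. c (enumerate A i)) \<circ> r) \<longlonglongrightarrow> l"
    using bounded_imp_convergent_subsequence by blast
  define s where "s = enumerate A \<circ> r"
  have s: "strict_mono s"
    unfolding s_def using strict_mono_enumerate[OF assms(1)] r(1) by (rule strict_mono_o)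
  have "(c \<longlongrightarrow> l) (inf sequentially (principal (range s)))"
  proof (rule tendstoI)
    fix e :: real assume "e > 0"
    then obtain N where N: "\<And>i. i \<ge> N \<Longrightarrow> dist (c (s i)) l < e"
      using tendstoD[OF r(2)] unfolding s_def eventually_sequentially by auto
    have "\<forall>\<^sub>F n in sequentially. s N \<le> n" by (rule eventually_ge_at_top)
    then have "\<forall>\<^sub>F n in sequentially. n \<in> range s \<longrightarrow> dist (c n) l < e"
      by eventually_elim (use N s in \<open>auto simp: strict_mono_less_eq\<close>)
    then show "\<forall>\<^sub>F n in inf sequentially (principal (range s)). dist (c n) l < e"
      by (simp add: eventually_inf_principal)
  qed
  moreover have "range s \<subseteq> A" unfolding s_def using enumerate_in_set[OF assms(1)] by auto
  moreover have "infinite (range s)" using s by (simp add: range_inj_infinite strict_mono_imp_inj_on)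
  ultimately show ?thesis by blast
qed

text \<open>
  Real numbers and sets of natural numbers are equinumerous, and a sequence of complex numbers, that is
  of pairs of sets of natural numbers, is coded by one set of natural numbers.
\<close>

lemma seq_lepoll_real: "(UNIV :: (nat \<Rightarrow> complex) set) \<lesssim> (UNIV :: real set)"
proof -
  obtain g :: "real \<Rightarrow> nat set" where g: "inj g"
    using eqpoll_imp_lepoll[OF eqpoll_sym[OF nat_sets_eqpoll_reals]] unfolding lepoll_def by blast
  obtain h :: "nat set \<Rightarrow> real" where h: "inj h"
    using eqpoll_imp_lepoll[OF nat_sets_eqpoll_reals] unfolding lepoll_def by blast
  define E where "E = (\<lambda>x :: nat \<Rightarrow> complex. h ({prod_encode (2 * n, m) |n m. m \<in> g (Re (x n))} \<union>
    {prod_encode (2 * n + 1, m) |n m. m \<in> g (Im (x n))}))"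
  have "inj E"
  proof (rule injI)
    fix x y assume "E x = E y"
    then have e: "{prod_encode (2 * n, m) |n m. m \<in> g (Re (x n))} \<union>
      {prod_encode (2 * n + 1, m) |n m. m \<in> g (Im (x n))} =
      {prod_encode (2 * n, m) |n m. m \<in> g (Re (y n))} \<union>
      {prod_encode (2 * n + 1, m) |n m. m \<in> g (Im (y n))}"
      unfolding E_def by (rule injD[OF h])
    have odd: "2 * n \<noteq> Suc (2 * k)" for n k :: nat by presburger
    have "m \<in> g (Re (x n)) \<longleftrightarrow> m \<in> g (Re (y n))" for m n
      using arg_cong[OF e, of "\<lambda>S. prod_encode (2 * n, m) \<in> S"] by (simp add: odd)
    moreover have "m \<in> g (Im (x n)) \<longleftrightarrow> m \<in> g (Im (y n))" for m n
      using arg_cong[OF e, of "\<lambda>S. prod_encode (2 * n + 1, m) \<in> S"] odd by (simp add: eq_commute)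
    ultimately have "g (Re (x n)) = g (Re (y n)) \<and> g (Im (x n)) = g (Im (y n))" for n
      by blast
    then have "Re (x n) = Re (y n) \<and> Im (x n) = Im (y n)" for n
      using g by (meson injD)
    then show "x = y" by (simp add: complex_eq_iff fun_eq_iff)
  qed
  then show ?thesis unfolding lepoll_def by (intro exI[of _ E]) simp
qed

context hilbert_space
begin

text \<open>
  A vector is determined by its countably many inner products with a total orthonormal sequence.
\<close>

lemma arrays_lepoll_real:
  assumes "separable H"
  shows "{x :: nat \<Rightarrow> nat \<Rightarrow> 'a. \<forall>k n. x k n \<in> carrier H} \<lesssim> (UNIV :: real set)"
proof -
  obtain e where e: "ortho_seq H e" "\<forall>x\<in>carrier H. (\<forall>k. cinner H x (e k) = 0) \<longrightarrow> x = \<zero>"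
    using ortho_seq_total_exists[OF assms] by blast
  have eH: "e k \<in> carrier H" for k using e unfolding ortho_seq_def by blast
  let ?A = "{x :: nat \<Rightarrow> nat \<Rightarrow> 'a. \<forall>k n. x k n \<in> carrier H}"
  define E where "E x i = (case prod_decode i of (k, p) \<Rightarrow> case prod_decode p of (n, j) \<Rightarrow>
    cinner H (x k n) (e j))" for x :: "nat \<Rightarrow> nat \<Rightarrow> 'a" and i
  have "inj_on E ?A"
  proof (rule inj_onI)
    fix x y assume x: "x \<in> ?A" and y: "y \<in> ?A" and eq: "E x = E y"
    have "x k n = y k n" for k n
    proof -
      have c: "x k n \<in> carrier H" "y k n \<in> carrier H" using x y by auto
      have "cinner H (x k n) (e j) = cinner H (y k n) (e j)" for j
        using fun_cong[OF eq, of "prod_encode (k, prod_encode (n, j))"] unfolding E_def by simp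
      then have "x k n \<ominus> y k n = \<zero>" using e(2) c eH by (simp add: cinner_diff_left)
      then show ?thesis using minus_eq_zero_iff[OF c] by blast
    qed
    then show "x = y" by blast
  qed
  then have "?A \<lesssim> (UNIV :: (nat \<Rightarrow> complex) set)" unfolding lepoll_def by blast
  then show ?thesis using seq_lepoll_real by (rule lepoll_trans)
qed

text \<open>
  The \<open>r\<close>-th dense family settles two questions about the array \<open>w r\<close>: convergence of the inner products
  of its first two rows, and near orthogonality. Every infinite set has an infinite subset settling the
  first question by compactness of bounded sets of complex numbers, and then one settling the second
  question because a set without a nearly orthogonal subset is itself acceptable.
\<close>

lemma generic_sequences_exist:
  assumes "separable H" continuum_hypothesis
  shows "\<exists>G w. generic_sequences H G w"
proof -
  let ?A = "{x :: nat \<Rightarrow> nat \<Rightarrow> 'a. \<forall>k n. x k n \<in> carrier H}"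
  obtain \<phi> :: "(nat \<Rightarrow> nat \<Rightarrow> 'a) \<Rightarrow> real" where \<phi>: "inj_on \<phi> ?A"
    using arrays_lepoll_real[OF assms(1)] unfolding lepoll_def by blast
  define w where "w = inv_into ?A \<phi>"
  have w: "\<exists>r. w r = x" if "\<And>k n. x k n \<in> carrier H" for x
    unfolding w_def using inv_into_f_f[OF \<phi>, of x] that by blast
  define decided where "decided x Z \<longleftrightarrow> near_orthogonal H x Z \<or>
    (\<forall>Y\<subseteq>Z. infinite Y \<longrightarrow> \<not> near_orthogonal H x Y)" for x :: "nat \<Rightarrow> nat \<Rightarrow> 'a" and Z
  define D where "D r = {Z. decided (w r) Z \<and> (bounded_seq H (w r 0) \<and> bounded_seq H (w r 1) \<longrightarrow>
    (\<exists>l. ((\<lambda>n. cinner H (w r 0 n) (w r 1 n)) \<longlongrightarrow> l) (inf sequentially (principal Z))))}" for r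
  have dense: "\<exists>Y\<subseteq>A. infinite Y \<and> Y \<in> D r" if "infinite A" for r A
  proof -
    have "\<exists>Y\<subseteq>A. infinite Y \<and> (bounded_seq H (w r 0) \<and> bounded_seq H (w r 1) \<longrightarrow>
      (\<exists>l. ((\<lambda>n. cinner H (w r 0 n) (w r 1 n)) \<longlongrightarrow> l) (inf sequentially (principal Y))))"
    proof (cases "bounded_seq H (w r 0) \<and> bounded_seq H (w r 1)")
      case True
      then obtain a b where c: "\<And>n. w r 0 n \<in> carrier H" "\<And>n. w r 1 n \<in> carrier H"
        and ab: "\<And>n. hnorm H (w r 0 n) \<le> a" "\<And>n. hnorm H (w r 1 n) \<le> b"
        unfolding bounded_seq_def by blast
      have "cmod (cinner H (w r 0 n) (w r 1 n)) \<le> a * b" for n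
        using order_trans[OF Cauchy_Schwarz[OF c] mult_mono[OF ab]] hnorm_nonneg[OF c(2)]
          order_trans[OF hnorm_nonneg[OF c(1)] ab(1)] by blast
      from convergent_along_infinite_subset[where c = "\<lambda>n. cinner H (w r 0 n) (w r 1 n)", OF that this]
      obtain Y l where "Y \<subseteq> A" "infinite Y"
        "((\<lambda>n. cinner H (w r 0 n) (w r 1 n)) \<longlongrightarrow> l) (inf sequentially (principal Y))"
        by (elim exE conjE)
      then show ?thesis by (intro exI[of _ Y] conjI impI exI[of _ l])
    next
      case False
      then show ?thesis using that by blast
    qed
    then obtain Y where Y: "Y \<subseteq> A" "infinite Y"
      "bounded_seq H (w r 0) \<and> bounded_seq H (w r 1) \<longrightarrow>
        (\<exists>l. ((\<lambda>n. cinner H (w r 0 n) (w r 1 n)) \<longlongrightarrow> l) (inf sequentially (principal Y)))" by blast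
    obtain Z where Z: "Z \<subseteq> Y" "infinite Z" "decided (w r) Z"
    proof (cases "\<exists>Z\<subseteq>Y. infinite Z \<and> near_orthogonal H (w r) Z")
      case True
      then show ?thesis using that unfolding decided_def by blast
    next
      case False
      then show ?thesis using that[of Y] Y(2) unfolding decided_def by blast
    qed
    have le: "inf sequentially (principal Z) \<le> inf sequentially (principal Y)"
      using Z(1) by (intro inf_mono) auto
    have "Z \<in> D r" unfolding D_def using Y(3) Z(3) tendsto_mono[OF le] by blast
    moreover have "Z \<subseteq> A" using Z(1) Y(1) by (rule subset_trans)
    ultimately show ?thesis using Z(2) by (intro exI[of _ Z] conjI)
  qed
  obtain G where G: "G \<noteq> bot" "G \<le> sequentially" "\<And>r. \<exists>Z\<in>D r. eventually (\<lambda>n. n \<in> Z) G"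
    by (rule generic_filter[where D = D, OF assms(2)]) (erule dense, rule that)
  have "generic_sequences H G w"
  proof
    fix y z assume yz: "bounded_seq H y" "bounded_seq H z"
    define x where "x k = (if k = 0 then y else z)" for k :: nat
    have "x k n \<in> carrier H" for k n using yz unfolding bounded_seq_def x_def by auto
    from w[OF this] obtain r where r: "w r = x" by (rule exE)
    obtain Z where Z: "Z \<in> D r" "eventually (\<lambda>n. n \<in> Z) G" using G(3) by blast
    have "G \<le> inf sequentially (principal Z)" using G(2) Z(2) by (simp add: le_principal)
    moreover obtain l where "((\<lambda>n. cinner H (y n) (z n)) \<longlongrightarrow> l) (inf sequentially (principal Z))"
      using Z(1) yz unfolding D_def r by (auto simp: x_def)
    ultimately show "\<exists>l. ((\<lambda>n. cinner H (y n) (z n)) \<longlongrightarrow> l) G" using tendsto_mono by blast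
  next
    fix x :: "nat \<Rightarrow> nat \<Rightarrow> 'a" assume x: "\<And>k n. x k n \<in> carrier H"
    show "\<exists>r. w r = x" using w[OF x] .
    then obtain r where r: "w r = x" by blast
    obtain Z where "Z \<in> D r" "eventually (\<lambda>n. n \<in> Z) G" using G(3) by blast
    then show "\<exists>Z. eventually (\<lambda>n. n \<in> Z) G \<and>
        (near_orthogonal H x Z \<or> (\<forall>Y\<subseteq>Z. infinite Y \<longrightarrow> \<not> near_orthogonal H x Y))"
      unfolding D_def decided_def r by blast
  qed (use G in auto)
  then show ?thesis by blast
qed

end

theorem theorem2:
  fixes H :: "'a inner_space"
  assumes "hilbert_space H"
    and "separable H"
    and "\<not> finite_dimensional H"
    and "continuum_hypothesis"
  shows "\<exists>(L :: (real \<Rightarrow> complex) inner_space) \<pi>.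
    star_representation (calkin_algebra H) L \<pi> \<and>
    irreducible_rep (calkin_algebra H) L \<pi> \<and>
    infinitely_transitive (calkin_algebra H) L \<pi>"
proof -
  obtain G w where "generic_sequences H G w"
    using hilbert_space.generic_sequences_exist[OF assms(1,2,4)] by blast
  then interpret generic_sequences H G w .
  obtain u where "u \<in> carrier limit_space" "u \<noteq> \<zero>\<^bsub>limit_space\<^esub>"
    using limit_space_nontrivial[OF assms(2,3)] by blast
  then show ?thesis
    using calkin_rep_star_representation calkin_rep_irreducible calkin_rep_infinitely_transitive by blast
qed

end
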